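(* Let $N\geqslant1$. For every $d\geqslant1$ and every $k\geqslant d-1$, the family $$\big\{\det\Delta_0(\underline{\underline{\alpha}})\ :\ \underline{\underline{\alpha}}\in\mathcal{B}^{N+},\ M(\underline{\underline{\alpha}})\leqslant d-1\big\},$$ of cardinality $(N+1)^d$, is a basis of $H^0\big(\mathbb{P}^N,\ \bigoplus_{n=0}^{\infty}E^{\mathrm{GG}}_{k,n}\otimes\mathcal{O}(d)\big)$.
   Context: Let $[X_0:\dots:X_N]$ be homogeneous coordinates on $\mathbb{P}^N=\mathbb{P}^N(\mathbb{C})$ and $U_i=\{X_i\neq 0\}$, with affine coordinates $X_j/X_i$ ($j\neq i$); on $U_0$ write $x_{0j}=X_j/X_0$. Green-Griffiths bundle $E^{\mathrm{GG}}_{k,n}$ (jet order $k$, weight $n$): in a chart with coordinates $(x_1,\dots,x_N)$, introduce formal jet variables $x_i^{(l)}$, $1\leqslant l\leqslant k$, of weight $l$. A local holomorphic section over an open set $V$ of the chart is a polynomial in these jet variables, with coefficients holomorphic on $V$, all of whose monomials have weight $n$. If $y_t=\Psi_t(x_1,\dots,x_N)$ is a change of charts, $y_t^{(l)}$ is identified with $(\Psi_t(x_1,\dots,x_N))^{(l)}$, computed by formal differentiation with the chain rule. A global section of $\bigoplus_{n\geqslant0}E^{\mathrm{GG}}_{k,n}\otimes\mathcal{O}(d)$ is a tuple $(s_0,\dots,s_N)$, with $s_i$ a polynomial in the jet variables of $U_i$ with coefficients holomorphic on $U_i$, such that $s_i=(X_j/X_i)^d s_j$ on $U_i\cap U_j$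 after the change of charts. A global section is identified with its component $s_0$ over $U_0$ (which determines it); a polynomial $P$ in the variables $x_{0i}^{(l)}$, $0\leqslant l\leqslant k$, is regarded as a global section when there is one with $s_0=P$. $\mathcal{B}^{N+}$ is the set of $N$-tuples $\underline{\underline{\alpha}}=(\underline{\alpha}^1,\dots,\underline{\alpha}^N)$ of finite (possibly empty) strictly increasing sequences $\underline{\alpha}^j=(\alpha^j_1<\dots<\alpha^j_{n_j})$ of integers $\geqslant 0$ such that, with $s_{N+1}=0$ and $s_j=n_N+\dots+n_j$, one has $\alpha^j_i\geqslant s_{j+1}$ for all $j,i$. $M(\underline{\underline{\alpha}})=\max_{j,i}\alpha^j_i$, with $M=-1$ if all sequences are empty. The column $\mathcal{C}_\alpha(\chi)$ has $l$-th entry $\binom{\alpha}{l-1}\chi^{(\alpha-l+1)}$ ($l\geqslant 1$), interpreted as $0$ if $l-1>\alpha$. $\Delta_0(\underline{\underline{\alpha}})$ is the square matrix of size $s_1=n_1+\dots+n_N$ with columns, from left to right, $\mathcal{C}_{\alpha^N_1}(x_{0N}),\dots,\mathcal{C}_{\alpha^N_{n_N}}(x_{0N}),\mathcal{C}_{\alpha^{N-1}_1}(x_{0,N-1}),\dots,\mathcal{C}_{\alpha^1_{n_1}}(x_{01})$, truncated to length $s_1$. The empty determinant is $1$. *)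

theory Defs
  imports
    "HOL-Analysis.Analysis"
    "HOL-Library.Function_Algebras"
    "Jordan_Normal_Form.Determinant"
begin

text \<open>
  The chart \<open>U\<^sub>i\<close> of \<open>\<bbbP>\<^sup>N\<close> is identified with affine \<open>N\<close>-space through the coordinates
  \<open>x\<^sub>i\<^sub>j = X\<^sub>j/X\<^sub>i\<close>, \<open>j \<in> {0..N} - {i}\<close>.  A jet \<open>\<xi>\<close> over \<open>U\<^sub>i\<close> assigns to \<open>\<xi> j l\<close> the value of
  \<open>x\<^sub>i\<^sub>j\<^sup>(\<^sup>l\<^sup>)\<close>; order \<open>l = 0\<close> is the base point.  Polynomials in the jet variables are represented
  by the functions of \<open>\<xi>\<close> they define (the ground field is infinite, so nothing is lost).  Entries
  \<open>\<xi> j l\<close> whose index \<open>j\<close> is not a coordinate of the chart are junk, on which sections do not depend.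
\<close>

type_synonym jet = "nat \<Rightarrow> nat \<Rightarrow> complex"

definition chart :: "nat \<Rightarrow> nat \<Rightarrow> nat set" where
  "chart N i = {0..N} - {i}"

text \<open>
  Holomorphic functions of the finitely many variables indexed by \<open>I\<close>, defined on all of
  \<open>\<complex>\<^sup>I\<close>: continuous, and holomorphic in each variable separately.  Continuity is for the product
  topology, which is the usual one because the function depends on the variables in \<open>I\<close> only.
\<close>

definition holomorphic_in :: "nat set \<Rightarrow> ((nat \<Rightarrow> complex) \<Rightarrow> complex) \<Rightarrow> bool" where
  "holomorphic_in I c \<longleftrightarrow>
     (\<forall>x y. (\<forall>j\<in>I. x j = y j) \<longrightarrow> c x = c y) \<and>
     continuous_on UNIV c \<and>
     (\<forall>x. \<forall>j\<in>I. (\<lambda>z. c (x(j := z))) holomorphic_on UNIV)"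

definition jet_monomial :: "nat set \<Rightarrow> nat \<Rightarrow> (nat \<Rightarrow> nat \<Rightarrow> nat) \<Rightarrow> jet \<Rightarrow> complex" where
  "jet_monomial I k e \<xi> = (\<Prod>j\<in>I. \<Prod>l=1..k. \<xi> j l ^ e j l)"

definition jet_weight :: "nat set \<Rightarrow> nat \<Rightarrow> (nat \<Rightarrow> nat \<Rightarrow> nat) \<Rightarrow> nat" where
  "jet_weight I k e = (\<Sum>j\<in>I. \<Sum>l=1..k. l * e j l)"

text \<open>Sections over the whole chart \<open>U\<^sub>i\<close> of the bundle of jet order \<open>k\<close> and weight \<open>n\<close>.\<close>

definition GG_section :: "nat \<Rightarrow> nat \<Rightarrow> nat \<Rightarrow> nat \<Rightarrow> (jet \<Rightarrow> complex) \<Rightarrow> bool" where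
  "GG_section N k n i f \<longleftrightarrow>
     (\<exists>E c. finite E \<and>
        (\<forall>e\<in>E. jet_weight (chart N i) k e = n \<and> holomorphic_in (chart N i) (c e)) \<and>
        f = (\<lambda>\<xi>. \<Sum>e\<in>E. c e (\<lambda>j. \<xi> j 0) * jet_monomial (chart N i) k e \<xi>))"

definition GG_sum_section :: "nat \<Rightarrow> nat \<Rightarrow> nat \<Rightarrow> (jet \<Rightarrow> complex) \<Rightarrow> bool" where
  "GG_sum_section N k i f \<longleftrightarrow>
     (\<exists>m g. (\<forall>n\<le>m. GG_section N k n i (g n)) \<and> f = (\<lambda>\<xi>. \<Sum>n\<le>m. g n \<xi>))"

definition jet_partial :: "nat \<Rightarrow> nat \<Rightarrow> (jet \<Rightarrow> complex) \<Rightarrow> jet \<Rightarrow> complex" where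
  "jet_partial m p f \<xi> = deriv (\<lambda>z. f (\<xi>(m := (\<xi> m)(p := z)))) (\<xi> m p)"

text \<open>
  \<open>formal_deriv I f l\<close> is \<open>f\<^sup>(\<^sup>l\<^sup>)\<close> for a function \<open>f\<close> of the order-zero variables indexed by \<open>I\<close>.
  The derivative \<open>f\<^sup>(\<^sup>l\<^sup>)\<close> involves variables of order at most \<open>l\<close>, whence the range of \<open>p\<close> in the
  chain rule.
\<close>

primrec formal_deriv :: "nat set \<Rightarrow> (jet \<Rightarrow> complex) \<Rightarrow> nat \<Rightarrow> jet \<Rightarrow> complex" where
  "formal_deriv I f 0 = f"
| "formal_deriv I f (Suc l) =
     (\<lambda>\<xi>. \<Sum>m\<in>I. \<Sum>p\<le>l. jet_partial m p (formal_deriv I f l) \<xi> * \<xi> m (Suc p))"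

text \<open>
  The change of charts: \<open>X\<^sub>m/X\<^sub>j\<close> expressed in the coordinates of \<open>U\<^sub>i\<close>, and the induced map sending
  a jet over \<open>U\<^sub>i \<inter> U\<^sub>j\<close>, written in \<open>U\<^sub>i\<close>, to the same jet written in \<open>U\<^sub>j\<close>.
\<close>

definition coord_change :: "nat \<Rightarrow> nat \<Rightarrow> nat \<Rightarrow> jet \<Rightarrow> complex" where
  "coord_change i j m \<xi> = (if m = i then 1 else \<xi> m 0) / \<xi> j 0"

definition jet_change :: "nat \<Rightarrow> nat \<Rightarrow> nat \<Rightarrow> jet \<Rightarrow> jet" where
  "jet_change N i j \<xi> = (\<lambda>m l. formal_deriv (chart N i) (coord_change i j m) l \<xi>)"

definition global_section :: "nat \<Rightarrow> nat \<Rightarrow> nat \<Rightarrow> (nat \<Rightarrow> jet \<Rightarrow> complex) \<Rightarrow> bool" where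
  "global_section N k d s \<longleftrightarrow>
     (\<forall>i\<le>N. GG_sum_section N k i (s i)) \<and>
     (\<forall>i\<le>N. \<forall>j\<le>N. i \<noteq> j \<longrightarrow>
        (\<forall>\<xi>. \<xi> j 0 \<noteq> 0 \<longrightarrow> s i \<xi> = (\<xi> j 0) ^ d * s j (jet_change N i j \<xi>)))"

text \<open>A global section is identified with its component over \<open>U\<^sub>0\<close>.\<close>

definition GG_H0 :: "nat \<Rightarrow> nat \<Rightarrow> nat \<Rightarrow> (jet \<Rightarrow> complex) set" where
  "GG_H0 N k d = {s 0 |s. global_section N k d s}"

definition jscale :: "complex \<Rightarrow> (jet \<Rightarrow> complex) \<Rightarrow> jet \<Rightarrow> complex" where
  "jscale a f = (\<lambda>\<xi>. a * f \<xi>)"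

interpretation jetfun: vector_space jscale
  by unfold_locales (auto simp: jscale_def fun_eq_iff algebra_simps)

text \<open>
  Tuples of sequences are functions \<open>\<alpha>\<close> with \<open>\<alpha> j\<close> the list of entries of the \<open>j\<close>-th sequence for
  \<open>1 \<le> j \<le> N\<close>, and empty for other \<open>j\<close>; \<open>seq_s N \<alpha> j\<close> is \<open>s\<^sub>j\<close>.
\<close>

definition seq_s :: "nat \<Rightarrow> (nat \<Rightarrow> nat list) \<Rightarrow> nat \<Rightarrow> nat" where
  "seq_s N \<alpha> j = (\<Sum>m=j..N. length (\<alpha> m))"

definition BNplus :: "nat \<Rightarrow> (nat \<Rightarrow> nat list) set" where
  "BNplus N = {\<alpha>. (\<forall>j. j \<notin> {1..N} \<longrightarrow> \<alpha> j = []) \<and>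
     (\<forall>j\<in>{1..N}. sorted_wrt (<) (\<alpha> j) \<and> (\<forall>a\<in>set (\<alpha> j). a \<ge> seq_s N \<alpha> (j + 1)))}"

text \<open>The maximal entry, taken to be \<open>-1\<close> if all sequences are empty.\<close>

definition max_entry :: "nat \<Rightarrow> (nat \<Rightarrow> nat list) \<Rightarrow> int" where
  "max_entry N \<alpha> = Max (insert (-1) (int ` (\<Union>j\<in>{1..N}. set (\<alpha> j))))"

text \<open>
  Rows are numbered from \<open>0\<close>, so that \<open>column_entry a j r \<xi>\<close> is the entry number \<open>r + 1\<close> of the
  column \<open>\<C>\<^sub>a(x\<^sub>0\<^sub>j)\<close>; the binomial coefficient vanishes for \<open>r > a\<close>.
\<close>

definition column_entry :: "nat \<Rightarrow> nat \<Rightarrow> nat \<Rightarrow> jet \<Rightarrow> complex" where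
  "column_entry a j r \<xi> = of_nat (a choose r) * \<xi> j (a - r)"

text \<open>The columns of the matrix from left to right, as pairs of \<open>j\<close> and an entry of \<open>\<alpha> j\<close>.\<close>

definition column_list :: "nat \<Rightarrow> (nat \<Rightarrow> nat list) \<Rightarrow> (nat \<times> nat) list" where
  "column_list N \<alpha> = concat (map (\<lambda>j. map (Pair j) (\<alpha> j)) (rev [1..<Suc N]))"

definition Delta0 :: "nat \<Rightarrow> (nat \<Rightarrow> nat list) \<Rightarrow> jet \<Rightarrow> complex Matrix.mat" where
  "Delta0 N \<alpha> \<xi> = Matrix.mat (seq_s N \<alpha> 1) (seq_s N \<alpha> 1)
     (\<lambda>(r, c). case column_list N \<alpha> ! c of (j, a) \<Rightarrow> column_entry a j r \<xi>)"

definition det_Delta0 :: "nat \<Rightarrow> (nat \<Rightarrow> nat list) \<Rightarrow> jet \<Rightarrow> complex" where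
  "det_Delta0 N \<alpha> = (\<lambda>\<xi>. Determinant.det (Delta0 N \<alpha> \<xi>))"

end

theory Submission
  imports Defs
    "HOL-Complex_Analysis.Cauchy_Integral_Formula"
    "HOL-Computational_Algebra.Fundamental_Theorem_Algebra"
begin

text \<open>
  A global section is a function \<open>F\<close> of the jets of the homogeneous coordinates with
  \<open>F(\<lambda>X) = \<lambda>\<^sub>0\<^sup>d F(X)\<close> for every jet \<open>\<lambda>\<close>; Liouville's theorem, applied along the order-zero variables,
  shows that \<open>F\<close> is a polynomial, homogeneous of degree \<open>d\<close>.  Split \<open>F\<close> according to its degrees
  \<open>n\<^sub>j\<close> in the \<open>X\<^sub>j\<close> and evaluate each part at \<open>X\<^sub>0 = 1\<close>, \<open>X\<^sub>j = \<Prod>\<^sub>i (1 - w\<^sub>j\<^sub>i t)\<^sup>-\<^sup>1\<close> with \<open>n\<^sub>j\<close> factors.  The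
  result determines \<open>F\<close>, and its part of lexicographically largest degree in \<open>w\<^sub>N, \<dots>, w\<^sub>1\<close> has
  degree at most \<open>n\<^sub>0 + \<dots> + n\<^sub>j\<^sub>-\<^sub>1\<close> in each \<open>w\<^sub>j\<^sub>i\<close>: multiply all coordinates by \<open>1 - w\<^sub>j\<^sub>i t\<close>.
  As it is symmetric in each block of variables, \<open>F\<close> is determined by as many coefficients as there
  are index tuples.  On the other side the determinants lie in the space, since multiplication of the
  \<open>X\<^sub>j\<close> by \<open>\<lambda>\<close> multiplies the matrix by a triangular one, and they are independent, since their diagonal
  terms are distinct monomials that are minimal for a suitable weight.
\<close>

section \<open>Polynomial functions in finitely many variables\<close>

text \<open>The degree bound in block \<open>j\<close> uses multiplication of
  \<open>X\<^sub>0, ..., X\<^sub>j\<close> alone, whereas a section is only invariant when all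
  coordinates are multiplied together. Passing to the top part for a block frees its coordinate from
  the multiplication; hence the lexicographic order, taken from block \<open>N\<close> downwards.
  Block \<open>j\<close> itself does not enter the bound because its factor in the variable
  considered is cancelled. The numbers fit the index tuples as follows. With
  \<open>n 0 + ... + n N = d\<close> the bound for block \<open>j\<close> is \<open>d\<close> minus
  the total size of the blocks \<open>j, ..., N\<close>. Sort the \<open>n j\<close> exponents and
  add to the one in position \<open>i\<close> (from 0) the number \<open>i\<close> and the total
  size of the blocks after \<open>j\<close>: the result is a strictly increasing sequence whose last
  entry is at most \<open>d - 1\<close>. The coefficients of the determinants are never computed.
  Functionals and determinants are indexed by the same set, and a combination of determinants killed
  by all functionals is zero, so by independence the square matrix of values is invertible.\<close>

definition mon :: "'v set \<Rightarrow> ('v \<Rightarrow> nat) \<Rightarrow> ('v \<Rightarrow> complex) \<Rightarrow> complex" where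
  "mon V e x = (\<Prod>v\<in>V. x v ^ e v)"

text \<open>Exponents are forced to be 0 outside \<open>V\<close>, so that distinct exponent
  functions give distinct monomials and coefficients become unique.\<close>

definition exps :: "'v set \<Rightarrow> ('v \<Rightarrow> nat) set" where
  "exps V = {e. \<forall>v. v \<notin> V \<longrightarrow> e v = 0}"

definition polyf :: "'v set \<Rightarrow> (('v \<Rightarrow> complex) \<Rightarrow> complex) \<Rightarrow> bool" where
  "polyf V f \<longleftrightarrow> (\<exists>E a. finite E \<and> E \<subseteq> exps V \<and> f = (\<lambda>x. \<Sum>e\<in>E. a e * mon V e x))"

definition is_cf :: "'v set \<Rightarrow> (('v \<Rightarrow> complex) \<Rightarrow> complex) \<Rightarrow> (('v \<Rightarrow> nat) \<Rightarrow> complex) \<Rightarrow> bool" where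
  "is_cf V f a \<longleftrightarrow> finite {e. a e \<noteq> 0} \<and> {e. a e \<noteq> 0} \<subseteq> exps V \<and>
     f = (\<lambda>x. \<Sum>e | a e \<noteq> 0. a e * mon V e x)"

text \<open>Polynomials are kept as functions and their coefficients are recovered by choice. For
  \<open>polyf V f\<close> the choice is unique by \<open>mon_indep\<close>; otherwise the value is
  arbitrary.\<close>

definition cf :: "'v set \<Rightarrow> (('v \<Rightarrow> complex) \<Rightarrow> complex) \<Rightarrow> ('v \<Rightarrow> nat) \<Rightarrow> complex" where
  "cf V f = (SOME a. is_cf V f a)"

definition supp :: "'v set \<Rightarrow> (('v \<Rightarrow> complex) \<Rightarrow> complex) \<Rightarrow> ('v \<Rightarrow> nat) set" where
  "supp V f = {e. cf V f e \<noteq> 0}"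

lemma power_sum_coeffs_zero:
  fixes c :: "'i \<Rightarrow> complex"
  assumes "finite I" "\<And>z. (\<Sum>i\<in>I. c i * z ^ d i) = 0"
  shows "(\<Sum>i | i \<in> I \<and> d i = m. c i) = 0"
proof -
  define p where "p = (\<Sum>i\<in>I. monom (c i) (d i))"
  have "poly p z = 0" for z
    using assms(2)[of z] by (simp add: p_def poly_sum poly_monom)
  hence "p = 0"
    using poly_all_0_iff_0 by blast
  hence "coeff p m = 0"
    by simp
  thus ?thesis
    using assms(1) by (simp add: p_def coeff_sum sum.If_cases Int_def conj_commute)
qed

lemma mon_insert_upd:
  assumes "finite V" "v \<notin> V"
  shows "mon (insert v V) e (x(v := z)) = mon V e x * z ^ e v"
proof -
  have "(\<Prod>u\<in>V. (x(v := z)) u ^ e u) = (\<Prod>u\<in>V. x u ^ e u)"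
    using assms by (intro prod.cong) auto
  thus ?thesis
    using assms by (simp add: mon_def mult.commute)
qed

text \<open>With the other variables frozen, the sum is a polynomial in \<open>x v\<close>, so the
  terms of each degree in \<open>v\<close> cancel among themselves; stripping \<open>v\<close> from
  them leaves a relation over \<open>V\<close>.\<close>

lemma mon_indep:
  assumes "finite V" "finite E" "E \<subseteq> exps V" "\<And>x. (\<Sum>e\<in>E. a e * mon V e x) = 0" "e \<in> E"
  shows "a e = 0"
  using assms
proof (induction V arbitrary: E a e rule: finite_induct)
  case empty
  have "e' = e" if "e' \<in> E" for e'
  proof -
    have "e' \<in> exps {}" "e \<in> exps {}"
      using empty.prems that by blast+
    thus ?thesis
      by (intro ext) (simp add: exps_def)
  qed
  hence "E = {e}"
    using empty.prems(4) by blast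
  thus ?case
    using empty.prems(3) by (simp add: mon_def)
next
  case (insert v V)
  define r where "r = (\<lambda>e::'a \<Rightarrow> nat. e(v := 0))"
  define k where "k = e v"
  define E' where "E' = {e. e \<in> E \<and> e v = k}"
  have inj: "inj_on r E'"
    by (auto simp: inj_on_def r_def E'_def fun_eq_iff split: if_splits) metis
  have mon_r: "mon V (r e) x = mon V e x" for e x
    unfolding mon_def r_def using insert.hyps by (intro prod.cong) auto
  have r_upd: "(r e)(v := k) = e" if "e \<in> E'" for e
    using that by (auto simp: r_def E'_def)
  have "(\<Sum>e\<in>r ` E'. a (e(v := k)) * mon V e x) = 0" for x
  proof -
    have "(\<Sum>e\<in>E. (a e * mon V e x) * z ^ e v) = 0" for z
      using insert.prems(3)[of "x(v := z)"]
      by (simp only: mult.assoc mon_insert_upd[OF insert.hyps])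
    hence "(\<Sum>e\<in>E'. a e * mon V e x) = 0"
      unfolding E'_def by (rule power_sum_coeffs_zero[OF insert.prems(1)])
    thus ?thesis
      by (simp add: sum.reindex[OF inj] mon_r r_upd)
  qed
  moreover have "finite (r ` E')" "r ` E' \<subseteq> exps V"
    using insert.prems by (auto simp: E'_def exps_def r_def)
  moreover have e: "e \<in> E'"
    using insert.prems by (auto simp: E'_def k_def)
  hence "r e \<in> r ` E'"
    by blast
  ultimately have "a ((r e)(v := k)) = 0"
    using insert.IH[of "r ` E'" "\<lambda>e. a (e(v := k))"] by blast
  thus ?case
    using r_upd[OF e] by simp
qed

lemma is_cf_unique:
  assumes "finite V" "is_cf V f a" "is_cf V f b"
  shows "a = b"
proof
  fix e
  define E where "E = {e. a e \<noteq> 0} \<union> {e. b e \<noteq> 0}"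
  have fin: "finite E" "E \<subseteq> exps V"
    using assms by (auto simp: E_def is_cf_def)
  have "(\<Sum>e\<in>E. (a e - b e) * mon V e x) = 0" for x
  proof -
    have "(\<Sum>e\<in>E. a e * mon V e x) = f x"
      using assms(2) fin by (auto simp: E_def is_cf_def intro!: sum.mono_neutral_right)
    moreover have "(\<Sum>e\<in>E. b e * mon V e x) = f x"
    proof -
      have "(\<Sum>e\<in>E. b e * mon V e x) = (\<Sum>e | b e \<noteq> 0. b e * mon V e x)"
        using fin by (intro sum.mono_neutral_right) (auto simp: E_def)
      thus ?thesis
        using assms(3) by (simp add: is_cf_def fun_eq_iff)
    qed
    ultimately show ?thesis
      by (simp add: algebra_simps sum_subtractf)
  qed
  hence "a e - b e = 0" if "e \<in> E"
    using mon_indep[OF assms(1) fin, of "\<lambda>e. a e - b e" e] that by simp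
  thus "a e = b e"
    by (cases "e \<in> E") (auto simp: E_def)
qed

text \<open>The exponents \<open>e i\<close> may coincide, and then their coefficients add up; this
  occurs for the permutations in the expansion of a determinant.\<close>

lemma is_cf_family:
  assumes "finite V" "finite I" "\<And>i. i \<in> I \<Longrightarrow> e i \<in> exps V"
  shows "is_cf V (\<lambda>x. \<Sum>i\<in>I. c i * mon V (e i) x) (\<lambda>e'. \<Sum>i | i \<in> I \<and> e i = e'. c i)"
    (is "is_cf V ?f ?a")
proof -
  have sub: "{e'. ?a e' \<noteq> 0} \<subseteq> e ` I"
  proof
    fix e' assume "e' \<in> {e'. ?a e' \<noteq> 0}"
    hence "{i. i \<in> I \<and> e i = e'} \<noteq> {}"
      by (metis (mono_tags, lifting) mem_Collect_eq sum.empty)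
    thus "e' \<in> e ` I" by auto
  qed
  have "?f x = (\<Sum>e' | ?a e' \<noteq> 0. ?a e' * mon V e' x)" for x
  proof -
    have "?f x = (\<Sum>e'\<in>e ` I. \<Sum>i | i \<in> I \<and> e i = e'. c i * mon V (e i) x)"
      using assms(2) by (rule sum.image_gen)
    also have "\<dots> = (\<Sum>e'\<in>e ` I. ?a e' * mon V e' x)"
      by (auto intro!: sum.cong simp: sum_distrib_right)
    also have "\<dots> = (\<Sum>e' | ?a e' \<noteq> 0. ?a e' * mon V e' x)"
      using sub assms(2) by (intro sum.mono_neutral_right) auto
    finally show ?thesis .
  qed
  thus ?thesis
    unfolding is_cf_def using finite_subset[OF sub] assms(2) order.trans[OF sub, of "exps V"] assms(3)
    by (intro conjI ext) (auto simp only: finite_imageI image_subset_iff)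
qed

lemma cf_eqI:
  assumes "finite V" "is_cf V f a"
  shows "cf V f = a"
  unfolding cf_def using is_cf_unique[OF assms(1)] assms(2) by (metis someI)

lemma polyf_is_cf:
  assumes "finite V" "polyf V f"
  shows "is_cf V f (cf V f)"
proof -
  obtain E a where "finite E" "E \<subseteq> exps V" and f: "f = (\<lambda>x. \<Sum>e\<in>E. a e * mon V e x)"
    using assms(2) by (auto simp: polyf_def)
  hence "is_cf V f (\<lambda>e'. \<Sum>i | i \<in> E \<and> i = e'. a i)"
    unfolding f using is_cf_family[OF assms(1), of E "\<lambda>e. e" a] by auto
  thus ?thesis
    unfolding cf_def by (rule someI[of "is_cf V f"])
qed

lemma is_cf_polyf: "is_cf V f a \<Longrightarrow> polyf V f"
  unfolding is_cf_def polyf_def by blast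

lemma
  assumes "finite V" "polyf V f"
  shows finite_supp: "finite (supp V f)"
    and supp_exps: "supp V f \<subseteq> exps V"
    and polyf_expand: "f x = (\<Sum>e\<in>supp V f. cf V f e * mon V e x)"
  using polyf_is_cf[OF assms] by (auto simp: is_cf_def supp_def fun_eq_iff)

lemma
  assumes "finite V" "finite I" "\<And>i. i \<in> I \<Longrightarrow> e i \<in> exps V"
  shows polyf_family: "polyf V (\<lambda>x. \<Sum>i\<in>I. c i * mon V (e i) x)"
    and cf_family: "cf V (\<lambda>x. \<Sum>i\<in>I. c i * mon V (e i) x) e' = (\<Sum>i | i \<in> I \<and> e i = e'. c i)"
  using is_cf_polyf[OF is_cf_family[OF assms]] cf_eqI[OF assms(1) is_cf_family[OF assms]]
  by auto

lemma polyf_const: "finite V \<Longrightarrow> polyf V (\<lambda>x. c)"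
  using polyf_family[of V "{()}" "\<lambda>_ _. 0" "\<lambda>_. c"] by (simp add: exps_def mon_def)

lemma mon_var: "finite V \<Longrightarrow> v \<in> V \<Longrightarrow> mon V (\<lambda>u. if u = v then 1 else 0) x = x v"
  by (simp add: mon_def if_distrib prod.delta cong: if_cong)

lemma polyf_var: "finite V \<Longrightarrow> v \<in> V \<Longrightarrow> polyf V (\<lambda>x. x v)"
  using polyf_family[of V "{()}" "\<lambda>_ u. if u = v then 1 else 0" "\<lambda>_. 1"]
  by (auto simp: exps_def mon_var)

lemma mon_add: "mon V (\<lambda>v. e v + e' v) x = mon V e x * mon V e' x"
  by (simp add: mon_def power_add prod.distrib)

lemma is_cf_linear:
  assumes "finite V" "polyf V f" "polyf V g"
  shows "is_cf V (\<lambda>x. r * f x + s * g x) (\<lambda>e. r * cf V f e + s * cf V g e)"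
proof -
  define E where "E = supp V f \<union> supp V g"
  have E: "finite E" "E \<subseteq> exps V"
    using finite_supp[OF assms(1,2)] finite_supp[OF assms(1,3)] supp_exps[OF assms(1,2)]
      supp_exps[OF assms(1,3)] by (auto simp: E_def)
  have fe: "f x = (\<Sum>e\<in>E. cf V f e * mon V e x)" for x
    unfolding polyf_expand[OF assms(1,2), of x] using E
    by (intro sum.mono_neutral_left) (auto simp: E_def supp_def)
  have ge: "g x = (\<Sum>e\<in>E. cf V g e * mon V e x)" for x
    unfolding polyf_expand[OF assms(1,3), of x] using E
    by (intro sum.mono_neutral_left) (auto simp: E_def supp_def)
  have "r * f x + s * g x = (\<Sum>e\<in>E. (r * cf V f e + s * cf V g e) * mon V e x)" for x
    by (simp only: fe[of x] ge[of x] sum_distrib_left sum.distrib[symmetric] algebra_simps)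
  hence "is_cf V (\<lambda>x. r * f x + s * g x) (\<lambda>e'. \<Sum>e | e \<in> E \<and> e = e'. r * cf V f e + s * cf V g e)"
    using is_cf_family[OF assms(1) E(1), of "\<lambda>e. e" "\<lambda>e. r * cf V f e + s * cf V g e"] E
    by (simp only: subset_iff)
  moreover have "(\<Sum>e | e \<in> E \<and> e = e'. r * cf V f e + s * cf V g e) = r * cf V f e' + s * cf V g e'" for e'
  proof (cases "e' \<in> E")
    case True
    hence "{e. e \<in> E \<and> e = e'} = {e'}" by auto
    thus ?thesis by simp
  next
    case False
    hence "{e. e \<in> E \<and> e = e'} = {}" by auto
    thus ?thesis using False by (simp add: E_def supp_def)
  qed
  ultimately show ?thesis by simp
qed

lemma
  assumes "finite V" "polyf V f" "polyf V g"
  shows polyf_linear: "polyf V (\<lambda>x. r * f x + s * g x)"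
    and cf_linear: "cf V (\<lambda>x. r * f x + s * g x) e = r * cf V f e + s * cf V g e"
  using is_cf_polyf[OF is_cf_linear[OF assms]] cf_eqI[OF assms(1) is_cf_linear[OF assms]] by auto

lemma polyf_add: "finite V \<Longrightarrow> polyf V f \<Longrightarrow> polyf V g \<Longrightarrow> polyf V (\<lambda>x. f x + g x)"
  using polyf_linear[of V f g 1 1] by simp

lemma polyf_mult:
  assumes "finite V" "polyf V f" "polyf V g"
  shows "polyf V (\<lambda>x. f x * g x)"
proof -
  let ?I = "supp V f \<times> supp V g"
  have "polyf V (\<lambda>x. \<Sum>i\<in>?I. (cf V f (fst i) * cf V g (snd i)) * mon V (\<lambda>v. fst i v + snd i v) x)"
    using finite_supp supp_exps assms by (intro polyf_family) (fastforce simp: exps_def)+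
  moreover have "f x * g x = (\<Sum>i\<in>?I. (cf V f (fst i) * cf V g (snd i)) * mon V (\<lambda>v. fst i v + snd i v) x)" for x
    unfolding polyf_expand[OF assms(1,2), of x] polyf_expand[OF assms(1,3), of x] sum_product
    by (simp add: sum.cartesian_product mon_add algebra_simps case_prod_unfold)
  ultimately show ?thesis by presburger
qed



lemma polyf_diff: "finite V \<Longrightarrow> polyf V f \<Longrightarrow> polyf V g \<Longrightarrow> polyf V (\<lambda>x. f x - g x)"
  using polyf_linear[of V f g 1 "-1"] by simp

lemma polyf_sum: "finite V \<Longrightarrow> (\<And>i. i \<in> I \<Longrightarrow> polyf V (f i)) \<Longrightarrow> polyf V (\<lambda>x. \<Sum>i\<in>I. f i x)"
  by (induction I rule: infinite_finite_induct) (auto intro: polyf_const polyf_add)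

lemma polyf_prod: "finite V \<Longrightarrow> (\<And>i. i \<in> I \<Longrightarrow> polyf V (f i)) \<Longrightarrow> polyf V (\<lambda>x. \<Prod>i\<in>I. f i x)"
  by (induction I rule: infinite_finite_induct) (auto intro: polyf_const polyf_mult)

lemma polyf_power: "finite V \<Longrightarrow> polyf V f \<Longrightarrow> polyf V (\<lambda>x. f x ^ n)"
  by (induction n) (auto intro: polyf_const polyf_mult)

lemmas polyf_intros = polyf_const polyf_var polyf_add polyf_mult polyf_diff polyf_sum polyf_prod
  polyf_power

lemma polyf_compose:
  assumes "finite V" "finite W" "polyf V f" "\<And>v. v \<in> V \<Longrightarrow> polyf W (\<lambda>y. g y v)"
  shows "polyf W (\<lambda>y. f (g y))"
proof -
  have "polyf W (\<lambda>y. \<Sum>e\<in>supp V f. cf V f e * mon V e (g y))"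
    unfolding mon_def using assms(2,4) by (intro polyf_intros) auto
  moreover have "(\<lambda>y. f (g y)) = (\<lambda>y. \<Sum>e\<in>supp V f. cf V f e * mon V e (g y))"
    by (intro ext polyf_expand[OF assms(1,3)])
  ultimately show ?thesis
    by metis
qed

lemma polyf_cong_vars:
  assumes "finite V" "polyf V f" "\<And>v. v \<in> V \<Longrightarrow> x v = y v"
  shows "f x = f y"
proof -
  have "mon V e x = mon V e y" for e
    using assms(3) by (simp add: mon_def)
  thus ?thesis
    by (simp only: polyf_expand[OF assms(1,2), of x] polyf_expand[OF assms(1,2), of y])
qed

lemma polyf_mono: "finite W \<Longrightarrow> V \<subseteq> W \<Longrightarrow> polyf V f \<Longrightarrow> polyf W f"
  using polyf_compose[of V W f "\<lambda>y. y"] polyf_var[of W] by (auto dest: finite_subset)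



lemma cf_zero: "finite V \<Longrightarrow> cf V (\<lambda>x. 0) e = 0"
  using cf_linear[of V "\<lambda>x. 0" "\<lambda>x. 0" 0 0 e] polyf_const[of V 0] by simp

lemma cf_sum:
  assumes "finite V" "\<And>i. i \<in> I \<Longrightarrow> polyf V (f i)"
  shows "cf V (\<lambda>x. \<Sum>i\<in>I. c i * f i x) e = (\<Sum>i\<in>I. c i * cf V (f i) e)"
  using assms(2)
proof (induction I rule: infinite_finite_induct)
  case (insert i I)
  have "polyf V (\<lambda>x. \<Sum>i\<in>I. c i * f i x)"
    using insert.prems by (intro polyf_intros assms(1)) auto
  from cf_linear[OF assms(1) _ this, of "f i" "c i" 1] show ?case
    using insert by simp
qed (use cf_zero[OF assms(1)] in auto)

lemma polyf_continuous:
  fixes g :: "'t::topological_space \<Rightarrow> 'v \<Rightarrow> complex"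
  assumes "finite V" "polyf V f" "\<And>v. v \<in> V \<Longrightarrow> continuous_on S (\<lambda>t. g t v)"
  shows "continuous_on S (\<lambda>t. f (g t))"
proof -
  have "continuous_on S (\<lambda>t. \<Sum>e\<in>supp V f. cf V f e * mon V e (g t))"
    unfolding mon_def using assms(3) by (intro continuous_intros)
  moreover have "(\<lambda>t. f (g t)) = (\<lambda>t. \<Sum>e\<in>supp V f. cf V f e * mon V e (g t))"
    by (intro ext polyf_expand[OF assms(1,2)])
  ultimately show ?thesis
    by metis
qed

section \<open>Homogeneous parts and gradings by weights\<close>

definition part :: "'v set \<Rightarrow> (('v \<Rightarrow> nat) \<Rightarrow> bool) \<Rightarrow> (('v \<Rightarrow> complex) \<Rightarrow> complex) \<Rightarrow> ('v \<Rightarrow> complex) \<Rightarrow> complex" where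
  "part V P f x = (\<Sum>e | e \<in> supp V f \<and> P e. cf V f e * mon V e x)"

lemma
  assumes "finite V" "polyf V f"
  shows polyf_part: "polyf V (part V P f)"
    and cf_part: "cf V (part V P f) e = (if P e then cf V f e else 0)"
proof -
  let ?I = "{e \<in> supp V f. P e}"
  have I: "finite ?I" "\<And>e. e \<in> ?I \<Longrightarrow> e \<in> exps V"
    using finite_supp[OF assms] supp_exps[OF assms] by auto
  have eq: "part V P f = (\<lambda>x. \<Sum>e\<in>?I. cf V f e * mon V e x)"
    by (simp add: part_def fun_eq_iff)
  show "polyf V (part V P f)"
    unfolding eq by (rule polyf_family[OF assms(1) I])
  have "cf V (part V P f) e = (\<Sum>i | i \<in> ?I \<and> i = e. cf V f i)"
    unfolding eq by (rule cf_family[OF assms(1) I])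
  also have "{i. i \<in> ?I \<and> i = e} = (if e \<in> ?I then {e} else {})"
    by auto
  finally show "cf V (part V P f) e = (if P e then cf V f e else 0)"
    by (simp add: supp_def)
qed

lemma polyf_ext_cf:
  assumes "finite V" "polyf V f" "polyf V g" "\<And>e. cf V f e = cf V g e"
  shows "f = g"
proof
  fix x
  have "supp V f = supp V g"
    using assms(4) by (simp add: supp_def)
  hence "(\<Sum>e\<in>supp V f. cf V f e * mon V e x) = (\<Sum>e\<in>supp V g. cf V g e * mon V e x)"
    using assms(4) by (intro sum.cong) auto
  thus "f x = g x"
    by (simp only: polyf_expand[OF assms(1,2), of x] polyf_expand[OF assms(1,3), of x])
qed

definition wt :: "'v set \<Rightarrow> ('v \<Rightarrow> nat) \<Rightarrow> ('v \<Rightarrow> nat) \<Rightarrow> nat" where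
  "wt V \<omega> e = (\<Sum>v\<in>V. \<omega> v * e v)"

definition scale :: "('v \<Rightarrow> nat) \<Rightarrow> complex \<Rightarrow> ('v \<Rightarrow> complex) \<Rightarrow> 'v \<Rightarrow> complex" where
  "scale \<omega> t x = (\<lambda>v. t ^ \<omega> v * x v)"

lemma mon_scale: "mon V e (scale \<omega> t x) = t ^ wt V \<omega> e * mon V e x"
  by (simp add: mon_def scale_def wt_def power_mult_distrib prod.distrib power_sum power_mult)

lemma polyf_scale:
  assumes "finite V" "polyf V f" "\<And>e. e \<in> supp V f \<Longrightarrow> wt V \<omega> e \<le> K"
  shows "f (scale \<omega> t x) = (\<Sum>q\<le>K. part V (\<lambda>e. wt V \<omega> e = q) f x * t ^ q)"
proof -
  have "f (scale \<omega> t x) = (\<Sum>e\<in>supp V f. cf V f e * mon V e x * t ^ wt V \<omega> e)"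
    unfolding polyf_expand[OF assms(1,2), of "scale \<omega> t x"] mon_scale by (simp add: algebra_simps)
  also have "\<dots> = (\<Sum>q\<le>K. \<Sum>e | e \<in> supp V f \<and> wt V \<omega> e = q. cf V f e * mon V e x * t ^ wt V \<omega> e)"
    using assms(3) finite_supp[OF assms(1,2)] by (intro sum.group[symmetric]) auto
  also have "\<dots> = (\<Sum>q\<le>K. part V (\<lambda>e. wt V \<omega> e = q) f x * t ^ q)"
    unfolding part_def sum_distrib_right by (intro sum.cong) auto
  finally show ?thesis .
qed

lemma supp_part: "finite V \<Longrightarrow> polyf V f \<Longrightarrow> supp V (part V P f) = {e \<in> supp V f. P e}"
  by (auto simp: supp_def cf_part)

lemma polyf_wt_bound:
  assumes "finite V" "polyf V f"
  obtains K where "\<And>e. e \<in> supp V f \<Longrightarrow> wt V \<omega> e \<le> K"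
  using finite_supp[OF assms] by (metis finite_imageI finite_nat_set_iff_bounded_le image_eqI)

lemma poly_coeffs_unique:
  fixes a b :: "nat \<Rightarrow> complex"
  assumes "\<And>t. (\<Sum>i\<le>K. a i * t ^ i) = (\<Sum>i\<le>K. b i * t ^ i)" "i \<le> K"
  shows "a i = b i"
  using assms polyfun_eq_coeffs[of a K b] by blast

text \<open>As \<open>t\<close> varies, \<open>f (scale \<omega> t x)\<close> is a polynomial in
  \<open>t\<close> whose coefficients are the homogeneous parts of \<open>f\<close> at
  \<open>x\<close>. The part with the weight of \<open>e\<close> therefore vanishes identically, and
  with it the coefficient at \<open>e\<close>.\<close>

lemma cf_zero_weight:
  assumes "finite V" "polyf V f"
    and "\<And>x. \<exists>p. (\<forall>t. poly p t = f (scale \<omega> t x)) \<and> coeff p (wt V \<omega> e) = 0"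
  shows "cf V f e = 0"
proof (rule ccontr)
  assume "cf V f e \<noteq> 0"
  hence e: "e \<in> supp V f" by (simp add: supp_def)
  obtain K where K: "\<And>e. e \<in> supp V f \<Longrightarrow> wt V \<omega> e \<le> K"
    using polyf_wt_bound[OF assms(1,2)] by metis
  define g where "g = (\<lambda>q. part V (\<lambda>e. wt V \<omega> e = q) f)"
  have "g (wt V \<omega> e) x = 0" for x
  proof -
    obtain p where p: "\<And>t. poly p t = f (scale \<omega> t x)" "coeff p (wt V \<omega> e) = 0"
      using assms(3)[of x] by blast
    have "poly p t = poly (\<Sum>q\<le>K. monom (g q x) q) t" for t
      unfolding p(1) g_def using polyf_scale[OF assms(1,2) K, of t x] by (simp add: poly_sum poly_monom)
    hence "p = (\<Sum>q\<le>K. monom (g q x) q)"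
      by (intro poly_eq_poly_eq_iff[THEN iffD1] ext)
    thus ?thesis
      using p(2) K[OF e] by (simp add: coeff_sum)
  qed
  hence "cf V (g (wt V \<omega> e)) e = 0"
    using cf_zero[OF assms(1)] by (metis ext)
  thus False
    using \<open>cf V f e \<noteq> 0\<close> by (simp add: g_def cf_part[OF assms(1,2)])
qed

lemma homogeneous_supp:
  assumes "finite V" "polyf V f" "\<And>t x. f (scale \<omega> t x) = t ^ n * f x" "e \<in> supp V f"
  shows "wt V \<omega> e = n"
proof (rule ccontr)
  assume "wt V \<omega> e \<noteq> n"
  hence "(\<forall>t. poly (monom (f x) n) t = f (scale \<omega> t x)) \<and> coeff (monom (f x) n) (wt V \<omega> e) = 0" for x
    by (simp add: poly_monom assms(3))
  hence "cf V f e = 0"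
    by (intro cf_zero_weight[OF assms(1,2)]) blast
  thus False
    using assms(4) by (simp add: supp_def)
qed

lemma homogeneous_if_supp:
  assumes "finite V" "polyf V f" "\<And>e. e \<in> supp V f \<Longrightarrow> wt V \<omega> e = n"
  shows "f (scale \<omega> t x) = t ^ n * f x"
proof -
  have "f (scale \<omega> t x) = (\<Sum>e\<in>supp V f. t ^ n * (cf V f e * mon V e x))"
    unfolding polyf_expand[OF assms(1,2), of "scale \<omega> t x"] mon_scale
    using assms(3) by (intro sum.cong) (auto simp: mult.left_commute)
  thus ?thesis
    using polyf_expand[OF assms(1,2), of x] by (simp add: sum_distrib_left)
qed

text \<open>A monomial has only one weight, so the pieces \<open>g q\<close> have disjoint supports
  and nothing cancels. In this way a coefficient of a top part is found again in the whole.\<close>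

lemma cf_homogeneous_sum:
  assumes "finite V" "\<And>q. q \<le> K \<Longrightarrow> polyf V (g q)"
    and "\<And>q t x. q \<le> K \<Longrightarrow> g q (scale \<omega> t x) = t ^ q * g q x"
    and "q \<le> K" "cf V (g q) e \<noteq> 0"
  shows "cf V (\<lambda>x. \<Sum>q\<le>K. g q x) e = cf V (g q) e"
proof -
  have "wt V \<omega> e = q"
    using homogeneous_supp[OF assms(1), of "g q" \<omega> q e] assms by (auto simp: supp_def)
  hence "cf V (g q') e = 0" if "q' \<le> K" "q' \<noteq> q" for q'
    using homogeneous_supp[OF assms(1), of "g q'" \<omega> q' e] assms(2,3) that by (auto simp: supp_def)
  hence "(\<Sum>q'\<le>K. cf V (g q') e) = (\<Sum>q'\<in>{q}. cf V (g q') e)"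
    using assms(4) by (intro sum.mono_neutral_right) auto
  thus ?thesis
    using cf_sum[OF assms(1), of "{..K}" g "\<lambda>_. 1" e] assms(2) by simp
qed

text \<open>Only the variables in \<open>U\<close> move with \<open>z\<close>, so the degree in
  \<open>z\<close> is bounded by the degree of \<open>f\<close> in these variables alone.\<close>

lemma polyf_line:
  assumes "finite V" "polyf V f" "\<And>e. e \<in> supp V f \<Longrightarrow> (\<Sum>v\<in>V \<inter> U. e v) \<le> m"
    and "\<And>v. v \<notin> U \<Longrightarrow> y v = 0"
  shows "\<exists>p. degree p \<le> m \<and> (\<forall>z. poly p z = f (\<lambda>v. x v + z * y v))"
proof -
  define q where "q = (\<lambda>e. \<Prod>v\<in>V. [:x v, y v:] ^ e v)"
  have "degree (q e) \<le> m" if "e \<in> supp V f" for e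
  proof -
    have "degree (q e) \<le> (\<Sum>v\<in>V. degree ([:x v, y v:] ^ e v))"
      unfolding q_def using degree_prod_sum_le[OF assms(1), of "\<lambda>v. [:x v, y v:] ^ e v"]
      by (simp add: o_def)
    also have "\<dots> \<le> (\<Sum>v\<in>V. if v \<in> U then e v else 0)"
    proof (intro sum_mono)
      fix v
      show "degree ([:x v, y v:] ^ e v) \<le> (if v \<in> U then e v else 0)"
        using degree_power_le[of "[:x v, y v:]" "e v"] assms(4)[of v]
        by (cases "y v = 0") (auto split: if_splits)
    qed
    also have "\<dots> = (\<Sum>v\<in>V \<inter> U. e v)"
      using assms(1) by (simp add: sum.inter_restrict)
    finally show ?thesis
      using assms(3)[OF that] by linarith
  qed
  hence "degree (\<Sum>e\<in>supp V f. Polynomial.smult (cf V f e) (q e)) \<le> m"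
    by (intro degree_sum_le finite_supp assms order.trans[OF degree_smult_le]) auto
  moreover have "poly (\<Sum>e\<in>supp V f. Polynomial.smult (cf V f e) (q e)) z = f (\<lambda>v. x v + z * y v)" for z
    unfolding polyf_expand[OF assms(1,2), of "\<lambda>v. x v + z * y v"] mon_def q_def
    by (simp add: poly_sum poly_prod poly_power)
  ultimately show ?thesis
    by blast
qed

lemma supp_var_degree:
  assumes "finite V" "polyf V f" "v \<in> V"
    and "\<And>x. \<exists>p. degree p \<le> m \<and> (\<forall>z. poly p z = f (x(v := z)))" and "e \<in> supp V f"
  shows "e v \<le> m"
proof (rule ccontr)
  assume gt: "\<not> e v \<le> m"
  define \<omega> where "\<omega> = (\<lambda>u. if u = v then 1 else 0 :: nat)"
  have wt: "wt V \<omega> e = e v"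
    using assms(1,3) by (simp add: wt_def \<omega>_def if_distrib[of "\<lambda>x. x * _"] sum.delta' cong: if_cong)
  have "\<exists>p. (\<forall>t. poly p t = f (scale \<omega> t x)) \<and> coeff p (wt V \<omega> e) = 0" for x
  proof -
    obtain p where p: "degree p \<le> m" "\<And>z. poly p z = f (x(v := z))"
      using assms(4)[of x] by blast
    \<comment> \<open>\<open>scale\<close> multiplies the coordinate by \<open>t\<close> instead of
      replacing it, hence the substitution of \<open>t * x v\<close> for the variable of
      \<open>p\<close>.\<close>
    have "degree (pcompose p [:0, x v:]) \<le> m"
      using p(1) degree_pcompose_le[of p "[:0, x v:]"]
      by (metis degree_pCons_0 degree_pCons_eq_if le_zero_eq mult.right_neutral mult_0_right One_nat_def order.trans zero_le)
    moreover have "scale \<omega> t x = x(v := t * x v)" for t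
      by (auto simp: scale_def \<omega>_def)
    hence "poly (pcompose p [:0, x v:]) t = f (scale \<omega> t x)" for t
      by (simp only: poly_pcompose p(2)) simp
    ultimately show ?thesis
      using gt by (intro exI[of _ "pcompose p [:0, x v:]"]) (simp add: wt coeff_eq_0)
  qed
  hence "cf V f e = 0"
    by (intro cf_zero_weight[OF assms(1,2)])
  thus False
    using assms(5) by (simp add: supp_def)
qed

lemma cf_permute:
  assumes "finite V" "polyf V f" "bij_betw \<pi> V V" "\<And>v. v \<notin> V \<Longrightarrow> \<pi> v = v"
    and "\<And>x. f (x \<circ> \<pi>) = f x"
  shows "cf V f (e \<circ> \<pi>) = cf V f e"
proof -
  have bij: "bij \<pi>"
    using assms(3,4) by (metis bij_betw_def permutes_bij permutes_def bij_imp_permutes)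
  have mon: "mon V (e \<circ> \<pi>) (x \<circ> \<pi>) = mon V e x" for e x
    unfolding mon_def using prod.reindex_bij_betw[OF assms(3), of "\<lambda>v. x v ^ e v"] by simp
  have V: "\<pi> v \<in> V \<longleftrightarrow> v \<in> V" for v
    using assms(3,4) by (metis bij_betw_apply)
  define a where "a = (\<lambda>e. cf V f (e \<circ> \<pi>))"
  have inj: "inj_on (\<lambda>e. e \<circ> \<pi>) A" for A :: "('a \<Rightarrow> nat) set"
    using bij by (auto simp: inj_on_def fun_eq_iff bij_def surj_def) metis
  have img: "(\<lambda>e. e \<circ> \<pi>) ` {e. a e \<noteq> 0} = supp V f"
  proof -
    have "e \<in> (\<lambda>e. e \<circ> \<pi>) ` {e. a e \<noteq> 0}" if "e \<in> supp V f" for e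
    proof
      show "e = (e \<circ> inv_into UNIV \<pi>) \<circ> \<pi>"
        using bij by (simp add: o_assoc[symmetric] bij_is_inj)
      thus "e \<circ> inv_into UNIV \<pi> \<in> {e. a e \<noteq> 0}"
        using that by (simp add: a_def supp_def)
    qed
    thus ?thesis by (auto simp: a_def supp_def)
  qed
  have "is_cf V f a"
    unfolding is_cf_def
  proof (intro conjI ext)
    show "finite {e. a e \<noteq> 0}"
      using finite_supp[OF assms(1,2)] img inj by (metis finite_imageD)
    show "{e. a e \<noteq> 0} \<subseteq> exps V"
    proof
      fix e assume "e \<in> {e. a e \<noteq> 0}"
      hence "e \<circ> \<pi> \<in> exps V"
        using img supp_exps[OF assms(1,2)] by blast
      thus "e \<in> exps V"
        using V bij by (auto simp: exps_def) (metis bij_pointE)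
    qed
    fix x
    have "f x = f (x \<circ> \<pi>)"
      by (simp add: assms(5))
    also have "\<dots> = (\<Sum>e\<in>(\<lambda>e. e \<circ> \<pi>) ` {e. a e \<noteq> 0}. cf V f e * mon V e (x \<circ> \<pi>))"
      unfolding img by (rule polyf_expand[OF assms(1,2)])
    also have "\<dots> = (\<Sum>e | a e \<noteq> 0. a e * mon V e x)"
      by (simp add: sum.reindex[OF inj] mon a_def)
    finally show "f x = (\<Sum>e | a e \<noteq> 0. a e * mon V e x)" .
  qed
  from cf_eqI[OF assms(1) this] show ?thesis
    by (simp add: a_def fun_eq_iff)
qed

text \<open>By Lagrange interpolation in one variable after the other.\<close>

lemma polyf_separately:
  assumes "finite V" "\<And>x y. (\<And>v. v \<in> V \<Longrightarrow> x v = y v) \<Longrightarrow> f x = f y"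
    and "\<And>x v. v \<in> V \<Longrightarrow> \<exists>p. degree p \<le> D \<and> (\<forall>z. poly p z = f (x(v := z)))"
  shows "polyf V f"
  using assms
proof (induction V arbitrary: f rule: finite_induct)
  case empty
  define c where "c = f (\<lambda>_. 0)"
  have "f = (\<lambda>x. c)"
    unfolding c_def using empty.prems(1) by (intro ext) auto
  thus ?case
    by (simp add: polyf_const)
next
  case (insert v V)
  define node where "node = (\<lambda>i::nat. of_nat i :: complex)"
  define L where "L = (\<lambda>i z. \<Prod>j\<in>{..D} - {i}. (z - node j) / (node i - node j))"
  have interp: "f x = (\<Sum>i\<le>D. L i (x v) * f (x(v := node i)))" for x
  proof -
    obtain p where p: "degree p \<le> D" "\<And>z. poly p z = f (x(v := z))"
      using insert.prems(2)[of v x] by blast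
    define r where "r = (\<lambda>i j. Polynomial.smult (1 / (node i - node j)) [:- node j, 1:])"
    define q where "q = (\<Sum>i\<le>D. Polynomial.smult (poly p (node i)) (\<Prod>j\<in>{..D} - {i}. r i j))"
    have pq: "poly q z = (\<Sum>i\<le>D. poly p (node i) * L i z)" for z
      unfolding q_def r_def L_def poly_sum poly_smult poly_prod
      by (intro sum.cong arg_cong2[of _ _ _ _ "(*)"] prod.cong) (auto simp: divide_simps)
    have "degree q \<le> D"
      unfolding q_def
    proof (intro degree_sum_le order.trans[OF degree_smult_le])
      fix i assume "i \<in> {..D}"
      have deg1: "degree (r i j) \<le> 1" for j
        unfolding r_def by (rule order.trans[OF degree_smult_le]) simp
      have "degree (\<Prod>j\<in>{..D} - {i}. r i j) \<le> sum (degree \<circ> r i) ({..D} - {i})"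
        by (rule degree_prod_sum_le) simp
      also have "\<dots> \<le> (\<Sum>j\<in>{..D} - {i}. 1)"
        unfolding o_def by (intro sum_mono deg1)
      finally show "degree (\<Prod>j\<in>{..D} - {i}. r i j) \<le> D"
        using \<open>i \<in> {..D}\<close> by simp
    qed auto
    \<comment> \<open>\<open>p\<close> and its interpolant \<open>q\<close> agree at
      \<open>D + 1\<close> nodes, while their degrees are at most \<open>D\<close>.\<close>
    have "poly (p - q) (node m) = 0" if "m \<le> D" for m
    proof -
      have "L i (node m) = (if i = m then 1 else 0)" if "i \<le> D" for i
      proof (cases "i = m")
        case True
        thus ?thesis by (auto simp: L_def node_def intro!: prod.neutral)
      next
        case False
        hence "m \<in> {..D} - {i}" using \<open>m \<le> D\<close> by auto
        thus ?thesis using False by (auto simp: L_def intro!: prod_zero bexI[of _ m])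
      qed
      hence "poly q (node m) = (\<Sum>i\<le>D. poly p (node i) * (if i = m then 1 else 0))"
        unfolding pq by (intro sum.cong) auto
      thus ?thesis
        using that by (simp add: if_distrib[of "\<lambda>x. _ * x"] cong: if_cong)
    qed
    hence sub: "node ` {..D} \<subseteq> {z. poly (p - q) z = 0}"
      by auto
    have "p - q = 0"
    proof (rule ccontr)
      assume ne: "p - q \<noteq> 0"
      have "card (node ` {..D}) = Suc D"
        by (subst card_image) (auto simp: inj_on_def node_def)
      moreover have "card (node ` {..D}) \<le> degree (p - q)"
        using card_mono[OF poly_roots_finite[OF ne] sub] card_poly_roots_bound[OF ne] by simp
      ultimately show False
        using degree_diff_le[OF p(1) \<open>degree q \<le> D\<close>] by simp
    qed
    hence "p = q" by simp
    have "f x = poly q (x v)"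
      using p(2)[of "x v"] \<open>p = q\<close> by simp
    thus ?thesis
      unfolding pq by (simp add: p(2) mult.commute)
  qed
  have "polyf V (\<lambda>x. f (x(v := node i)))" for i
  proof (rule insert.IH)
    show "f (x(v := node i)) = f (y(v := node i))" if "\<And>u. u \<in> V \<Longrightarrow> x u = y u" for x y
      using that by (intro insert.prems) auto
    fix x u assume "u \<in> V"
    hence "x(u := z, v := node i) = (x(v := node i))(u := z)" for z
      using insert.hyps by auto
    thus "\<exists>p. degree p \<le> D \<and> (\<forall>z. poly p z = f (x(u := z, v := node i)))"
      using insert.prems(2)[of u "x(v := node i)"] \<open>u \<in> V\<close>
      by (simp only: insert_iff simp_thms)
  qed
  hence poly: "polyf (insert v V) (\<lambda>x. \<Sum>i\<le>D. L i (x v) * f (x(v := node i)))"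
    unfolding L_def divide_inverse using insert.hyps(1)
    by (intro polyf_intros) (auto intro!: polyf_mono[of "insert v V" V])
  have "(\<lambda>x. \<Sum>i\<le>D. L i (x v) * f (x(v := node i))) = f"
    by (intro ext interp[symmetric])
  from subst[OF this, of "polyf (insert v V)", OF poly] show ?case .
qed

section \<open>Jets as power series\<close>

text \<open>Taylor series of a jet. Dividing by \<open>fact l\<close> turns the Leibniz rule into
  multiplication of power series, and a quotient of coordinates into a quotient of series.\<close>

definition jf :: "(nat \<Rightarrow> complex) \<Rightarrow> complex fps" where
  "jf a = Abs_fps (\<lambda>l. a l / fact l)"

definition pt :: "(nat \<Rightarrow> complex fps) \<Rightarrow> nat \<times> nat \<Rightarrow> complex" where
  "pt A = (\<lambda>(j, l). fact l * fps_nth (A j) l)"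



text \<open>The jets of the homogeneous coordinates, normalised to be 1 at the index
  \<open>i\<close>, so that every change of charts becomes division by a single series.\<close>

definition hom_coord :: "nat \<Rightarrow> jet \<Rightarrow> nat \<Rightarrow> complex fps" where
  "hom_coord i \<xi> m = (if m = i then 1 else jf (\<xi> m))"

lemma jf_nth [simp]: "fps_nth (jf a) l = a l / fact l"
  by (simp add: jf_def)

lemma pt_apply [simp]: "pt A (j, l) = fact l * fps_nth (A j) l"
  by (simp add: pt_def)

lemma jf_pt [simp]: "jf (\<lambda>l. pt A (j, l)) = A j"
  by (rule fps_ext) simp

lemma pt_jf: "pt (\<lambda>j. jf (\<lambda>l. x (j, l))) = x"
  by (auto simp: pt_def fun_eq_iff)

section \<open>Coefficients of inverse series and the change of charts\<close>

lemma fps_inverse_nth_rec: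
  fixes f :: "complex fps"
  assumes "fps_nth f 0 \<noteq> 0" "n > 0"
  shows "fps_nth (inverse f) n =
    - inverse (fps_nth f 0) * (\<Sum>i=1..n. fps_nth f i * fps_nth (inverse f) (n - i))"
proof -
  have "fps_nth (f * inverse f) n = 0"
    using assms by (simp add: inverse_mult_eq_1')
  hence "fps_nth f 0 * fps_nth (inverse f) n + (\<Sum>i=1..n. fps_nth f i * fps_nth (inverse f) (n - i)) = 0"
    by (simp add: fps_mult_nth sum.atLeast_Suc_atMost)
  thus ?thesis
    using assms(1) by (simp add: field_simps eq_neg_iff_add_eq_0 add.commute)
qed

lemma continuous_on_fps_inverse_nth:
  fixes f :: "'t::topological_space \<Rightarrow> complex fps"
  assumes "\<And>t. t \<in> S \<Longrightarrow> fps_nth (f t) 0 \<noteq> 0" "\<And>n. continuous_on S (\<lambda>t. fps_nth (f t) n)"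
  shows "continuous_on S (\<lambda>t. fps_nth (inverse (f t)) n)"
proof (induction n rule: less_induct)
  case (less n)
  show ?case
  proof (cases "n = 0")
    case True
    thus ?thesis
      using assms by (auto intro!: continuous_intros)
  next
    case False
    have "continuous_on S (\<lambda>t. - inverse (fps_nth (f t) 0) *
        (\<Sum>i=1..n. fps_nth (f t) i * fps_nth (inverse (f t)) (n - i)))"
      using assms False by (intro continuous_intros less) auto
    thus ?thesis
      using fps_inverse_nth_rec[OF assms(1)] False by (auto cong: continuous_on_cong)
  qed
qed

lemma continuous_on_fps_mult_nth:
  fixes f g :: "'t::topological_space \<Rightarrow> complex fps"
  assumes "\<And>n. continuous_on S (\<lambda>t. fps_nth (f t) n)" "\<And>n. continuous_on S (\<lambda>t. fps_nth (g t) n)"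
  shows "continuous_on S (\<lambda>t. fps_nth (f t * g t) n)"
  unfolding fps_mult_nth by (intro continuous_intros assms)

text \<open>With \<open>f z\<close> the inverse at \<open>z\<close>, the resolvent identity
  \<open>f z - f 0 = - z * H * f z * f 0\<close> gives the difference quotient in closed form, and
  continuity of the coefficients of \<open>f\<close> gives its limit.\<close>

lemma fps_inverse_nth_deriv:
  fixes B H :: "complex fps"
  assumes "fps_nth B 0 \<noteq> 0"
  shows "((\<lambda>z. fps_nth (G * inverse (B + fps_const z * H)) n) has_field_derivative
    - fps_nth (G * H * (inverse B)\<^sup>2) n) (at 0)"
proof -
  define S where "S = {z. fps_nth (B + fps_const z * H) 0 \<noteq> 0}"
  have S: "open S"
    unfolding S_def by (intro open_Collect_neq) (auto intro!: continuous_intros)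
  have "0 \<in> S" using assms by (simp add: S_def)
  define f where "f = (\<lambda>z. inverse (B + fps_const z * H))"
  have "continuous_on S (\<lambda>z. fps_nth (f z) n)" for n
    unfolding f_def by (rule continuous_on_fps_inverse_nth) (auto simp: S_def intro!: continuous_intros)
  hence "continuous_on S (\<lambda>z. - fps_nth (G * H * f z * f 0) n)"
    by (intro continuous_intros continuous_on_fps_mult_nth) auto
  hence "isCont (\<lambda>z. - fps_nth (G * H * f z * f 0) n) 0"
    using S \<open>0 \<in> S\<close> by (simp add: continuous_on_eq_continuous_at)
  hence lim: "((\<lambda>z. - fps_nth (G * H * f z * f 0) n) \<longlongrightarrow> - fps_nth (G * H * f 0 * f 0) n) (at 0)"
    by (simp add: isCont_def)
  have "eventually (\<lambda>z. z \<in> S - {0}) (at 0)"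
    using eventually_at_topological S \<open>0 \<in> S\<close> by blast
  hence "eventually (\<lambda>z. - fps_nth (G * H * f z * f 0) n =
      (fps_nth (G * f z) n - fps_nth (G * f 0) n) / (z - 0)) (at 0)"
  proof eventually_elim
    case (elim z)
    have "(B + fps_const z * H) * f z = 1" "B * f 0 = 1"
      using elim assms by (simp_all add: f_def S_def inverse_mult_eq_1')
    hence "f z - f 0 = f z * (B * f 0) - f 0 * ((B + fps_const z * H) * f z)"
      by simp
    also have "\<dots> = - (fps_const z * (H * f z * f 0))"
      by (simp add: algebra_simps)
    finally have "G * (f z - f 0) = - (fps_const z * (G * H * f z * f 0))"
      by (simp add: mult_ac)
    hence "G * f z - G * f 0 = - (fps_const z * (G * H * f z * f 0))"
      by (simp add: algebra_simps)
    hence "fps_nth (G * f z) n - fps_nth (G * f 0) n = - z * fps_nth (G * H * f z * f 0) n"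
      by (metis fps_mult_left_const_nth fps_neg_nth fps_sub_nth minus_mult_left)
    thus ?case
      using elim by simp
  qed
  hence "((\<lambda>z. (fps_nth (G * f z) n - fps_nth (G * f 0) n) / (z - 0)) \<longlongrightarrow> - fps_nth (G * H * f 0 * f 0) n) (at 0)"
    using lim by (rule Lim_transform_eventually[rotated])
  thus ?thesis
    by (simp add: has_field_derivative_iff f_def power2_eq_square mult.assoc)
qed

lemma jf_upd: "jf (a(p := z)) = jf a + fps_const ((z - a p) / fact p) * fps_X ^ p"
  by (rule fps_ext) (auto simp: fps_X_power_nth diff_divide_distrib add_divide_distrib)

lemma fps_deriv_jf: "fps_deriv (jf a) = jf (\<lambda>l. a (Suc l))"
  by (rule fps_ext) (simp del: of_nat_Suc)

text \<open>Induction on the order. Each jet variable enters the numerator \<open>A\<close> or the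
  denominator \<open>B\<close> affinely, through \<open>fps_X ^ p / fact p\<close>, so all partial
  derivatives are explicit; the chain rule sums them to a coefficient of the derivative of
  \<open>A / B\<close>.\<close>

lemma formal_deriv_coord_change:
  assumes "j \<le> N" "i \<noteq> j" "m \<le> N" "m \<noteq> j" "\<xi> j 0 \<noteq> 0"
  shows "formal_deriv (chart N i) (coord_change i j m) l \<xi> =
    fact l * fps_nth (hom_coord i \<xi> m * inverse (hom_coord i \<xi> j)) l"
  using assms(5)
proof (induction l arbitrary: \<xi>)
  case 0
  thus ?case
    using assms by (simp add: coord_change_def hom_coord_def divide_inverse)
next
  case (Suc l)
  define Y where "Y = (\<lambda>\<xi>. fact l * fps_nth (hom_coord i \<xi> m * inverse (hom_coord i \<xi> j)) l)"
  define B where "B = hom_coord i \<xi> j"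
  define A where "A = hom_coord i \<xi> m"
  have B0: "fps_nth B 0 \<noteq> 0"
    using Suc.prems assms(2) by (simp add: B_def hom_coord_def)
  define D where "D = (\<lambda>m' p. fact l / fact p * ((if m' = m then fps_nth (inverse B) (l - p) else 0) -
    (if m' = j then fps_nth (A * (inverse B)\<^sup>2) (l - p) else 0)))"
  have partial: "jet_partial m' p (formal_deriv (chart N i) (coord_change i j m) l) \<xi> = D m' p"
    if "m' \<in> chart N i" "p \<le> l" for m' p
  proof -
    define u where "u = (\<lambda>z. \<xi>(m' := (\<xi> m')(p := z)))"
    \<comment> \<open>The induction hypothesis requires a nonzero denominator. This persists in a
      neighbourhood, which suffices for a derivative.\<close>
    have "eventually (\<lambda>z. u z j 0 \<noteq> 0) (nhds (\<xi> m' p))"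
    proof (cases "m' = j \<and> p = 0")
      case True
      thus ?thesis
        using Suc.prems t1_space_nhds[of "\<xi> j 0" 0] by (simp add: u_def)
    next
      case False
      thus ?thesis
        using Suc.prems by (auto simp: u_def)
    qed
    hence "eventually (\<lambda>z. formal_deriv (chart N i) (coord_change i j m) l (u z) = Y (u z)) (nhds (\<xi> m' p))"
      by eventually_elim (simp add: Suc.IH Y_def)
    hence "jet_partial m' p (formal_deriv (chart N i) (coord_change i j m) l) \<xi> = deriv (\<lambda>z. Y (u z)) (\<xi> m' p)"
      unfolding jet_partial_def u_def by (intro deriv_cong_ev) auto
    also have "\<dots> = D m' p"
    proof (rule DERIV_imp_deriv)
      have "m' \<noteq> i" using that by (simp add: chart_def)
      consider "m' = m" | "m' = j" | "m' \<noteq> m" "m' \<noteq> j" by blast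
      thus "((\<lambda>z. Y (u z)) has_field_derivative D m' p) (at (\<xi> m' p))"
      proof cases
        case 1
        have "Y (u z) = fact l * (fps_nth (A * inverse B) l + (z - \<xi> m' p) / fact p * fps_nth (inverse B) (l - p))" for z
        proof -
          have "hom_coord i (u z) m = A + fps_const ((z - \<xi> m p) / fact p) * fps_X ^ p"
            using 1 \<open>m' \<noteq> i\<close> by (simp add: hom_coord_def u_def A_def jf_upd)
          moreover have "hom_coord i (u z) j = B"
            using 1 assms(4) by (auto simp: hom_coord_def u_def B_def)
          ultimately show ?thesis
            using \<open>p \<le> l\<close> 1
            by (simp add: Y_def distrib_right mult.assoc fps_X_power_mult_nth)
        qed
        moreover have "D m' p = fact l * (1 / fact p * fps_nth (inverse B) (l - p))"
          using 1 assms(4) by (simp add: D_def)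
        ultimately show ?thesis
          by (auto intro!: derivative_eq_intros)
      next
        case 2
        define H :: "complex fps" where "H = fps_const (1 / fact p) * fps_X ^ p"
        have "Y (u z) = fact l * fps_nth (A * inverse (B + fps_const (z - \<xi> m' p) * H)) l" for z
        proof -
          have "hom_coord i (u z) m = A"
            using 2 assms(4) by (auto simp: hom_coord_def u_def A_def)
          moreover have "hom_coord i (u z) j = B + fps_const (z - \<xi> m' p) * H"
            using 2 \<open>m' \<noteq> i\<close> by (simp add: hom_coord_def u_def B_def jf_upd H_def mult.assoc[symmetric])
          ultimately show ?thesis
            by (simp add: Y_def)
        qed
        moreover have "((\<lambda>w. fps_nth (A * inverse (B + fps_const w * H)) l) has_field_derivative
            - fps_nth (A * H * (inverse B)\<^sup>2) l) (at (\<xi> m' p - \<xi> m' p))"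
          using fps_inverse_nth_deriv[OF B0] by simp
        hence "((\<lambda>z. fps_nth (A * inverse (B + fps_const (z - \<xi> m' p) * H)) l) has_field_derivative
            - fps_nth (A * H * (inverse B)\<^sup>2) l) (at (\<xi> m' p))"
          using DERIV_chain2[where g = "\<lambda>z. z - \<xi> m' p" and x = "\<xi> m' p" and Db = 1]
          by (fastforce intro: derivative_eq_intros)
        moreover have "A * H * (inverse B)\<^sup>2 = fps_const (1 / fact p) * (fps_X ^ p * (A * (inverse B)\<^sup>2))"
          by (simp add: H_def mult_ac)
        hence "fps_nth (A * H * (inverse B)\<^sup>2) l = 1 / fact p * fps_nth (A * (inverse B)\<^sup>2) (l - p)"
          using \<open>p \<le> l\<close> by (simp only: fps_mult_left_const_nth fps_X_power_mult_nth) simp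
        hence "D m' p = fact l * (- fps_nth (A * H * (inverse B)\<^sup>2) l)"
          using 2 assms(4) by (simp add: D_def)
        ultimately show ?thesis
          by (simp only: DERIV_cmult)
      next
        case 3
        have "hom_coord i (u z) m = A" "hom_coord i (u z) j = B" for z
          using 3 by (auto simp: hom_coord_def u_def A_def B_def)
        thus ?thesis
          using 3 by (simp add: Y_def D_def)
      qed
    qed
    finally show ?thesis .
  qed
  have jI: "j \<in> chart N i" using assms by (simp add: chart_def)
  have sumj: "(\<Sum>p\<le>l. \<xi> j (Suc p) / fact p * fps_nth G (l - p)) = fps_nth (fps_deriv B * G) l" for G
    using assms(2) by (simp add: B_def hom_coord_def fps_mult_nth atMost_atLeast0 fps_deriv_jf del: fps_deriv_nth)
  have summ: "(\<Sum>p\<le>l. \<xi> m (Suc p) / fact p * fps_nth G (l - p)) = fps_nth (fps_deriv A * G) l" if "m \<noteq> i" for G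
    using that by (simp add: A_def hom_coord_def fps_mult_nth atMost_atLeast0 fps_deriv_jf del: fps_deriv_nth)
  have fin: "finite (chart N i)" by (simp add: chart_def)
  have "formal_deriv (chart N i) (coord_change i j m) (Suc l) \<xi> =
      (\<Sum>m'\<in>chart N i. \<Sum>p\<le>l. D m' p * \<xi> m' (Suc p))"
    using partial by simp
  also have "\<dots> = (\<Sum>m'\<in>chart N i. (if m' = m then fact l * (\<Sum>p\<le>l. \<xi> m (Suc p) / fact p * fps_nth (inverse B) (l - p)) else 0) -
      (if m' = j then fact l * (\<Sum>p\<le>l. \<xi> j (Suc p) / fact p * fps_nth (A * (inverse B)\<^sup>2) (l - p)) else 0))"
    using assms(4) by (intro sum.cong refl)
      (auto simp: D_def sum_distrib_left sum_subtractf sum_negf algebra_simps)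
  \<comment> \<open>For \<open>m = i\<close> the numerator is the constant 1: the chart has no
    variable for it, and its derivative vanishes accordingly.\<close>
  also have "\<dots> = (if m = i then 0 else fact l * fps_nth (fps_deriv A * inverse B) l) -
      fact l * fps_nth (fps_deriv B * (A * (inverse B)\<^sup>2)) l"
  proof (cases "m = i")
    case True
    hence "m \<notin> chart N i" by (simp add: chart_def)
    thus ?thesis
      unfolding sumj using fin jI True by (simp add: sum_subtractf sum.delta)
  next
    case False
    hence "m \<in> chart N i" using assms(3) by (simp add: chart_def)
    thus ?thesis
      unfolding sumj summ[OF False] using fin jI False by (simp add: sum_subtractf sum.delta)
  qed
  also have "\<dots> = fact l * fps_nth (fps_deriv A * inverse B - fps_deriv B * (A * (inverse B)\<^sup>2)) l"
    by (simp add: A_def hom_coord_def algebra_simps)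
  also have "fps_deriv A * inverse B - fps_deriv B * (A * (inverse B)\<^sup>2) = fps_deriv (A * inverse B)"
    using B0 by (simp add: fps_inverse_deriv algebra_simps)
  also have "fact l * fps_nth (fps_deriv (A * inverse B)) l = fact (Suc l) * fps_nth (A * inverse B) (Suc l)"
    by (simp only: fps_deriv_nth fact_Suc) (simp add: algebra_simps)
  finally show ?case
    by (simp only: A_def B_def)
qed

lemma jet_change_eq:
  assumes "j \<le> N" "i \<noteq> j" "m \<le> N" "m \<noteq> j" "\<xi> j 0 \<noteq> 0"
  shows "jet_change N i j \<xi> m l = pt (\<lambda>m. hom_coord i \<xi> m * inverse (hom_coord i \<xi> j)) (m, l)"
  using formal_deriv_coord_change[where \<xi> = \<xi>] assms by (simp add: jet_change_def)

section \<open>Global sections are polynomial\<close>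

definition jvars :: "nat set \<Rightarrow> nat \<Rightarrow> (nat \<times> nat) set" where
  "jvars I k = I \<times> {0..k}"

lemma finite_jvars [simp]: "finite I \<Longrightarrow> finite (jvars I k)"
  by (simp add: jvars_def)

lemma finite_chart [simp]: "finite (chart N i)"
  by (simp add: chart_def)

lemma jet_monomial_mon:
  "jet_monomial I k e \<xi> = mon (I \<times> {1..k}) (case_prod e) (case_prod \<xi>)"
  by (simp add: jet_monomial_def mon_def prod.cartesian_product case_prod_unfold)

lemma GG_sum_section_expand:
  assumes "GG_sum_section N k i f"
  obtains T :: "(nat \<times> (nat \<Rightarrow> nat \<Rightarrow> nat)) set" and c e where "finite T"
    "\<And>t. t \<in> T \<Longrightarrow> holomorphic_in (chart N i) (c t)"
    "\<And>x. f (curry x) = (\<Sum>t\<in>T. c t (\<lambda>j. x (j, 0)) * mon (chart N i \<times> {1..k}) (e t) x)"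
proof -
  obtain m g where g: "\<And>n. n \<le> m \<Longrightarrow> GG_section N k n i (g n)" and f: "f = (\<lambda>\<xi>. \<Sum>n\<le>m. g n \<xi>)"
    using assms unfolding GG_sum_section_def by blast
  have "\<forall>n\<in>{..m}. \<exists>Ec. finite (fst Ec) \<and> (\<forall>e\<in>fst Ec. holomorphic_in (chart N i) (snd Ec e)) \<and>
      g n = (\<lambda>\<xi>. \<Sum>e\<in>fst Ec. snd Ec e (\<lambda>j. \<xi> j 0) * jet_monomial (chart N i) k e \<xi>)"
    using g unfolding GG_section_def by fastforce
  then obtain Ec where Ec: "\<And>n. n \<le> m \<Longrightarrow> finite (fst (Ec n))"
    "\<And>n e. n \<le> m \<Longrightarrow> e \<in> fst (Ec n) \<Longrightarrow> holomorphic_in (chart N i) (snd (Ec n) e)"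
    "\<And>n. n \<le> m \<Longrightarrow> g n = (\<lambda>\<xi>. \<Sum>e\<in>fst (Ec n). snd (Ec n) e (\<lambda>j. \<xi> j 0) * jet_monomial (chart N i) k e \<xi>)"
    unfolding bchoice_iff by auto
  show ?thesis
  proof (rule that[of "Sigma {..m} (\<lambda>n. fst (Ec n))" "\<lambda>t. snd (Ec (fst t)) (snd t)" "\<lambda>t. case_prod (snd t)"])
    show "finite (Sigma {..m} (\<lambda>n. fst (Ec n)))"
      using Ec(1) by (intro finite_SigmaI) auto
    show "holomorphic_in (chart N i) (snd (Ec (fst t)) (snd t))" if "t \<in> Sigma {..m} (\<lambda>n. fst (Ec n))" for t
      using that Ec(2) by auto
    fix x :: "nat \<times> nat \<Rightarrow> complex"
    have "f (curry x) = (\<Sum>n\<le>m. \<Sum>e\<in>fst (Ec n). snd (Ec n) e (\<lambda>j. x (j, 0)) *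
        mon (chart N i \<times> {1..k}) (case_prod e) x)"
      unfolding f by (intro sum.cong refl) (simp add: Ec(3) jet_monomial_mon)
    thus "f (curry x) = (\<Sum>t\<in>Sigma {..m} (\<lambda>n. fst (Ec n)). snd (Ec (fst t)) (snd t) (\<lambda>j. x (j, 0)) *
        mon (chart N i \<times> {1..k}) (case_prod (snd t)) x)"
      using Ec(1) by (simp add: sum.Sigma case_prod_unfold)
  qed
qed

text \<open>The degree bound \<open>D\<close> is uniform in the base point, as
  \<open>polyf_separately\<close> demands. In the order-zero directions a section is only known to
  be entire at this stage.\<close>

lemma
  assumes "GG_sum_section N k i f"
  shows GG_sum_section_depends:
      "(\<And>v. v \<in> jvars (chart N i) k \<Longrightarrow> x v = y v) \<Longrightarrow> f (curry x) = f (curry y)"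
    and GG_sum_section_jet_degree:
      "\<exists>D. \<forall>x j l. j \<in> chart N i \<longrightarrow> 1 \<le> l \<longrightarrow> l \<le> k \<longrightarrow>
        (\<exists>p. degree p \<le> D \<and> (\<forall>z. poly p z = f (curry (x((j, l) := z)))))"
    and GG_sum_section_holomorphic:
      "j \<in> chart N i \<Longrightarrow> (\<lambda>z. f (curry (x((j, 0) := z)))) holomorphic_on UNIV"
    and GG_sum_section_continuous:
      "(\<And>v. continuous_on S (\<lambda>t. g t v)) \<Longrightarrow> continuous_on S (\<lambda>t::complex. f (curry (g t)))"
proof -
  obtain T :: "(nat \<times> (nat \<Rightarrow> nat \<Rightarrow> nat)) set" and c e where T: "finite T"
    and c: "\<And>t. t \<in> T \<Longrightarrow> holomorphic_in (chart N i) (c t)"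
    and f: "\<And>x. f (curry x) = (\<Sum>t\<in>T. c t (\<lambda>j. x (j, 0)) * mon (chart N i \<times> {1..k}) (e t) x)"
    using GG_sum_section_expand[OF assms] by blast
  define V where "V = chart N i \<times> {1..k}"
  have V: "finite V" by (simp add: V_def)
  note f = f[folded V_def]
  show "f (curry x) = f (curry y)" if "\<And>v. v \<in> jvars (chart N i) k \<Longrightarrow> x v = y v"
  proof -
    have "c t (\<lambda>j. x (j, 0)) = c t (\<lambda>j. y (j, 0))" if "t \<in> T" for t
      using c[OF that] \<open>\<And>v. v \<in> jvars (chart N i) k \<Longrightarrow> x v = y v\<close>
      by (auto simp: holomorphic_in_def jvars_def)
    moreover have "mon V (e t) x = mon V (e t) y" for t
      unfolding mon_def using that by (intro prod.cong) (auto simp: V_def jvars_def)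
    ultimately show ?thesis
      unfolding f by simp
  qed
  define D where "D = (\<Sum>t\<in>T. \<Sum>v\<in>V. e t v)"
  have "\<exists>p. degree p \<le> D \<and> (\<forall>z. poly p z = f (curry (x((j, l) := z))))"
    if "j \<in> chart N i" "1 \<le> l" "l \<le> k" for x j l
  proof -
    define V' where "V' = V - {(j, l)}"
    have ins: "V = insert (j, l) V'" "finite V'" "(j, l) \<notin> V'"
      using that by (auto simp: V'_def V_def)
    define p where "p = (\<Sum>t\<in>T. monom (c t (\<lambda>j. x (j, 0)) * mon V' (e t) x) (e t (j, l)))"
    have "e t (j, l) \<le> D" if "t \<in> T" for t
    proof -
      have "e t (j, l) \<le> (\<Sum>v\<in>V. e t v)"
        using V ins(1) by (intro member_le_sum) auto
      also have "\<dots> \<le> D"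
        unfolding D_def using T that by (intro member_le_sum[of t T "\<lambda>t. \<Sum>v\<in>V. e t v"]) auto
      finally show ?thesis .
    qed
    hence "degree p \<le> D"
      unfolding p_def using T by (intro degree_sum_le order.trans[OF degree_monom_le]) auto
    moreover have "poly p z = f (curry (x((j, l) := z)))" for z
    proof -
      have "(\<lambda>j'. (x((j, l) := z)) (j', 0)) = (\<lambda>j'. x (j', 0))"
        using that by auto
      thus ?thesis
        unfolding f p_def by (simp only: ins(1) mon_insert_upd[OF ins(2,3)])
          (simp add: poly_sum poly_monom mult.assoc)
    qed
    ultimately show ?thesis by blast
  qed
  thus "\<exists>D. \<forall>x j l. j \<in> chart N i \<longrightarrow> 1 \<le> l \<longrightarrow> l \<le> k \<longrightarrow>
        (\<exists>p. degree p \<le> D \<and> (\<forall>z. poly p z = f (curry (x((j, l) := z)))))"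
    by blast
  show "(\<lambda>z. f (curry (x((j, 0) := z)))) holomorphic_on UNIV" if "j \<in> chart N i"
  proof -
    have "(\<lambda>j'. (x((j, 0) := z)) (j', 0)) = (\<lambda>j'. x (j', 0))(j := z)" for z
      by auto
    moreover have "mon V (e t) (x((j, 0) := z)) = mon V (e t) x" for t z
      unfolding mon_def by (intro prod.cong) (auto simp: V_def)
    ultimately have "f (curry (x((j, 0) := z))) =
        (\<Sum>t\<in>T. c t ((\<lambda>j'. x (j', 0))(j := z)) * mon V (e t) x)" for z
      by (simp only: f)
    moreover have "(\<lambda>z. \<Sum>t\<in>T. c t ((\<lambda>j'. x (j', 0))(j := z)) * mon V (e t) x) holomorphic_on UNIV"
    proof (intro holomorphic_intros)
      fix t assume "t \<in> T"
      thus "(\<lambda>z. c t ((\<lambda>j'. x (j', 0))(j := z))) holomorphic_on UNIV"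
        using c[of t] that unfolding holomorphic_in_def by blast
    qed
    ultimately show ?thesis by presburger
  qed
  show "continuous_on S (\<lambda>t. f (curry (g t)))" if g: "\<And>v. continuous_on S (\<lambda>t. g t v)"
  proof -
    have "continuous_on S (\<lambda>t. \<Sum>s\<in>T. c s (\<lambda>j. g t (j, 0)) * mon V (e s) (g t))"
      unfolding mon_def
    proof (intro continuous_intros g)
      fix s assume "s \<in> T"
      hence "continuous_on UNIV (c s)"
        using c unfolding holomorphic_in_def by blast
      moreover have "continuous_on S (\<lambda>t. \<lambda>j. g t (j, 0))"
        by (intro continuous_on_coordinatewise_then_product g)
      ultimately show "continuous_on S (\<lambda>t. c s (\<lambda>j. g t (j, 0)))"
        by (rule continuous_on_compose2) auto
    qed
    thus ?thesis
      by (simp only: f)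
  qed
qed

lemma curry_case_prod_upd: "curry (x((j, l) := z)) = (curry x)(j := (curry x j)(l := z))"
  by (auto simp: fun_eq_iff)

text \<open>
  In the \<open>j\<close>-th chart the point with \<open>x\<^sub>i\<^sub>j = z\<close> tends to the origin as \<open>z\<close> tends to infinity, so
  the transition rule bounds the section by a multiple of \<open>\<bar>z\<bar>\<^sup>d\<close>.
\<close>

lemma global_section_growth:
  assumes s: "global_section N k d s" and "i \<le> N" "j \<in> chart N i"
  shows "\<exists>B. \<forall>z. 1 \<le> norm z \<longrightarrow> norm (s i (curry (x((j, 0) := z)))) \<le> B * norm z ^ d"
proof -
  have j: "j \<le> N" "i \<noteq> j" "i \<in> chart N j"
    using assms by (auto simp: chart_def)
  define \<xi> where "\<xi> = curry x"
  \<comment> \<open>When the order-zero value is \<open>z\<close>, the series of the coordinate is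
    \<open>z + \<zeta> = z * (1 + u * \<zeta>)\<close> with \<open>u = 1 / z\<close>.\<close>
  define \<zeta> where "\<zeta> = jf (\<xi> j) - fps_const (\<xi> j 0)"
  have \<zeta>0: "fps_nth \<zeta> 0 = 0" by (simp add: \<zeta>_def)
  \<comment> \<open>The same jet in the chart \<open>j\<close>, written in \<open>u = 1 / z\<close>.
    It extends continuously to \<open>u = 0\<close>, so \<open>s j\<close> is bounded along it on
    the closed unit disc.\<close>
  define g where "g = (\<lambda>u v. if fst v \<in> chart N j then
      pt (\<lambda>m. fps_const u * hom_coord i \<xi> m * inverse (1 + fps_const u * \<zeta>)) v else 0)"
  have cont: "continuous_on (cball 0 1) (\<lambda>u. g u v)" for v
  proof -
    have const: "continuous_on (cball 0 1) (\<lambda>u::complex. fps_nth (fps_const u) n)" for n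
      by (cases "n = 0") auto
    have "continuous_on (cball 0 1) (\<lambda>u. fps_nth (inverse (1 + fps_const u * \<zeta>)) n)" for n
      using \<zeta>0 by (intro continuous_on_fps_inverse_nth) (auto intro!: continuous_intros)
    hence "continuous_on (cball 0 1) (\<lambda>u. fact (snd v) *
        fps_nth (fps_const u * hom_coord i \<xi> (fst v) * inverse (1 + fps_const u * \<zeta>)) (snd v))"
      by (intro continuous_intros continuous_on_fps_mult_nth const) auto
    thus ?thesis
      by (cases "fst v \<in> chart N j") (simp_all add: g_def pt_def case_prod_unfold)
  qed
  have GGj: "GG_sum_section N k j (s j)"
    using s j unfolding global_section_def by blast
  have "continuous_on (cball 0 1) (\<lambda>u. s j (curry (g u)))"
    using cont by (rule GG_sum_section_continuous[OF GGj])
  hence "bounded ((\<lambda>u. s j (curry (g u))) ` cball 0 1)"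
    by (intro compact_imp_bounded compact_continuous_image) auto
  then obtain B where B: "\<And>u. norm u \<le> 1 \<Longrightarrow> norm (s j (curry (g u))) \<le> B"
    unfolding bounded_iff by (metis image_eqI mem_cball_0)
  have "norm (s i (curry (x((j, 0) := z)))) \<le> B * norm z ^ d" if "1 \<le> norm z" for z
  proof -
    have z: "z \<noteq> 0" using that by auto
    define \<xi>z where "\<xi>z = curry (x((j, 0) := z))"
    have \<xi>z: "\<xi>z = \<xi>(j := (\<xi> j)(0 := z))"
      unfolding \<xi>z_def \<xi>_def by (rule curry_case_prod_upd)
    have z0: "\<xi>z j 0 = z" by (simp add: \<xi>z)
    have homj: "hom_coord i \<xi>z j = fps_const z + \<zeta>"
      using j by (simp add: hom_coord_def \<xi>z jf_upd \<zeta>_def fps_eq_iff)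
    have homm: "hom_coord i \<xi>z m = hom_coord i \<xi> m" if "m \<noteq> j" for m
      using that by (simp add: hom_coord_def \<xi>z)
    have inv: "inverse (fps_const z + \<zeta>) = fps_const (1 / z) * inverse (1 + fps_const (1 / z) * \<zeta>)"
    proof -
      have "fps_const z + \<zeta> = fps_const z * (1 + fps_const (1 / z) * \<zeta>)"
        using z by (simp add: distrib_left mult.assoc[symmetric])
      thus ?thesis
        using z by (simp add: fps_inverse_mult fps_const_inverse divide_inverse)
    qed
    have "s i \<xi>z = z ^ d * s j (jet_change N i j \<xi>z)"
      using s assms(2) j z z0 unfolding global_section_def by metis
    also have "s j (jet_change N i j \<xi>z) = s j (curry (g (1 / z)))"
    proof -
      have "case_prod (jet_change N i j \<xi>z) v = g (1 / z) v" if v: "v \<in> jvars (chart N j) k" for v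
      proof -
        obtain m l where ml: "v = (m, l)" by (cases v)
        have m: "m \<le> N" "m \<noteq> j" using v by (auto simp: ml jvars_def chart_def)
        have "jet_change N i j \<xi>z m l = pt (\<lambda>m. hom_coord i \<xi>z m * inverse (hom_coord i \<xi>z j)) (m, l)"
          using j m z z0 by (intro jet_change_eq) auto
        also have "\<dots> = g (1 / z) (m, l)"
          using m v by (simp add: ml g_def jvars_def homj homm inv mult_ac)
        finally show ?thesis by (simp add: ml)
      qed
      thus ?thesis
        using GG_sum_section_depends[OF GGj, of "case_prod (jet_change N i j \<xi>z)" "g (1 / z)"] by simp
    qed
    finally have "norm (s i \<xi>z) = norm z ^ d * norm (s j (curry (g (1 / z))))"
      by (simp add: norm_mult norm_power)
    also have "\<dots> \<le> norm z ^ d * B"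
      using that by (intro mult_left_mono B) (auto simp: norm_divide divide_simps)
    finally show ?thesis
      by (simp add: \<xi>z_def mult.commute)
  qed
  thus ?thesis by blast
qed

text \<open>A common bound for the degree in every variable is \<open>max D d\<close>: in positive
  order \<open>D\<close> comes from the definition, in order zero \<open>d\<close> comes from the
  growth estimate.\<close>

lemma global_section_polyf:
  assumes s: "global_section N k d s" and "i \<le> N"
  shows "polyf (jvars (chart N i) k) (\<lambda>x. s i (curry x))"
proof -
  have GG: "GG_sum_section N k i (s i)"
    using s assms unfolding global_section_def by blast
  obtain D where D: "\<And>x j l. j \<in> chart N i \<Longrightarrow> 1 \<le> l \<Longrightarrow> l \<le> k \<Longrightarrow>
        \<exists>p. degree p \<le> D \<and> (\<forall>z. poly p z = s i (curry (x((j, l) := z))))"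
    using GG_sum_section_jet_degree[OF GG] by blast
  show ?thesis
  proof (rule polyf_separately[where D = "max D d"])
    show "s i (curry x) = s i (curry y)" if "\<And>v. v \<in> jvars (chart N i) k \<Longrightarrow> x v = y v" for x y
      using that by (rule GG_sum_section_depends[OF GG])
    fix x v assume "v \<in> jvars (chart N i) k"
    then obtain j l where v: "v = (j, l)" "j \<in> chart N i" "l \<le> k"
      by (auto simp: jvars_def)
    have "\<exists>p. degree p \<le> max D d \<and> (\<forall>z. poly p z = s i (curry (x((j, l) := z))))"
    proof (cases "l = 0")
      case False
      hence "1 \<le> l" by simp
      from D[OF v(2) this v(3), of x] show ?thesis
        by (meson max.coboundedI1)
    next
      case True
      define h where "h = (\<lambda>z. s i (curry (x((j, l) := z))))"
      obtain B where B: "\<And>z. 1 \<le> norm z \<Longrightarrow> norm (h z) \<le> B * norm z ^ d"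
        using global_section_growth[OF s assms(2) v(2), of x] unfolding h_def True by blast
      have "h holomorphic_on UNIV"
        unfolding h_def True using v(2) by (rule GG_sum_section_holomorphic[OF GG])
      hence h: "h z = (\<Sum>m\<le>d. (deriv ^^ m) h 0 / fact m * z ^ m)" for z
        using B by (rule Liouville_polynomial)
      define p where "p = (\<Sum>m\<le>d. monom ((deriv ^^ m) h 0 / fact m) m)"
      have "degree p \<le> d"
        unfolding p_def by (intro degree_sum_le order.trans[OF degree_monom_le]) auto
      moreover have "poly p z = h z" for z
        unfolding h[of z] by (simp add: p_def poly_sum poly_monom)
      ultimately show ?thesis
        unfolding h_def by (meson max.coboundedI2)
    qed
    thus "\<exists>p. degree p \<le> max D d \<and> (\<forall>z. poly p z = s i (curry (x(v := z))))"
      unfolding v(1) .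
  qed simp
qed

section \<open>Homogenisation\<close>

text \<open>The coefficient of order \<open>n\<close> of an inverse series has the constant term to
  the power \<open>n + 1\<close> as denominator, by the recursion for inverses.\<close>

lemma quotient_polyf:
  assumes "i \<in> I" "m \<in> I" "finite I" "l \<le> k"
  shows "\<exists>q. polyf (jvars I k) q \<and> (\<forall>A. fps_nth (A i) 0 \<noteq> 0 \<longrightarrow>
    q (pt A) = fps_nth (A i) 0 ^ (l + 1) * pt (\<lambda>m. A m * inverse (A i)) (m, l))"
proof -
  have V: "finite (jvars I k)" using assms by simp
  have nth: "polyf (jvars I k) (\<lambda>x. x (j, t) / fact t)" if "j \<in> I" "t \<le> k" for j t
    unfolding divide_inverse using that by (intro polyf_intros V) (auto simp: jvars_def)
  have "\<exists>q. polyf (jvars I k) q \<and> (\<forall>A. fps_nth (A i) 0 \<noteq> 0 \<longrightarrow>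
    q (pt A) = fps_nth (A i) 0 ^ (n + 1) * fps_nth (inverse (A i)) n)" if "n \<le> k" for n
    using that
  proof (induction n rule: less_induct)
    case (less n)
    show ?case
    proof (cases "n = 0")
      case True
      thus ?thesis by (intro exI[of _ "\<lambda>x. 1"]) (auto intro!: polyf_const V)
    next
      case False
      have "\<forall>t\<in>{1..n}. \<exists>q. polyf (jvars I k) q \<and> (\<forall>A. fps_nth (A i) 0 \<noteq> 0 \<longrightarrow>
          q (pt A) = fps_nth (A i) 0 ^ (n - t + 1) * fps_nth (inverse (A i)) (n - t))"
        using less by auto
      then obtain q where q: "\<And>t. t \<in> {1..n} \<Longrightarrow> polyf (jvars I k) (q t)"
        "\<And>t A. t \<in> {1..n} \<Longrightarrow> fps_nth (A i) 0 \<noteq> 0 \<Longrightarrow>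
          q t (pt A) = fps_nth (A i) 0 ^ (n - t + 1) * fps_nth (inverse (A i)) (n - t)"
        unfolding bchoice_iff by blast
      \<comment> \<open>With \<open>a\<close> the constant term, \<open>a ^ n\<close> splits as
        \<open>a ^ (t - 1) * a ^ (n - t + 1)\<close>, and the second factor is absorbed by
        \<open>q t\<close>.\<close>
      define r where "r = (\<lambda>x. - 1 * (\<Sum>t=1..n. x (i, t) / fact t * ((x (i, 0) / fact 0) ^ (t - 1) * q t x)))"
      have "polyf (jvars I k) r"
        unfolding r_def using assms(1) less.prems by (intro polyf_intros V nth q(1)) auto
      moreover have "r (pt A) = fps_nth (A i) 0 ^ (n + 1) * fps_nth (inverse (A i)) n"
        if a: "fps_nth (A i) 0 \<noteq> 0" for A
      proof -
        define a where "a = fps_nth (A i) 0"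
        have "fps_nth (inverse (A i)) n = - inverse a * (\<Sum>t=1..n. fps_nth (A i) t * fps_nth (inverse (A i)) (n - t))"
          unfolding a_def using a False by (intro fps_inverse_nth_rec) auto
        hence "a ^ (n + 1) * fps_nth (inverse (A i)) n =
            - 1 * (\<Sum>t=1..n. fps_nth (A i) t * (a ^ n * fps_nth (inverse (A i)) (n - t)))"
          using a by (simp add: a_def sum_distrib_left field_simps)
        also have "(\<Sum>t=1..n. fps_nth (A i) t * (a ^ n * fps_nth (inverse (A i)) (n - t))) =
            (\<Sum>t=1..n. pt A (i, t) / fact t * ((pt A (i, 0) / fact 0) ^ (t - 1) * q t (pt A)))"
        proof (intro sum.cong refl)
          fix t assume t: "t \<in> {1..n}"
          hence "n = (t - 1) + (n - t + 1)" by auto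
          hence "a ^ n = a ^ (t - 1) * a ^ (n - t + 1)"
            by (metis power_add)
          thus "fps_nth (A i) t * (a ^ n * fps_nth (inverse (A i)) (n - t)) =
              pt A (i, t) / fact t * ((pt A (i, 0) / fact 0) ^ (t - 1) * q t (pt A))"
            using q(2)[of t A] t a by (simp add: a_def)
        qed
        finally show ?thesis by (simp add: a_def r_def)
      qed
      ultimately show ?thesis by blast
    qed
  qed
  hence "\<forall>n\<in>{..k}. \<exists>q. polyf (jvars I k) q \<and> (\<forall>A. fps_nth (A i) 0 \<noteq> 0 \<longrightarrow>
    q (pt A) = fps_nth (A i) 0 ^ (n + 1) * fps_nth (inverse (A i)) n)"
    by blast
  then obtain q where q: "\<And>n. n \<le> k \<Longrightarrow> polyf (jvars I k) (q n)"
    "\<And>n A. n \<le> k \<Longrightarrow> fps_nth (A i) 0 \<noteq> 0 \<Longrightarrow>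
       q n (pt A) = fps_nth (A i) 0 ^ (n + 1) * fps_nth (inverse (A i)) n"
    unfolding bchoice_iff by auto
  define r where "r = (\<lambda>x. fact l * (\<Sum>t=0..l. x (m, t) / fact t * ((x (i, 0) / fact 0) ^ t * q (l - t) x)))"
  have "polyf (jvars I k) r"
    unfolding r_def using assms by (intro polyf_intros V nth q(1)) auto
  moreover have "r (pt A) = fps_nth (A i) 0 ^ (l + 1) * pt (\<lambda>m. A m * inverse (A i)) (m, l)"
    if a: "fps_nth (A i) 0 \<noteq> 0" for A
  proof -
    define a where "a = fps_nth (A i) 0"
    have "a ^ (l + 1) * fps_nth (A m * inverse (A i)) l =
        (\<Sum>t=0..l. fps_nth (A m) t * (a ^ (l + 1) * fps_nth (inverse (A i)) (l - t)))"
      by (simp add: fps_mult_nth sum_distrib_left mult_ac)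
    also have "\<dots> = (\<Sum>t=0..l. pt A (m, t) / fact t * ((pt A (i, 0) / fact 0) ^ t * q (l - t) (pt A)))"
    proof (intro sum.cong refl)
      fix t assume t: "t \<in> {0..l}"
      hence "l + 1 = t + (l - t + 1)" by auto
      hence "a ^ (l + 1) = a ^ t * a ^ (l - t + 1)"
        by (metis power_add)
      thus "fps_nth (A m) t * (a ^ (l + 1) * fps_nth (inverse (A i)) (l - t)) =
          pt A (m, t) / fact t * ((pt A (i, 0) / fact 0) ^ t * q (l - t) (pt A))"
        using q(2)[of "l - t" A] a assms(4) by (simp add: a_def)
    qed
    finally show ?thesis
      by (simp add: r_def a_def mult_ac)
  qed
  ultimately show ?thesis by blast
qed

lemma clear_denominators:
  assumes "polyf (jvars J k) f" "J \<subseteq> I" "i \<in> I" "finite I"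
  shows "\<exists>M q. polyf (jvars I k) q \<and> (\<forall>A. fps_nth (A i) 0 \<noteq> 0 \<longrightarrow>
    q (pt A) = fps_nth (A i) 0 ^ M * f (pt (\<lambda>m. A m * inverse (A i))))"
proof -
  have V: "finite (jvars I k)" "finite (jvars J k)"
    using assms finite_subset[OF assms(2)] by auto
  have "\<forall>v\<in>jvars J k. \<exists>q. polyf (jvars I k) q \<and> (\<forall>A. fps_nth (A i) 0 \<noteq> 0 \<longrightarrow>
    q (pt A) = fps_nth (A i) 0 ^ (snd v + 1) * pt (\<lambda>m. A m * inverse (A i)) v)"
    using quotient_polyf[OF assms(3) _ assms(4)] assms(2) by (force simp: jvars_def)
  then obtain q where q: "\<And>v. v \<in> jvars J k \<Longrightarrow> polyf (jvars I k) (q v)"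
    "\<And>v A. v \<in> jvars J k \<Longrightarrow> fps_nth (A i) 0 \<noteq> 0 \<Longrightarrow>
       q v (pt A) = fps_nth (A i) 0 ^ (snd v + 1) * pt (\<lambda>m. A m * inverse (A i)) v"
    unfolding bchoice_iff by blast
  define E where "E = supp (jvars J k) f"
  \<comment> \<open>\<open>w e\<close> is the power of the constant term consumed by the monomial
    \<open>e\<close>; the sum of all of them serves as a common exponent.\<close>
  define w where "w = (\<lambda>e. \<Sum>v\<in>jvars J k. (snd v + 1) * e v)"
  define M where "M = (\<Sum>e\<in>E. w e)"
  have E: "finite E" unfolding E_def by (rule finite_supp[OF V(2) assms(1)])
  define r where "r = (\<lambda>x. \<Sum>e\<in>E. cf (jvars J k) f e * ((x (i, 0)) ^ (M - w e) * (\<Prod>v\<in>jvars J k. q v x ^ e v)))"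
  have "polyf (jvars I k) r"
    unfolding r_def using assms(3) by (intro polyf_intros V q) (auto simp: jvars_def)
  moreover have "r (pt A) = fps_nth (A i) 0 ^ M * f (pt (\<lambda>m. A m * inverse (A i)))"
    if a: "fps_nth (A i) 0 \<noteq> 0" for A
  proof -
    define a where "a = fps_nth (A i) 0"
    define y where "y = pt (\<lambda>m. A m * inverse (A i))"
    have "r (pt A) = (\<Sum>e\<in>E. cf (jvars J k) f e * (a ^ M * mon (jvars J k) e y))"
      unfolding r_def
    proof (intro sum.cong refl)
      fix e assume "e \<in> E"
      hence "w e \<le> M"
        unfolding M_def using E by (intro member_le_sum) auto
      have "(\<Prod>v\<in>jvars J k. q v (pt A) ^ e v) = (\<Prod>v\<in>jvars J k. a ^ ((snd v + 1) * e v) * y v ^ e v)"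
        by (intro prod.cong refl)
          (simp only: q(2)[of _ A, OF _ a] a_def y_def power_mult_distrib power_mult)
      also have "\<dots> = a ^ w e * mon (jvars J k) e y"
        by (simp only: prod.distrib mon_def w_def power_sum)
      finally have "pt A (i, 0) ^ (M - w e) * (\<Prod>v\<in>jvars J k. q v (pt A) ^ e v) = a ^ M * mon (jvars J k) e y"
        using \<open>w e \<le> M\<close> by (simp add: a_def mult.assoc[symmetric] power_add[symmetric])
      thus "cf (jvars J k) f e * (pt A (i, 0) ^ (M - w e) * (\<Prod>v\<in>jvars J k. q v (pt A) ^ e v)) =
          cf (jvars J k) f e * (a ^ M * mon (jvars J k) e y)"
        by simp
    qed
    also have "\<dots> = a ^ M * f y"
      unfolding polyf_expand[OF V(2) assms(1), of y] E_def by (simp add: sum_distrib_left mult_ac)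
    finally show ?thesis by (simp add: a_def y_def)
  qed
  ultimately show ?thesis by blast
qed

lemma
  assumes "finite V" "polyf V f" "\<delta> \<in> exps V"
  shows cf_mon_mult: "cf V (\<lambda>x. mon V \<delta> x * f x) (\<lambda>v. e v + \<delta> v) = cf V f e"
    and cf_mon_mult_ge: "cf V (\<lambda>x. mon V \<delta> x * f x) e' \<noteq> 0 \<Longrightarrow> \<delta> v \<le> e' v"
proof -
  let ?g = "\<lambda>x. \<Sum>e\<in>supp V f. cf V f e * mon V (\<lambda>v. e v + \<delta> v) x"
  have eq: "(\<lambda>x. mon V \<delta> x * f x) = ?g"
  proof
    fix x
    show "mon V \<delta> x * f x = ?g x"
      unfolding polyf_expand[OF assms(1,2), of x] by (simp add: sum_distrib_left mon_add mult_ac)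
  qed
  have mem: "(\<lambda>v. e v + \<delta> v) \<in> exps V" if "e \<in> supp V f" for e
    using that supp_exps[OF assms(1,2)] assms(3) by (force simp: exps_def)
  have c: "cf V (\<lambda>x. mon V \<delta> x * f x) e' = (\<Sum>e | e \<in> supp V f \<and> (\<lambda>v. e v + \<delta> v) = e'. cf V f e)" for e'
    unfolding eq using finite_supp[OF assms(1,2)] mem by (intro cf_family assms(1))
  have "{e'. e' \<in> supp V f \<and> (\<lambda>v. e' v + \<delta> v) = (\<lambda>v. e v + \<delta> v)} = (if e \<in> supp V f then {e} else {})"
  proof -
    have "(\<lambda>v. e' v + \<delta> v) = (\<lambda>v. e v + \<delta> v) \<longleftrightarrow> e' = e" for e'
      by (auto simp: fun_eq_iff)
    thus ?thesis by auto
  qed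
  thus "cf V (\<lambda>x. mon V \<delta> x * f x) (\<lambda>v. e v + \<delta> v) = cf V f e"
    unfolding c by (simp add: supp_def)
  show "\<delta> v \<le> e' v" if "cf V (\<lambda>x. mon V \<delta> x * f x) e' \<noteq> 0"
  proof -
    have "{e. e \<in> supp V f \<and> (\<lambda>v. e v + \<delta> v) = e'} \<noteq> {}"
      using that unfolding c by (metis (no_types, lifting) sum.empty)
    thus ?thesis by auto
  qed
qed

lemma mon_single: "finite V \<Longrightarrow> a \<in> V \<Longrightarrow> mon V (\<lambda>v. if v = a then n else 0) x = x a ^ n"
  by (simp add: mon_def if_distrib[of "\<lambda>n. _ ^ n"] prod.delta' cong: if_cong)

text \<open>The right-hand side forces every exponent of \<open>a\<close> in \<open>P\<close> to be
  at least \<open>n\<close>, because the factor \<open>x b ^ m\<close> contributes nothing to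
  it.\<close>

lemma divide_by_power:
  assumes "finite V" "polyf V P" "polyf V Q" "a \<in> V" "b \<in> V" "a \<noteq> b"
    and "\<And>x. x a \<noteq> 0 \<Longrightarrow> x b \<noteq> 0 \<Longrightarrow> x b ^ m * P x = x a ^ n * Q x"
  obtains F where "polyf V F" "\<And>x. P x = x a ^ n * F x"
proof -
  define \<delta> where "\<delta> = (\<lambda>p q v. (if v = a then p else 0) + (if v = b then q else 0 :: nat))"
  have \<delta>: "mon V (\<delta> p q) x = x a ^ p * x b ^ q" "\<delta> p q \<in> exps V" for p q x
    using assms by (auto simp: \<delta>_def mon_add mon_single exps_def)
  \<comment> \<open>The additional factor \<open>x a * x b\<close> makes both sides vanish where the
    hypothesis says nothing. The identity then holds everywhere and coefficients can be
    compared.\<close>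
  have eq: "(\<lambda>x. mon V (\<delta> 1 (m + 1)) x * P x) = (\<lambda>x. mon V (\<delta> (n + 1) 1) x * Q x)"
  proof
    fix x
    show "mon V (\<delta> 1 (m + 1)) x * P x = mon V (\<delta> (n + 1) 1) x * Q x"
    proof (cases "x a = 0 \<or> x b = 0")
      case False
      thus ?thesis
        using assms(7)[of x] by (simp add: \<delta> mult_ac)
    qed (auto simp: \<delta>)
  qed
  have ge: "n \<le> e a" if "e \<in> supp V P" for e
  proof -
    have "cf V (\<lambda>x. mon V (\<delta> (n + 1) 1) x * Q x) (\<lambda>v. e v + \<delta> 1 (m + 1) v) \<noteq> 0"
      using that cf_mon_mult[OF assms(1,2) \<delta>(2), of 1 "m + 1" e] unfolding eq by (simp add: supp_def)
    from cf_mon_mult_ge[OF assms(1,3) \<delta>(2) this, of a] show ?thesis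
      using assms(6) by (simp add: \<delta>_def)
  qed
  define F where "F = (\<lambda>x. \<Sum>e\<in>supp V P. cf V P e * mon V (e(a := e a - n)) x)"
  show ?thesis
  proof (rule that[of F])
    have "e(a := e a - n) \<in> exps V" if "e \<in> supp V P" for e
      using that supp_exps[OF assms(1,2)] assms(4) by (auto simp: exps_def)
    thus "polyf V F"
      unfolding F_def using finite_supp[OF assms(1,2)] by (intro polyf_family assms(1))
    fix x
    have "mon V e x = x a ^ n * mon V (e(a := e a - n)) x" if "e \<in> supp V P" for e
    proof -
      have "e = (\<lambda>v. (if v = a then n else 0) + (e(a := e a - n)) v)"
        using ge[OF that] by auto
      thus ?thesis
        using mon_add[of V "\<lambda>v. if v = a then n else 0" "e(a := e a - n)" x] mon_single[OF assms(1,4), of n x]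
        by metis
    qed
    thus "P x = x a ^ n * F x"
      unfolding polyf_expand[OF assms(1,2), of x] F_def sum_distrib_left
      by (intro sum.cong) (auto simp: mult_ac)
  qed
qed

text \<open>Dividing by \<open>A i\<close> and then changing charts gives the same jet as dividing
  by \<open>A j\<close>; the powers of the constant terms account for the twist by
  \<open>d\<close>.\<close>

lemma global_section_transition:
  assumes s: "global_section N k d s" and ij: "i \<le> N" "j \<le> N"
    and A: "fps_nth (A i) 0 \<noteq> 0" "fps_nth (A j) 0 \<noteq> 0"
  shows "fps_nth (A i) 0 ^ d * s i (curry (pt (\<lambda>m. A m * inverse (A i)))) =
    fps_nth (A j) 0 ^ d * s j (curry (pt (\<lambda>m. A m * inverse (A j))))"
proof (cases "i = j")
  case False
  define \<xi> where "\<xi> = curry (pt (\<lambda>m. A m * inverse (A i)))"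
  have \<xi>0: "\<xi> j 0 = fps_nth (A j) 0 / fps_nth (A i) 0"
    by (simp add: \<xi>_def divide_inverse)
  have hom: "hom_coord i \<xi> m = A m * inverse (A i)" for m
    using A by (simp add: hom_coord_def \<xi>_def curry_def inverse_mult_eq_1' del: pt_apply)
  have quot: "hom_coord i \<xi> m * inverse (hom_coord i \<xi> j) = A m * inverse (A j)" for m
  proof -
    have "inverse (A j * inverse (A i)) = inverse (A j) * A i"
      using A by (simp add: fps_inverse_mult fps_inverse_idempotent)
    thus ?thesis
      unfolding hom using A inverse_mult_eq_1[of "A i"] by (simp add: mult_ac)
  qed
  have GGj: "GG_sum_section N k j (s j)"
    using s ij unfolding global_section_def by blast
  have "s j (jet_change N i j \<xi>) = s j (curry (pt (\<lambda>m. A m * inverse (A j))))"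
  proof -
    have "case_prod (jet_change N i j \<xi>) v = pt (\<lambda>m. A m * inverse (A j)) v"
      if "v \<in> jvars (chart N j) k" for v
    proof -
      obtain m l where ml: "v = (m, l)" by (cases v)
      have m: "m \<le> N" "m \<noteq> j" using that by (auto simp: ml jvars_def chart_def)
      thus ?thesis
        using jet_change_eq[OF ij(2) False m, of \<xi> l] \<xi>0 A by (simp add: ml quot)
    qed
    thus ?thesis
      using GG_sum_section_depends[OF GGj, of "case_prod (jet_change N i j \<xi>)"
          "pt (\<lambda>m. A m * inverse (A j))"] by simp
  qed
  moreover have "s i \<xi> = \<xi> j 0 ^ d * s j (jet_change N i j \<xi>)"
    using s ij False \<xi>0 A unfolding global_section_def by simp
  ultimately show ?thesis
    using A by (simp add: \<xi>_def[symmetric] \<xi>0 power_divide)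
qed simp

text \<open>The denominator is a power of \<open>X\<^sub>0\<close> when computed in chart 0 and a
  power of \<open>X\<^sub>1\<close> when computed in chart 1, so there is none. Two charts must
  exist for this, whence \<open>N \<ge> 1\<close>.\<close>

lemma global_section_homogenise:
  assumes s: "global_section N k d s" and "N \<ge> 1"
  obtains F where "polyf (jvars {0..N} k) F"
    "\<And>A. fps_nth (A 0) 0 \<noteq> 0 \<Longrightarrow> F (pt A) = fps_nth (A 0) 0 ^ d * s 0 (curry (pt (\<lambda>m. A m * inverse (A 0))))"
proof -
  let ?V = "jvars {0..N} k"
  have V: "finite ?V" by simp
  have sub: "chart N i \<subseteq> {0..N}" for i
    by (auto simp: chart_def)
  obtain M0 q0 where q0: "polyf ?V q0" "\<And>A. fps_nth (A 0) 0 \<noteq> 0 \<Longrightarrow>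
      q0 (pt A) = fps_nth (A 0) 0 ^ M0 * s 0 (curry (pt (\<lambda>m. A m * inverse (A 0))))"
    using clear_denominators[OF global_section_polyf[OF s, of 0] sub, of 0] by auto
  obtain M1 q1 where q1: "polyf ?V q1" "\<And>A. fps_nth (A 1) 0 \<noteq> 0 \<Longrightarrow>
      q1 (pt A) = fps_nth (A 1) 0 ^ M1 * s 1 (curry (pt (\<lambda>m. A m * inverse (A 1))))"
    using clear_denominators[OF global_section_polyf[OF s, of 1] sub, of 1] assms(2) by auto
  have vars: "(0, 0) \<in> ?V" "(1, 0) \<in> ?V"
    using assms(2) by (auto simp: jvars_def)
  obtain F where F: "polyf ?V F" "\<And>x. x (0, 0) ^ d * q0 x = x (0, 0) ^ M0 * F x"
  proof (rule divide_by_power[of ?V "\<lambda>x. x (0, 0) ^ d * q0 x" "\<lambda>x. x (1, 0) ^ d * q1 x" "(0, 0)" "(1, 0)" M1 M0])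
    show "polyf ?V (\<lambda>x. x (0, 0) ^ d * q0 x)" "polyf ?V (\<lambda>x. x (1, 0) ^ d * q1 x)"
      using vars q0 q1 by (intro polyf_intros V; simp)+
    fix x :: "nat \<times> nat \<Rightarrow> complex" assume x: "x (0, 0) \<noteq> 0" "x (1, 0) \<noteq> 0"
    define A where "A = (\<lambda>j. jf (\<lambda>l. x (j, l)))"
    have xA: "x = pt A" by (simp add: A_def pt_jf)
    have nz: "fps_nth (A 0) 0 \<noteq> 0" "fps_nth (A 1) 0 \<noteq> 0"
      using x by (auto simp: A_def)
    show "x (1, 0) ^ M1 * (x (0, 0) ^ d * q0 x) = x (0, 0) ^ M0 * (x (1, 0) ^ d * q1 x)"
      using global_section_transition[OF s, of 0 1 A] assms(2) nz q0(2)[of A] q1(2)[of A]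
      by (simp add: xA)
  qed (use vars V that in auto)
  show ?thesis
  proof (rule that[OF F(1)])
    fix A :: "nat \<Rightarrow> complex fps" assume nz: "fps_nth (A 0) 0 \<noteq> 0"
    have "fps_nth (A 0) 0 ^ M0 * F (pt A) = fps_nth (A 0) 0 ^ d * q0 (pt A)"
      using F(2)[of "pt A"] by simp
    thus "F (pt A) = fps_nth (A 0) 0 ^ d * s 0 (curry (pt (\<lambda>m. A m * inverse (A 0))))"
      using q0(2)[of A] nz by simp
  qed
qed

section \<open>Polynomials in jets vanishing on reciprocals of polynomials\<close>

text \<open>This replaces density arguments: identities are proved off finitely many points of a
  complex line and extended by continuity.\<close>

lemma continuous_zero_off_finite:
  fixes h :: "complex \<Rightarrow> complex"
  assumes "continuous_on UNIV h" "finite B" "\<And>z. z \<notin> B \<Longrightarrow> h z = 0"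
  shows "h x = 0"
proof -
  have "open (- (B - {x}))"
    using assms(2) by (intro open_Compl finite_imp_closed) auto
  hence "eventually (\<lambda>z. h z = 0) (at x)"
    unfolding eventually_at_topological using assms(3)
    by (intro exI[of _ "- (B - {x})"]) auto
  hence "(h \<longlongrightarrow> 0) (at x)"
    by (rule tendsto_eventually)
  moreover have "(h \<longlongrightarrow> h x) (at x)"
    using assms(1) by (simp add: continuous_on_eq_continuous_at isCont_def)
  ultimately show ?thesis
    using tendsto_unique[of "at x" h] by simp
qed

text \<open>The expansion of 1 / (1 - w T) in the parameter T of the jets; \<open>lin w\<close> is
  its inverse.\<close>

definition geo :: "complex \<Rightarrow> complex fps" where
  "geo w = Abs_fps (\<lambda>p. w ^ p)"

definition lin :: "complex \<Rightarrow> complex fps" where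
  "lin z = 1 - fps_const z * fps_X"

lemma geo_nth [simp]: "fps_nth (geo w) p = w ^ p"
  by (simp add: geo_def)

lemma lin_geo: "lin w * geo w = 1"
proof (rule fps_ext)
  fix p
  show "fps_nth (lin w * geo w) p = fps_nth 1 p"
    by (cases p) (simp_all add: lin_def left_diff_distrib mult.assoc)
qed

lemma geo_0: "geo 0 = 1"
  by (rule fps_ext) (auto simp: power_0_left)

lemma lin_0: "lin 0 = 1"
  by (simp add: lin_def)

lemma lin_nth_0 [simp]: "fps_nth (lin z) 0 = 1"
  by (simp add: lin_def)

lemma polyf_fps_prod:
  assumes "finite W" "\<And>i l. i \<in> I \<Longrightarrow> polyf W (\<lambda>w. fps_nth (f i w) l)"
  shows "polyf W (\<lambda>w. fps_nth (\<Prod>i\<in>I. f i w) l)"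
  using assms(2)
proof (induction I arbitrary: l rule: infinite_finite_induct)
  case (insert i I)
  hence "polyf W (\<lambda>w. \<Sum>t=0..l. fps_nth (f i w) t * fps_nth (\<Prod>i\<in>I. f i w) (l - t))"
    by (intro polyf_intros assms(1)) auto
  thus ?case
    using insert.hyps by (simp add: fps_mult_nth)
qed (auto intro: polyf_const[OF assms(1)])

lemma continuous_on_fps_prod:
  fixes f :: "'i \<Rightarrow> 't::topological_space \<Rightarrow> complex fps"
  assumes "\<And>i l. i \<in> I \<Longrightarrow> continuous_on S (\<lambda>t. fps_nth (f i t) l)"
  shows "continuous_on S (\<lambda>t. fps_nth (\<Prod>i\<in>I. f i t) l)"
  using assms
proof (induction I arbitrary: l rule: infinite_finite_induct)
  case (insert i I)
  thus ?case
    by (simp add: continuous_on_fps_mult_nth)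
qed auto

lemma homogeneous_total_degree:
  assumes "finite V" "polyf V g" "\<And>c x. g (\<lambda>l. c * x l) = c ^ n * g x" "e \<in> supp V g"
  shows "(\<Sum>v\<in>V. e v) = n"
  using homogeneous_supp[OF assms(1,2), of "\<lambda>_. 1" n e] assms(3,4)
  by (simp add: scale_def wt_def)

text \<open>
  By induction on the number of numerator factors: \<open>g (fps_nth (lin \<zeta> * y))\<close> is a polynomial in
  \<open>\<zeta>\<close> of degree at most \<open>n\<close>, which vanishes at \<open>\<zeta> = 0\<close> and, by cancellation, at the \<open>n\<close> numbers
  \<open>w i\<close>.
\<close>

lemma vanish_on_fractions:
  assumes g: "polyf {0..k} g" "\<And>c x. g (\<lambda>l. c * x l) = c ^ n * g x"
    and geo: "\<And>w. g (fps_nth (\<Prod>i<n. geo (w i))) = 0"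
  shows "g (fps_nth ((\<Prod>z\<leftarrow>zs. lin z) * (\<Prod>i<n. geo (w i)))) = 0"
proof (induction zs arbitrary: w)
  case Nil
  thus ?case using geo by simp
next
  case (Cons z zs)
  have generic: "g (fps_nth ((\<Prod>z\<leftarrow>z # zs. lin z) * (\<Prod>i<n. geo (w i)))) = 0"
    if inj: "inj_on w {..<n}" and nz: "\<And>i. i < n \<Longrightarrow> w i \<noteq> 0" for w
  proof -
    define y where "y = (\<Prod>z\<leftarrow>zs. lin z) * (\<Prod>i<n. geo (w i))"
    have "\<exists>p. degree p \<le> n \<and> (\<forall>\<zeta>. poly p \<zeta> = g (\<lambda>l. fps_nth y l + \<zeta> * fps_nth (- (fps_X * y)) l))"
      by (rule polyf_line[of _ _ UNIV]) (use g homogeneous_total_degree[OF _ g] in auto)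
    moreover have "(\<lambda>l. fps_nth y l + \<zeta> * fps_nth (- (fps_X * y)) l) = fps_nth (lin \<zeta> * y)" for \<zeta>
      by (rule ext) (simp add: lin_def algebra_simps mult.assoc)
    ultimately obtain p where p: "degree p \<le> n" "\<And>\<zeta>. poly p \<zeta> = g (fps_nth (lin \<zeta> * y))"
      by auto
    have "poly p 0 = 0"
      using Cons.IH[of w] by (simp add: p(2) lin_0 y_def)
    moreover have "poly p (w i) = 0" if "i < n" for i
    proof -
      \<comment> \<open>The factor \<open>lin (w i)\<close> cancels \<open>geo (w i)\<close>;
        putting 0 in place of \<open>w i\<close> keeps the number of factors equal to
        \<open>n\<close>, as \<open>geo 0 = 1\<close>.\<close>
      have split: "(\<Prod>i'<n. geo (u i')) = geo (u i) * (\<Prod>i'\<in>{..<n} - {i}. geo (u i'))" for u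
        using that by (intro prod.remove) auto
      have "lin (w i) * y = (lin (w i) * geo (w i)) * ((\<Prod>z\<leftarrow>zs. lin z) * (\<Prod>i'\<in>{..<n} - {i}. geo (w i')))"
        unfolding y_def split[of w] by (simp add: mult_ac)
      also have "\<dots> = (\<Prod>z\<leftarrow>zs. lin z) * (\<Prod>i'<n. geo ((w(i := 0)) i'))"
        unfolding split[of "w(i := 0)"] by (simp add: lin_geo geo_0)
      finally show ?thesis
        using Cons.IH[of "w(i := 0)"] by (simp only: p(2))
    qed
    ultimately have sub: "insert 0 (w ` {..<n}) \<subseteq> {\<zeta>. poly p \<zeta> = 0}"
      by auto
    have "p = 0"
    proof (rule ccontr)
      assume "p \<noteq> 0"
      have "card (insert 0 (w ` {..<n})) = Suc n"
        using nz inj by (subst card_insert_disjoint) (auto simp: card_image)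
      moreover have "card (insert 0 (w ` {..<n})) \<le> degree p"
        using card_mono[OF poly_roots_finite[OF \<open>p \<noteq> 0\<close>] sub] card_poly_roots_bound[OF \<open>p \<noteq> 0\<close>] by simp
      ultimately show False using p(1) by simp
    qed
    thus ?thesis
      using p(2)[of z] by (simp add: y_def mult.assoc)
  qed
  \<comment> \<open>Coinciding or vanishing \<open>w i\<close> are perturbed: for \<epsilon> outside
    the finite set \<open>B\<close> the numbers \<open>u \<epsilon> i\<close> are distinct and
    nonzero.\<close>
  define u where "u = (\<lambda>\<epsilon> i. w i + \<epsilon> * of_nat (Suc i))"
  define h where "h = (\<lambda>\<epsilon>. g (fps_nth ((\<Prod>z\<leftarrow>z # zs. lin z) * (\<Prod>i<n. geo (u \<epsilon> i)))))"
  define B where "B = (\<lambda>i. - w i / of_nat (Suc i)) ` {..<n} \<union>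
    (\<lambda>(i, j). - (w i - w j) / (of_nat (Suc i) - of_nat (Suc j))) ` ({..<n} \<times> {..<n})"
  have "h \<epsilon> = 0" if "\<epsilon> \<notin> B" for \<epsilon>
    unfolding h_def
  proof (rule generic)
    show "inj_on (u \<epsilon>) {..<n}"
    proof (rule inj_onI, rule ccontr)
      fix i j assume ij: "i \<in> {..<n}" "j \<in> {..<n}" "u \<epsilon> i = u \<epsilon> j" "i \<noteq> j"
      hence "(of_nat (Suc i) - of_nat (Suc j) :: complex) \<noteq> 0"
        by (simp del: of_nat_Suc)
      moreover have "\<epsilon> * (of_nat (Suc i) - of_nat (Suc j)) = - (w i - w j)"
      proof -
        have "\<epsilon> * of_nat (Suc i) = w j + \<epsilon> * of_nat (Suc j) - w i"
          using ij(3) unfolding u_def by (metis add_diff_cancel_left')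
        thus ?thesis
          by (simp only: right_diff_distrib) simp
      qed
      ultimately have "\<epsilon> = - (w i - w j) / (of_nat (Suc i) - of_nat (Suc j))"
        by (metis nonzero_eq_divide_eq)
      hence "\<epsilon> \<in> B"
        using ij unfolding B_def by (intro UnI2 image_eqI[of _ _ "(i, j)"]) auto
      thus False using that by simp
    qed
    show "u \<epsilon> i \<noteq> 0" if "i < n" for i
    proof
      assume "u \<epsilon> i = 0"
      hence "\<epsilon> * of_nat (Suc i) = - w i"
        unfolding u_def by (metis add_eq_0_iff)
      hence "\<epsilon> = - w i / of_nat (Suc i)"
        by (metis nonzero_eq_divide_eq of_nat_neq_0)
      thus False
        using that \<open>\<epsilon> \<notin> B\<close> unfolding B_def by blast
    qed
  qed
  moreover have "continuous_on UNIV h"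
    unfolding h_def
    by (rule polyf_continuous[OF _ g(1)])
      (auto simp: u_def intro!: continuous_on_fps_mult_nth continuous_on_fps_prod continuous_intros)
  moreover have "finite B"
    by (simp add: B_def)
  ultimately have "h 0 = 0"
    using continuous_zero_off_finite by blast
  thus ?case
    by (simp add: h_def u_def)
qed

lemma continuous_on_upd: "continuous_on S (\<lambda>z. (x(a := z)) v :: complex)"
  by (cases "v = a") auto

text \<open>Only the coefficients up to \<open>k\<close> matter. If \<open>x 0\<close> is nonzero,
  they are up to a constant those of a polynomial with constant term 1, which is a product of
  factors \<open>lin z\<close> over the complex numbers; then \<open>vanish_on_fractions\<close>
  applies with all \<open>w i\<close> equal to 0.\<close>

lemma vanish_on_reciprocals:
  assumes g: "polyf {0..k} g" "\<And>c x. g (\<lambda>l. c * x l) = c ^ n * g x"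
    and geo: "\<And>w. g (fps_nth (\<Prod>i<n. geo (w i))) = 0"
  shows "g x = 0"
proof -
  have nonzero: "g x = 0" if "x 0 \<noteq> 0" for x
  proof -
    \<comment> \<open>The coefficients are taken in reverse order, so that \<open>p\<close> is monic
      of degree \<open>k\<close> and its reflection has the coefficients \<open>x l / x 0\<close>.
      Vanishing top coefficients of \<open>x\<close> become roots 0 of \<open>p\<close>, with
      \<open>lin 0 = 1\<close>.\<close>
    define p where "p = (\<Sum>l\<le>k. monom (x (k - l) / x 0) l)"
    have coeff: "coeff p l = (if l \<le> k then x (k - l) / x 0 else 0)" for l
      by (simp add: p_def coeff_sum)
    have "coeff p k = 1" using that by (simp add: coeff)
    moreover have "degree p = k"
    proof (rule antisym)
      show "degree p \<le> k" by (rule degree_le) (simp add: coeff)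
      show "k \<le> degree p" using \<open>coeff p k = 1\<close> by (intro le_degree) simp
    qed
    ultimately have p: "p \<noteq> 0" "lead_coeff p = 1" by auto
    obtain A where A: "p = Polynomial.smult (lead_coeff p) (\<Prod>z\<in>#A. [:- z, 1:])"
      using alg_closed_imp_factorization[OF p(1)] by blast
    obtain zs where zs: "A = mset zs" by (metis ex_mset)
    have p_eq: "p = (\<Prod>z\<leftarrow>zs. [:- z, 1:])"
      using A p(2) by (simp add: zs prod_mset_prod_list[symmetric] flip: mset_map)
    have "fps_of_poly (reflect_poly [:- z, 1:]) = lin z" for z
      by (rule fps_ext) (auto simp: coeff_reflect_poly lin_def coeff_pCons fps_X_def split: nat.splits)
    hence "fps_of_poly (reflect_poly p) = (\<Prod>z\<leftarrow>zs. lin z)"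
      unfolding p_eq by (simp add: reflect_poly_prod_list fps_of_poly_prod_list o_def)
    hence "fps_nth (\<Prod>z\<leftarrow>zs. lin z) l = x l / x 0" if "l \<le> k" for l
      using that \<open>degree p = k\<close> by (metis coeff coeff_reflect_poly diff_diff_cancel diff_le_self fps_of_poly_nth not_le)
    hence "fps_nth (\<Prod>z\<leftarrow>zs. lin z) l = inverse (x 0) * x l" if "l \<in> {0..k}" for l
      using that by (simp add: divide_inverse mult.commute)
    hence "g (fps_nth (\<Prod>z\<leftarrow>zs. lin z)) = g (\<lambda>l. inverse (x 0) * x l)"
      by (rule polyf_cong_vars[OF finite_atLeastAtMost g(1)])
    moreover have "g (fps_nth (\<Prod>z\<leftarrow>zs. lin z)) = 0"
      using vanish_on_fractions[OF g geo, of zs "\<lambda>_. 0"] by (simp add: geo_0)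
    ultimately show ?thesis
      using g(2)[of "inverse (x 0)" x] that by simp
  qed
  have "continuous_on UNIV (\<lambda>z. g (x(0 := z)))"
    by (rule polyf_continuous[OF finite_atLeastAtMost g(1) continuous_on_upd])
  from continuous_zero_off_finite[OF this, of "{0}" "x 0"] nonzero show ?thesis by simp
qed

section \<open>Invariant polynomials are determined by few coefficients\<close>

text \<open>\<open>bw j\<close> measures the degree in the jet of \<open>X\<^sub>j\<close>,
  \<open>lw j\<close> the number of derivatives falling on it. Scaling by \<open>bw j\<close>
  multiplies \<open>X\<^sub>j\<close> by a constant; scaling by \<open>lw j\<close> dilates its
  parameter, which is \<open>dil\<close>.\<close>

definition bw :: "nat \<Rightarrow> nat \<times> nat \<Rightarrow> nat" where
  "bw j v = (if fst v = j then 1 else 0)"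

definition lw :: "nat \<Rightarrow> nat \<times> nat \<Rightarrow> nat" where
  "lw j v = (if fst v = j then snd v else 0)"

definition dil :: "complex \<Rightarrow> complex fps \<Rightarrow> complex fps" where
  "dil t a = Abs_fps (\<lambda>l. t ^ l * fps_nth a l)"



text \<open>Only \<open>X\<^sub>0, ..., X\<^sub>J\<close> are multiplied. Sections give the case of
  all coordinates, and the induction lowers \<open>J\<close>. Constant terms other than 1 are left
  to homogeneity.\<close>

definition invariant :: "nat \<Rightarrow> ((nat \<times> nat \<Rightarrow> complex) \<Rightarrow> complex) \<Rightarrow> bool" where
  "invariant J F \<longleftrightarrow> (\<forall>lam A. fps_nth lam 0 = 1 \<longrightarrow>
     F (pt (\<lambda>j. if j \<le> J then lam * A j else A j)) = F (pt A))"

text \<open>Generating series of the complete homogeneous symmetric polynomials in the variables of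
  block \<open>j\<close>.\<close>

definition hser :: "(nat \<Rightarrow> nat) \<Rightarrow> nat \<Rightarrow> (nat \<times> nat \<Rightarrow> complex) \<Rightarrow> complex fps" where
  "hser n j w = (\<Prod>i<n j. geo (w (j, i)))"

definition rec_eval :: "(nat \<Rightarrow> nat) \<Rightarrow> ((nat \<times> nat \<Rightarrow> complex) \<Rightarrow> complex) \<Rightarrow> (nat \<times> nat \<Rightarrow> complex) \<Rightarrow> complex" where
  "rec_eval n F w = F (pt (\<lambda>j. if j = 0 then 1 else hser n j w))"

definition rvars :: "nat \<Rightarrow> (nat \<Rightarrow> nat) \<Rightarrow> (nat \<times> nat) set" where
  "rvars N n = Sigma {1..N} (\<lambda>j. {..<n j})"

lemma finite_rvars [simp]: "finite (rvars N n)"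
  by (auto simp: rvars_def)

lemma dil_nth [simp]: "fps_nth (dil t a) l = t ^ l * fps_nth a l"
  by (simp add: dil_def)

lemma dil_mult: "dil t (a * b) = dil t a * dil t b"
proof (rule fps_ext)
  fix l
  have "(\<Sum>i=0..l. t ^ l * (fps_nth a i * fps_nth b (l - i))) =
      (\<Sum>i=0..l. t ^ i * fps_nth a i * (t ^ (l - i) * fps_nth b (l - i)))"
  proof (intro sum.cong refl)
    fix i assume "i \<in> {0..l}"
    hence "t ^ l = t ^ i * t ^ (l - i)"
      by (simp add: power_add[symmetric])
    thus "t ^ l * (fps_nth a i * fps_nth b (l - i)) = t ^ i * fps_nth a i * (t ^ (l - i) * fps_nth b (l - i))"
      by simp
  qed
  thus "fps_nth (dil t (a * b)) l = fps_nth (dil t a * dil t b) l"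
    by (simp add: fps_mult_nth sum_distrib_left)
qed

lemma dil_dil: "dil s (dil t a) = dil (s * t) a"
  by (rule fps_ext) (simp add: power_mult_distrib)

lemma dil_1 [simp]: "dil 1 a = a"
  by (rule fps_ext) simp

lemma dil_0: "dil 0 a = fps_const (fps_nth a 0)"
  by (rule fps_ext) (auto simp: power_0_left)

lemma dil_one [simp]: "dil t 1 = 1"
  by (rule fps_ext) auto

lemma dil_geo_prod: "dil t (\<Prod>i\<in>I. geo (w i)) = (\<Prod>i\<in>I. geo (t * w i))"
proof (induction I rule: infinite_finite_induct)
  case (insert i I)
  moreover have "dil t (geo (w i)) = geo (t * w i)"
    by (rule fps_ext) (simp add: power_mult_distrib)
  ultimately show ?case
    by (simp add: dil_mult)
qed simp_all

lemma scale_lw_pt: "scale (lw j) t (pt A) = pt (\<lambda>m. if m = j then dil t (A m) else A m)"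
  by (auto simp: fun_eq_iff scale_def lw_def)

lemma scale_bw_pt: "scale (bw j) c (pt A) = pt (\<lambda>m. if m = j then fps_const c * A m else A m)"
  by (auto simp: fun_eq_iff scale_def bw_def)

text \<open>Multiplying \<open>X\<^sub>j\<close> by a constant \<open>t\<close> commutes with
  multiplication by \<open>lam\<close>, so invariance holds for each coefficient of a power of
  \<open>t\<close>.\<close>

lemma invariant_part_block:
  assumes "finite V" "polyf V F" "invariant J F"
  shows "invariant J (part V (\<lambda>e. wt V (bw j) e = n) F)"
  unfolding invariant_def
proof (intro allI impI)
  fix lam :: "complex fps" and A assume lam: "fps_nth lam 0 = 1"
  obtain K where K: "\<And>e. e \<in> supp V F \<Longrightarrow> wt V (bw j) e \<le> K"
    using polyf_wt_bound[OF assms(1,2)] by metis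
  \<comment> \<open>\<open>L\<close> is at least \<open>n\<close>, so that the part of degree
    \<open>n\<close> is among the coefficients compared even when it is zero.\<close>
  define L where "L = max K n"
  have L: "\<And>e. e \<in> supp V F \<Longrightarrow> wt V (bw j) e \<le> L"
    using K by (force simp: L_def)
  define act where "act = (\<lambda>A. pt (\<lambda>j. if j \<le> J then lam * A j else A j))"
  have "F (scale (bw j) t (act A)) = F (scale (bw j) t (pt A))" for t
  proof -
    have "scale (bw j) t (act A) = act (\<lambda>m. if m = j then fps_const t * A m else A m)"
      unfolding act_def scale_bw_pt by (auto simp: fun_eq_iff mult_ac intro!: arg_cong[of _ _ pt])
    thus ?thesis
      using assms(3) lam unfolding invariant_def act_def scale_bw_pt by simp
  qed
  hence "(\<Sum>q\<le>L. part V (\<lambda>e. wt V (bw j) e = q) F (act A) * t ^ q) =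
      (\<Sum>q\<le>L. part V (\<lambda>e. wt V (bw j) e = q) F (pt A) * t ^ q)" for t
    using polyf_scale[OF assms(1,2) L, of t "act A"] polyf_scale[OF assms(1,2) L, of t "pt A"] by metis
  from poly_coeffs_unique[where a = "\<lambda>q. part V (\<lambda>e. wt V (bw j) e = q) F (act A)"
      and b = "\<lambda>q. part V (\<lambda>e. wt V (bw j) e = q) F (pt A)", OF this, of n]
  show "part V (\<lambda>e. wt V (bw j) e = n) F (pt (\<lambda>j. if j \<le> J then lam * A j else A j)) =
      part V (\<lambda>e. wt V (bw j) e = n) F (pt A)"
    by (simp add: act_def L_def)
qed

text \<open>
  Dilating the jet of \<open>X\<^sub>J\<close> by \<open>t\<close> turns multiplication of \<open>X\<^sub>J\<close> by \<open>lam\<close> into multiplication by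
  \<open>dil (1 / t) lam\<close>, which tends to 1; so the part of top weight no longer sees \<open>lam\<close> in \<open>X\<^sub>J\<close>.
\<close>

lemma invariant_top_part:
  assumes "finite V" "polyf V F" "invariant (Suc J) F"
    and top: "\<And>e. e \<in> supp V F \<Longrightarrow> wt V (lw (Suc J)) e \<le> \<Theta>"
  shows "invariant J (part V (\<lambda>e. wt V (lw (Suc J)) e = \<Theta>) F)"
  unfolding invariant_def
proof (intro allI impI)
  fix lam :: "complex fps" and A assume lam: "fps_nth lam 0 = 1"
  define G where "G = (\<lambda>q. part V (\<lambda>e. wt V (lw (Suc J)) e = q) F)"
  define A' where "A' = (\<lambda>\<sigma> j. if j \<le> J then lam * A j else if j = Suc J then dil \<sigma> lam * A j else A j)"
  \<comment> \<open>With \<open>t = 1 / \<sigma>\<close> this is \<open>\<sigma> ^ \<Theta>\<close>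
    times the difference of the two values of \<open>F\<close>. Only nonnegative powers of \<sigma>
    occur because \<Theta> bounds the weights.\<close>
  define h where "h = (\<lambda>\<sigma>. \<Sum>q\<le>\<Theta>. \<sigma> ^ (\<Theta> - q) * (G q (pt (A' \<sigma>)) - G q (pt A)))"
  have "h \<sigma> = 0" if "\<sigma> \<notin> {0}" for \<sigma>
  proof -
    define t where "t = 1 / \<sigma>"
    have t: "t * \<sigma> = 1" "t \<noteq> 0" using that by (auto simp: t_def)
    define B where "B = (\<lambda>m. if m = Suc J then dil t (A m) else A m)"
    have "scale (lw (Suc J)) t (pt (A' \<sigma>)) = pt (\<lambda>j. if j \<le> Suc J then lam * B j else B j)"
      unfolding scale_lw_pt by (rule arg_cong[of _ _ pt])
        (auto simp: fun_eq_iff A'_def B_def dil_mult dil_dil t)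
    hence "F (scale (lw (Suc J)) t (pt (A' \<sigma>))) = F (scale (lw (Suc J)) t (pt A))"
      using assms(3) lam unfolding invariant_def scale_lw_pt[of _ _ A] B_def by simp
    hence "(\<Sum>q\<le>\<Theta>. G q (pt (A' \<sigma>)) * t ^ q) = (\<Sum>q\<le>\<Theta>. G q (pt A) * t ^ q)"
      using polyf_scale[OF assms(1,2) top, of t "pt (A' \<sigma>)"] polyf_scale[OF assms(1,2) top, of t "pt A"]
      unfolding G_def by metis
    hence "\<sigma> ^ \<Theta> * (\<Sum>q\<le>\<Theta>. (G q (pt (A' \<sigma>)) - G q (pt A)) * t ^ q) = 0"
      by (simp add: algebra_simps sum_subtractf)
    moreover have pow: "\<sigma> ^ \<Theta> * t ^ q = \<sigma> ^ (\<Theta> - q)" if "q \<le> \<Theta>" for q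
    proof -
      have "\<sigma> ^ \<Theta> = \<sigma> ^ (\<Theta> - q) * \<sigma> ^ q"
        using that by (simp add: power_add[symmetric])
      moreover have "\<sigma> ^ q * t ^ q = 1"
        using t by (metis mult.commute power_mult_distrib power_one)
      ultimately show ?thesis by (simp add: mult.assoc)
    qed
    moreover have "\<sigma> ^ \<Theta> * (\<Sum>q\<le>\<Theta>. (G q (pt (A' \<sigma>)) - G q (pt A)) * t ^ q) = h \<sigma>"
      unfolding h_def sum_distrib_left
    proof (intro sum.cong refl)
      fix q assume "q \<in> {..\<Theta>}"
      hence "\<sigma> ^ \<Theta> * t ^ q = \<sigma> ^ (\<Theta> - q)"
        by (intro pow) simp
      thus "\<sigma> ^ \<Theta> * ((G q (pt (A' \<sigma>)) - G q (pt A)) * t ^ q) =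
          \<sigma> ^ (\<Theta> - q) * (G q (pt (A' \<sigma>)) - G q (pt A))"
        by (metis mult.assoc mult.commute)
    qed
    ultimately show ?thesis by simp
  qed
  moreover have "continuous_on UNIV h"
  proof -
    have "continuous_on UNIV (\<lambda>\<sigma>. G q (pt (A' \<sigma>)))" for q
    proof (rule polyf_continuous[OF assms(1), of "G q"])
      show "polyf V (G q)"
        unfolding G_def by (rule polyf_part[OF assms(1,2)])
      show "continuous_on UNIV (\<lambda>\<sigma>. pt (A' \<sigma>) v)" for v
      proof (cases "fst v = Suc J")
        case True
        have "continuous_on UNIV (\<lambda>\<sigma>. fact (snd v) * fps_nth (dil \<sigma> lam * A (Suc J)) (snd v))"
          by (intro continuous_intros continuous_on_fps_mult_nth) (auto intro!: continuous_intros)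
        thus ?thesis
          using True by (cases v) (simp add: A'_def)
      next
        case False
        thus ?thesis by (cases v; cases "fst v \<le> J") (simp_all add: A'_def)
      qed
    qed
    thus ?thesis
      unfolding h_def by (intro continuous_intros)
  qed
  ultimately have "h 0 = 0"
    using continuous_zero_off_finite[of h "{0}"] by blast
  \<comment> \<open>At \<sigma> = 0 only \<open>q = \<Theta>\<close> survives, with
    \<open>0 ^ 0 = 1\<close>.\<close>
  moreover have "h 0 = (\<Sum>q\<in>{\<Theta>}. 0 ^ (\<Theta> - q) * (G q (pt (A' 0)) - G q (pt A)))"
    unfolding h_def by (intro sum.mono_neutral_right) auto
  moreover have "A' 0 = (\<lambda>j. if j \<le> J then lam * A j else A j)"
    by (auto simp: A'_def dil_0 lam)
  ultimately show "part V (\<lambda>e. wt V (lw (Suc J)) e = \<Theta>) F (pt (\<lambda>j. if j \<le> J then lam * A j else A j)) =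
      part V (\<lambda>e. wt V (lw (Suc J)) e = \<Theta>) F (pt A)"
    by (simp add: G_def)
qed

lemma polyf_rec_eval:
  assumes "polyf (jvars {0..N} k) F"
  shows "polyf (rvars N n) (rec_eval n F)"
proof -
  have "polyf (rvars N n) (\<lambda>w. pt (\<lambda>j. if j = 0 then 1 else hser n j w) v)"
    if "v \<in> jvars {0..N} k" for v
  proof (cases "fst v = 0")
    case True
    thus ?thesis
      by (cases v) (auto intro: polyf_const)
  next
    case False
    hence "polyf (rvars N n) (\<lambda>w. fact (snd v) * fps_nth (\<Prod>i<n (fst v). geo (w (fst v, i))) (snd v))"
      using that
      by (intro polyf_mult polyf_const polyf_fps_prod)
        (auto simp: rvars_def jvars_def intro!: polyf_power polyf_var finite_SigmaI)
    thus ?thesis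
      using False by (cases v) (simp add: hser_def)
  qed
  thus ?thesis
    unfolding rec_eval_def by (intro polyf_compose[OF _ _ assms]) auto
qed

text \<open>So the weight \<open>lw j\<close> of \<open>F\<close> becomes the degree of
  \<open>rec_eval n F\<close> in the variables of block \<open>j\<close>, and top parts on one side
  are top parts on the other.\<close>

lemma rec_eval_scale:
  assumes "j \<noteq> 0"
  shows "rec_eval n F (scale (bw j) t w) = F (scale (lw j) t (pt (\<lambda>j. if j = 0 then 1 else hser n j w)))"
proof -
  have "hser n m (scale (bw j) t w) = (if m = j then dil t (hser n m w) else hser n m w)" for m
    by (auto simp: hser_def dil_geo_prod scale_def bw_def)
  thus ?thesis
    unfolding rec_eval_def scale_lw_pt using assms by (auto intro!: arg_cong[of _ _ F] arg_cong[of _ _ pt])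
qed

text \<open>The coordinates are set free one at a time: in \<open>X\<^sub>j\<close> alone
  \<open>F\<close> is homogeneous of degree \<open>n j\<close>, and
  \<open>vanish_on_reciprocals\<close> passes from products of \<open>n j\<close> factors
  \<open>geo\<close> to arbitrary series. What remains is \<open>X\<^sub>0 = 1\<close>, which
  invariance and homogeneity in \<open>X\<^sub>0\<close> remove.\<close>

lemma rec_eval_nonzero:
  assumes F: "polyf (jvars {0..N} k) F" "invariant 0 F"
    and deg: "\<And>e j. e \<in> supp (jvars {0..N} k) F \<Longrightarrow> j \<le> N \<Longrightarrow> wt (jvars {0..N} k) (bw j) e = n j"
    and zero: "\<And>w. rec_eval n F w = 0"
  shows "F x = 0"
proof -
  let ?V = "jvars {0..N} k"
  have V: "finite ?V" by simp
  have hom: "F (scale (bw j) t x) = t ^ n j * F x" if "j \<le> N" for j t x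
    using homogeneous_if_supp[OF V F(1), of "bw j" "n j"] deg that by blast
  \<comment> \<open>After \<open>m\<close> steps the last \<open>m\<close> coordinates are arbitrary
    series.\<close>
  have chain: "F (pt (\<lambda>j. if j = 0 then 1 else if j \<le> N - m then hser n j w else A j)) = 0" if "m \<le> N" for m A w
    using that
  proof (induction m arbitrary: A w)
    case 0
    have "F (pt (\<lambda>j. if j = 0 then 1 else if j \<le> N - 0 then hser n j w else A j)) = rec_eval n F w"
      unfolding rec_eval_def by (rule polyf_cong_vars[OF V F(1)]) (auto simp: jvars_def)
    thus ?case using zero by simp
  next
    case (Suc m)
    define J where "J = N - m"
    have J: "J \<noteq> 0" "J \<le> N" "N - Suc m = J - 1"
      using Suc.prems by (auto simp: J_def)
    define C where "C = (\<lambda>a j. if j = 0 then 1 else if j = J then a else if j \<le> J - 1 then hser n j w else A j)"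
    define g where "g = (\<lambda>x. F (pt (C (Abs_fps x))))"
    have "g (fps_nth (A J)) = 0"
    proof (rule vanish_on_reciprocals[of k g "n J"])
      show "polyf {0..k} g"
        unfolding g_def
      proof (rule polyf_compose[OF V _ F(1)])
        fix v assume v: "v \<in> ?V"
        obtain j l where jl: "v = (j, l)" by (cases v)
        show "polyf {0..k} (\<lambda>y. pt (C (Abs_fps y)) v)"
          using v J(1) unfolding jl
          by (cases "j = 0"; cases "j = J") (auto simp: C_def jvars_def intro!: polyf_intros)
      qed simp
      show "g (\<lambda>l. c * x l) = c ^ n J * g x" for c x
      proof -
        have "pt (C (Abs_fps (\<lambda>l. c * x l))) = scale (bw J) c (pt (C (Abs_fps x)))"
          unfolding scale_bw_pt using J(1)
          by (intro arg_cong[of _ _ pt]) (auto simp: C_def fun_eq_iff fps_eq_iff)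
        thus ?thesis
          unfolding g_def by (simp add: hom[OF J(2)])
      qed
      show "g (fps_nth (\<Prod>i<n J. geo (u i))) = 0" for u
      proof -
        define w' where "w' = (\<lambda>v. if fst v = J then u (snd v) else w v)"
        have "hser n J w' = (\<Prod>i<n J. geo (u i))" "\<And>j. j \<noteq> J \<Longrightarrow> hser n j w' = hser n j w"
          by (auto simp: hser_def w'_def)
        hence "C (\<Prod>i<n J. geo (u i)) = (\<lambda>j. if j = 0 then 1 else if j \<le> N - m then hser n j w' else A j)"
          by (auto simp: C_def fun_eq_iff J_def[symmetric])
        thus ?thesis
          using Suc.IH[of w' A] Suc.prems by (simp add: g_def fps_nth_inverse)
      qed
    qed
    moreover have "C (A J) = (\<lambda>j. if j = 0 then 1 else if j \<le> N - Suc m then hser n j w else A j)"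
      using J(1) by (auto simp: C_def fun_eq_iff J(3))
    ultimately show ?case
      by (simp add: g_def fps_nth_inverse)
  qed
  have nonzero: "F x = 0" if "x (0, 0) \<noteq> 0" for x
  proof -
    define A where "A = (\<lambda>j. jf (\<lambda>l. x (j, l)))"
    have xA: "x = pt A" by (simp add: A_def pt_jf)
    define c where "c = fps_nth (A 0) 0"
    have c: "c \<noteq> 0" using that by (simp add: c_def A_def)
    \<comment> \<open>Here \<open>X\<^sub>0\<close> may be multiplied alone, and this
      \<open>lam\<close> turns it into its constant term.\<close>
    define lam where "lam = fps_const c * inverse (A 0)"
    have lam: "fps_nth lam 0 = 1" "lam * A 0 = fps_const c"
      using c by (simp_all add: lam_def c_def mult.assoc inverse_mult_eq_1)
    have "F x = F (pt (\<lambda>j. if j \<le> 0 then lam * A j else A j))"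
      using F(2) lam(1) unfolding xA invariant_def by simp
    also have "(\<lambda>j. if j \<le> 0 then lam * A j else A j) = (\<lambda>j. if j = 0 then fps_const c * (if j = 0 then 1 else A j) else (if j = 0 then 1 else A j))"
      by (auto simp: lam)
    also have "F (pt \<dots>) = c ^ n 0 * F (pt (\<lambda>j. if j = 0 then 1 else A j))"
      unfolding scale_bw_pt[symmetric] by (rule hom) simp
    also have "(\<lambda>j. if j = 0 then 1 else A j) =
        (\<lambda>j. if j = 0 then 1 else if j \<le> N - N then hser n j (\<lambda>_. 0) else A j)"
      by auto
    also have "F (pt \<dots>) = 0"
      by (rule chain) simp
    finally show ?thesis by simp
  qed
  have "continuous_on UNIV (\<lambda>z. F (x((0, 0) := z)))"
    by (rule polyf_continuous[OF V F(1) continuous_on_upd])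
  from continuous_zero_off_finite[OF this, of "{0}" "x (0, 0)"] nonzero show ?thesis by simp
qed

text \<open>Multiply \<open>X\<^sub>0, ..., X\<^sub>J\<close> by \<open>lin z\<close> where
  \<open>z\<close> is the value of \<open>w (J, i)\<close>. In \<open>X\<^sub>J\<close> this cancels
  the factor \<open>geo z\<close>, so \<open>z\<close> is left only in the coordinates before
  \<open>X\<^sub>J\<close>, each of them affine in \<open>z\<close>; the bound is the degree of
  \<open>F\<close> in these coordinates.\<close>

lemma invariant_degree_bound:
  assumes F: "polyf (jvars {0..N} k) F" "invariant J F"
    and deg: "\<And>e j. e \<in> supp (jvars {0..N} k) F \<Longrightarrow> j \<le> N \<Longrightarrow> wt (jvars {0..N} k) (bw j) e = n j"
    and J: "1 \<le> J" "J \<le> N" "i < n J"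
    and "\<epsilon> \<in> supp (rvars N n) (rec_eval n F)"
  shows "\<epsilon> (J, i) \<le> (\<Sum>l<J. n l)"
proof (rule supp_var_degree[OF _ polyf_rec_eval[OF F(1)]])
  let ?V = "jvars {0..N} k"
  have V: "finite ?V" by simp
  fix w :: "nat \<times> nat \<Rightarrow> complex"
  define H where "H = (\<lambda>j. if j = 0 then 1 else hser n j w)"
  define Q where "Q = (\<Prod>i'\<in>{..<n J} - {i}. geo (w (J, i')))"
  \<comment> \<open>After the multiplication the point moves along a line in \<open>z\<close>:
    \<open>C\<close> is its value at \<open>z = 0\<close> and \<open>D\<close> its
    direction.\<close>
  define C where "C = (\<lambda>j. if j = J then Q else H j)"
  define D where "D = (\<lambda>j. if j < J then - (fps_X * H j) else 0)"
  have sumdeg: "(\<Sum>v\<in>?V \<inter> {v. fst v < J}. e v) \<le> (\<Sum>l<J. n l)" if "e \<in> supp ?V F" for e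
  proof -
    have "?V \<inter> {v. fst v < J} = {..<J} \<times> {0..k}"
      using J(2) by (auto simp: jvars_def)
    hence "(\<Sum>v\<in>?V \<inter> {v. fst v < J}. e v) = (\<Sum>l<J. \<Sum>t\<in>{0..k}. e (l, t))"
      by (simp add: sum.cartesian_product)
    also have "\<dots> = (\<Sum>l<J. n l)"
    proof (intro sum.cong refl)
      fix l assume "l \<in> {..<J}"
      hence "l \<le> N" using J(2) by simp
      have "wt ?V (bw l) e = (\<Sum>m\<in>{0..N}. \<Sum>t\<in>{0..k}. if m = l then e (l, t) else 0)"
        unfolding wt_def jvars_def bw_def sum.cartesian_product by (intro sum.cong) auto
      also have "\<dots> = (\<Sum>m\<in>{0..N}. if m = l then (\<Sum>t\<in>{0..k}. e (l, t)) else 0)"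
        by (intro sum.cong) auto
      also have "\<dots> = (\<Sum>t\<in>{0..k}. e (l, t))"
        using \<open>l \<le> N\<close> by simp
      finally show "(\<Sum>t\<in>{0..k}. e (l, t)) = n l"
        using deg[OF that \<open>l \<le> N\<close>] by simp
    qed
    finally show ?thesis by simp
  qed
  have "\<exists>p. degree p \<le> (\<Sum>l<J. n l) \<and> (\<forall>z. poly p z = F (\<lambda>v. pt C v + z * pt D v))"
    by (rule polyf_line[OF V F(1) sumdeg]) (auto simp: D_def pt_def)
  moreover have "F (\<lambda>v. pt C v + z * pt D v) = rec_eval n F (w((J, i) := z))" for z
  proof -
    define B where "B = (\<lambda>j. if j = 0 then 1 else hser n j (w((J, i) := z)))"
    have BJ: "B J = geo z * Q"
      using J unfolding B_def hser_def Q_def by (subst prod.remove[of _ i]) (auto intro!: prod.cong)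
    have B: "B j = H j" if "j \<noteq> J" for j
      using that by (auto simp: B_def H_def hser_def)
    have CD: "(\<lambda>v. pt C v + z * pt D v) = pt (\<lambda>j. C j + fps_const z * D j)"
      by (auto simp: fun_eq_iff algebra_simps)
    have "(\<lambda>j. C j + fps_const z * D j) = (\<lambda>j. if j \<le> J then lin z * B j else B j)"
    proof
      fix j
      have "lin z * (geo z * Q) = Q"
        using lin_geo[of z] by (simp add: mult.assoc[symmetric])
      moreover have "H j + fps_const z * - (fps_X * H j) = lin z * H j"
        by (simp add: lin_def algebra_simps)
      ultimately show "C j + fps_const z * D j = (if j \<le> J then lin z * B j else B j)"
        by (cases j J rule: linorder_cases) (auto simp: C_def D_def BJ B)
    qed
    moreover have "F (pt (\<lambda>j. if j \<le> J then lin z * B j else B j)) = F (pt B)"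
      using F(2) unfolding invariant_def by simp
    ultimately show ?thesis
      unfolding CD rec_eval_def B_def by simp
  qed
  ultimately show "\<exists>p. degree p \<le> (\<Sum>l<J. n l) \<and> (\<forall>z. poly p z = rec_eval n F (w((J, i) := z)))"
    by simp
qed (use assms in \<open>auto simp: rvars_def\<close>)

text \<open>Invariance for \<open>Suc J\<close> bounds all exponents of block \<open>Suc J\<close>
  already in \<open>F\<close> itself. The bounds for the earlier blocks come from the top part,
  which is invariant for \<open>J\<close>; its coefficient is also one of \<open>F\<close>, since
  the other parts have other degrees in block \<open>Suc J\<close>.\<close>

lemma invariant_good_coefficient:
  assumes "polyf (jvars {0..N} k) F" "invariant J F" "J \<le> N"
    and "\<And>e j. e \<in> supp (jvars {0..N} k) F \<Longrightarrow> j \<le> N \<Longrightarrow> wt (jvars {0..N} k) (bw j) e = n j"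
    and "supp (jvars {0..N} k) F \<noteq> {}"
  shows "\<exists>\<epsilon>\<in>supp (rvars N n) (rec_eval n F).
    \<forall>j i. 1 \<le> j \<longrightarrow> j \<le> J \<longrightarrow> i < n j \<longrightarrow> \<epsilon> (j, i) \<le> (\<Sum>l<j. n l)"
  using assms
proof (induction J arbitrary: F)
  case 0
  let ?V = "jvars {0..N} k"
  have "supp (rvars N n) (rec_eval n F) \<noteq> {}"
  proof
    assume "supp (rvars N n) (rec_eval n F) = {}"
    hence "rec_eval n F w = 0" for w
      using polyf_expand[OF finite_rvars polyf_rec_eval[OF 0(1), of n], of w] by simp
    hence "F x = 0" for x
      using rec_eval_nonzero[of N k F n x] 0 by blast
    hence "F = (\<lambda>x. 0)" by blast
    thus False
      using 0(5) cf_zero[of ?V] by (simp add: supp_def)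
  qed
  thus ?case by auto
next
  case (Suc J)
  let ?V = "jvars {0..N} k"
  have V: "finite ?V" by simp
  define \<Theta> where "\<Theta> = Max (wt ?V (lw (Suc J)) ` supp ?V F)"
  have fin: "finite (supp ?V F)" by (rule finite_supp[OF V Suc.prems(1)])
  have top: "wt ?V (lw (Suc J)) e \<le> \<Theta>" if "e \<in> supp ?V F" for e
    unfolding \<Theta>_def using fin that by auto
  define G where "G = (\<lambda>q. part ?V (\<lambda>e. wt ?V (lw (Suc J)) e = q) F)"
  have G: "polyf ?V (G q)" for q
    unfolding G_def by (rule polyf_part[OF V Suc.prems(1)])
  have suppG: "supp ?V (G q) = {e \<in> supp ?V F. wt ?V (lw (Suc J)) e = q}" for q
    unfolding G_def by (rule supp_part[OF V Suc.prems(1)])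
  have "\<Theta> \<in> wt ?V (lw (Suc J)) ` supp ?V F"
    unfolding \<Theta>_def using fin Suc.prems(5) by (intro Max_in) auto
  hence ne: "supp ?V (G \<Theta>) \<noteq> {}"
    unfolding suppG by auto
  have "invariant J (G \<Theta>)"
    unfolding G_def by (rule invariant_top_part[OF V Suc.prems(1,2) top])
  then obtain \<epsilon> where \<epsilon>: "\<epsilon> \<in> supp (rvars N n) (rec_eval n (G \<Theta>))"
    "\<And>j i. 1 \<le> j \<Longrightarrow> j \<le> J \<Longrightarrow> i < n j \<Longrightarrow> \<epsilon> (j, i) \<le> (\<Sum>l<j. n l)"
    using Suc.IH[of "G \<Theta>"] G ne Suc.prems(3,4) suppG by auto
  have sum: "rec_eval n F = (\<lambda>w. \<Sum>q\<le>\<Theta>. rec_eval n (G q) w)"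
  proof
    fix w
    show "rec_eval n F w = (\<Sum>q\<le>\<Theta>. rec_eval n (G q) w)"
      using polyf_scale[OF V Suc.prems(1) top, of 1 "pt (\<lambda>j. if j = 0 then 1 else hser n j w)"]
      by (simp add: rec_eval_def G_def scale_def)
  qed
  have "cf (rvars N n) (rec_eval n F) \<epsilon> = cf (rvars N n) (rec_eval n (G \<Theta>)) \<epsilon>"
    unfolding sum
  proof (rule cf_homogeneous_sum)
    show "rec_eval n (G q) (scale (bw (Suc J)) t w) = t ^ q * rec_eval n (G q) w" for q t w
    proof -
      have "G q (scale (lw (Suc J)) t x) = t ^ q * G q x" for x
        using homogeneous_if_supp[OF V G] suppG by blast
      thus ?thesis
        by (simp add: rec_eval_scale) (simp add: rec_eval_def)
    qed
  qed (use \<epsilon>(1) polyf_rec_eval[OF G] in \<open>auto simp: supp_def\<close>)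
  hence in_supp: "\<epsilon> \<in> supp (rvars N n) (rec_eval n F)"
    using \<epsilon>(1) by (simp add: supp_def)
  have "\<epsilon> (Suc J, i) \<le> (\<Sum>l<Suc J. n l)" if "i < n (Suc J)" for i
    using invariant_degree_bound[OF Suc.prems(1,2,4) _ Suc.prems(3) that in_supp] by simp
  hence "\<forall>j i. 1 \<le> j \<longrightarrow> j \<le> Suc J \<longrightarrow> i < n j \<longrightarrow> \<epsilon> (j, i) \<le> (\<Sum>l<j. n l)"
    using \<epsilon>(2) by (metis le_Suc_eq)
  thus ?case
    using in_supp by blast
qed

section \<open>The index set\<close>

text \<open>The offset \<open>s\<close> makes an induction on \<open>N\<close> possible: removing
  the last sequence raises the lower bounds of all the others by its length.\<close>

definition tuples :: "nat \<Rightarrow> nat \<Rightarrow> nat \<Rightarrow> (nat \<Rightarrow> nat list) set" where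
  "tuples N s d = {\<alpha>. (\<forall>j. j \<notin> {1..N} \<longrightarrow> \<alpha> j = []) \<and>
     (\<forall>j\<in>{1..N}. sorted_wrt (<) (\<alpha> j) \<and> set (\<alpha> j) \<subseteq> {s + seq_s N \<alpha> (j + 1)..<d})}"

lemma tuples_eq:
  "{\<alpha> \<in> BNplus N. max_entry N \<alpha> \<le> int d - 1} = tuples N 0 d"
proof -
  have fin: "finite (insert (-1) (int ` (\<Union>j\<in>{1..N}. set (\<alpha> j))))" for \<alpha> :: "nat \<Rightarrow> nat list"
    by simp
  have "max_entry N \<alpha> \<le> int d - 1 \<longleftrightarrow> (\<forall>j\<in>{1..N}. \<forall>a\<in>set (\<alpha> j). a < d)" for \<alpha>
    unfolding max_entry_def by (subst Max_le_iff[OF fin]) auto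
  thus ?thesis
    unfolding BNplus_def tuples_def by (auto simp: subset_iff)
qed

definition cut :: "nat \<Rightarrow> (nat \<Rightarrow> nat list) \<Rightarrow> nat \<Rightarrow> nat list" where
  "cut j \<alpha> = \<alpha>(j := [])"

lemma cut_same: "cut j \<alpha> j = []"
  by (simp add: cut_def)

lemma cut_other: "m \<noteq> j \<Longrightarrow> cut j \<alpha> m = \<alpha> m"
  by (simp add: cut_def)

lemma seq_s_Suc: "j \<le> Suc N \<Longrightarrow> seq_s (Suc N) \<alpha> j = length (\<alpha> (Suc N)) + seq_s N (cut (Suc N) \<alpha>) j"
proof -
  assume "j \<le> Suc N"
  moreover have "(\<Sum>m=j..N. length (cut (Suc N) \<alpha> m)) = (\<Sum>m=j..N. length (\<alpha> m))"
    by (intro sum.cong refl) (simp add: cut_other)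
  ultimately show ?thesis
    by (simp add: seq_s_def)
qed

lemma seq_s_beyond: "N < j \<Longrightarrow> seq_s N \<alpha> j = 0"
  by (simp add: seq_s_def)



lemma tuples_Suc:
  "\<alpha> \<in> tuples (Suc N) s d \<longleftrightarrow> sorted_wrt (<) (\<alpha> (Suc N)) \<and> set (\<alpha> (Suc N)) \<subseteq> {s..<d} \<and>
    cut (Suc N) \<alpha> \<in> tuples N (s + length (\<alpha> (Suc N))) d"
proof -
  have "seq_s (Suc N) \<alpha> (Suc N + 1) = 0"
    by (simp add: seq_s_beyond)
  moreover have "(\<forall>j\<in>{1..N}. sorted_wrt (<) (\<alpha> j) \<and> set (\<alpha> j) \<subseteq> {s + seq_s (Suc N) \<alpha> (j + 1)..<d}) \<longleftrightarrow>
      (\<forall>j\<in>{1..N}. sorted_wrt (<) (cut (Suc N) \<alpha> j) \<and> set (cut (Suc N) \<alpha> j) \<subseteq>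
        {s + length (\<alpha> (Suc N)) + seq_s N (cut (Suc N) \<alpha>) (j + 1)..<d})"
    by (intro ball_cong refl) (simp add: seq_s_Suc cut_other add.assoc)
  moreover have "(\<forall>j. j \<notin> {1..Suc N} \<longrightarrow> \<alpha> j = []) \<longleftrightarrow> (\<forall>j. j \<notin> {1..N} \<longrightarrow> cut (Suc N) \<alpha> j = [])"
  proof -
    have "(j \<notin> {1..Suc N} \<longrightarrow> \<alpha> j = []) \<longleftrightarrow> (j \<notin> {1..N} \<longrightarrow> cut (Suc N) \<alpha> j = [])" for j
      by (cases "j = Suc N") (auto simp: cut_same cut_other)
    thus ?thesis by simp
  qed
  moreover have "(\<forall>j\<in>{1..Suc N}. P j) \<longleftrightarrow> P (Suc N) \<and> (\<forall>j\<in>{1..N}. P j)" for P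
  proof -
    have "{1..Suc N} = insert (Suc N) {1..N}" by auto
    thus ?thesis by (simp only: ball_simps)
  qed
  ultimately show ?thesis
    unfolding tuples_def mem_Collect_eq by (simp only: add_0_right) blast
qed

text \<open>Summing over the set \<open>S\<close> of entries of the last sequence gives the
  expansion of \<open>(1 + (N + 1)) ^ (d - s)\<close>. For \<open>s > d\<close> both sides are 1 by
  truncated subtraction.\<close>

lemma card_tuples: "finite (tuples N s d) \<and> card (tuples N s d) = (N + 1) ^ (d - s)"
proof (induction N arbitrary: s)
  case 0
  have "tuples 0 s d = {\<lambda>_. []}"
    by (auto simp: tuples_def)
  thus ?case by simp
next
  case (Suc N)
  let ?X = "{s..<d}"
  let ?S = "Sigma (Pow ?X) (\<lambda>S. tuples N (s + card S) d)"
  have bij: "bij_betw (\<lambda>\<alpha>. (set (\<alpha> (Suc N)), cut (Suc N) \<alpha>)) (tuples (Suc N) s d) ?S"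
  proof (rule bij_betw_byWitness[where f' = "\<lambda>(S, \<beta>). \<beta>(Suc N := sorted_list_of_set S)"])
    show "\<forall>\<alpha>\<in>tuples (Suc N) s d. (case (set (\<alpha> (Suc N)), cut (Suc N) \<alpha>) of (S, \<beta>) \<Rightarrow> \<beta>(Suc N := sorted_list_of_set S)) = \<alpha>"
      by (simp add: tuples_Suc strict_sorted_iff sorted_list_of_set.idem_if_sorted_distinct cut_def)
    have none: "\<beta> (Suc N) = []" if "\<beta> \<in> tuples N t d" for \<beta> t
      using that by (auto simp: tuples_def)
    have fin: "finite S" if "S \<subseteq> ?X" for S
      using that finite_subset by blast
    have cut_none: "cut (Suc N) (\<beta>(Suc N := xs)) = \<beta>" if "\<beta> \<in> tuples N t d" for \<beta> t xs
      using none[OF that] by (simp add: cut_def fun_upd_idem)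
    show "\<forall>p\<in>?S. (set ((case p of (S, \<beta>) \<Rightarrow> \<beta>(Suc N := sorted_list_of_set S)) (Suc N)),
        cut (Suc N) (case p of (S, \<beta>) \<Rightarrow> \<beta>(Suc N := sorted_list_of_set S))) = p"
      using cut_none fin by auto
    show "(\<lambda>\<alpha>. (set (\<alpha> (Suc N)), cut (Suc N) \<alpha>)) ` tuples (Suc N) s d \<subseteq> ?S"
      by (auto simp: tuples_Suc strict_sorted_iff distinct_card subset_iff)
    show "(\<lambda>(S, \<beta>). \<beta>(Suc N := sorted_list_of_set S)) ` ?S \<subseteq> tuples (Suc N) s d"
      using fin by (auto simp: tuples_Suc cut_none)
  qed
  have fin: "finite ?S"
    using Suc by (intro finite_SigmaI) auto
  have "card ?S = (\<Sum>S\<in>Pow ?X. (N + 1) ^ (d - (s + card S)))"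
    using Suc by (subst card_SigmaI) auto
  also have "\<dots> = (\<Sum>S\<in>Pow ?X. (\<Prod>x\<in>S. 1) * (\<Prod>x\<in>?X - S. N + 1))"
  proof (intro sum.cong refl)
    fix S assume "S \<in> Pow ?X"
    hence "card (?X - S) = d - s - card S"
      by (subst card_Diff_subset) (auto intro: finite_subset)
    thus "(N + 1) ^ (d - (s + card S)) = (\<Prod>x\<in>S. 1) * (\<Prod>x\<in>?X - S. N + 1)"
      by simp
  qed
  also have "\<dots> = (\<Prod>x\<in>?X. 1 + (N + 1))"
    by (rule prod_add[symmetric]) simp
  finally show ?case
    using bij_betw_same_card[OF bij] bij_betw_finite[OF bij] fin by simp
qed

text \<open>For \<open>s = 0\<close> this makes \<open>d - seq_s N \<alpha> 1\<close> a genuine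
  difference: it is the number of columns of \<open>X\<^sub>0\<close> in the homogenised
  determinant.\<close>

lemma seq_s_le:
  assumes "\<alpha> \<in> tuples N s d" "s \<le> d"
  shows "s + seq_s N \<alpha> 1 \<le> d"
  using assms
proof (induction N arbitrary: \<alpha> s)
  case 0
  thus ?case by (simp add: seq_s_def)
next
  case (Suc N)
  have "length (\<alpha> (Suc N)) = card (set (\<alpha> (Suc N)))"
    using Suc.prems(1) by (simp add: tuples_Suc strict_sorted_iff distinct_card)
  also have "\<dots> \<le> d - s"
    using Suc.prems(1) card_mono[of "{s..<d}" "set (\<alpha> (Suc N))"] by (simp add: tuples_Suc)
  finally have "s + length (\<alpha> (Suc N)) \<le> d"
    using Suc.prems(2) by simp
  thus ?case
    using Suc.IH[of "cut (Suc N) \<alpha>" "s + length (\<alpha> (Suc N))"] Suc.prems seq_s_Suc[of 1 N \<alpha>]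
    by (simp add: tuples_Suc)
qed

lemma sorted_entry_ge:
  assumes "sorted_wrt (<) xs" "\<And>a. a \<in> set xs \<Longrightarrow> s \<le> a" "i < length xs"
  shows "s + i \<le> (xs ! i :: nat)"
  using assms(3)
proof (induction i)
  case 0
  thus ?case using assms(2) by simp
next
  case (Suc i)
  hence "xs ! i < xs ! Suc i"
    using assms(1) by (simp add: sorted_wrt_nth_less)
  thus ?case using Suc by simp
qed

section \<open>Numbering of the columns, and orders along the diagonal\<close>

lemma column_list_Suc:
  "column_list (Suc N) \<alpha> = map (Pair (Suc N)) (\<alpha> (Suc N)) @ column_list N (cut (Suc N) \<alpha>)"
proof -
  have "map (\<lambda>j. map (Pair j) (\<alpha> j)) (rev [1..<Suc N]) =
      map (\<lambda>j. map (Pair j) ((cut (Suc N) \<alpha>) j)) (rev [1..<Suc N])"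
    by (intro map_cong refl) (auto simp: cut_def)
  moreover have "rev [1..<Suc (Suc N)] = Suc N # rev [1..<Suc N]"
    by simp
  ultimately show ?thesis
    unfolding column_list_def by (simp only: list.map concat.simps)
qed

lemma length_column_list: "length (column_list N \<alpha>) = seq_s N \<alpha> 1"
proof (induction N arbitrary: \<alpha>)
  case 0
  thus ?case by (simp add: column_list_def seq_s_def)
next
  case (Suc N)
  thus ?case by (simp add: column_list_Suc seq_s_Suc)
qed

lemma column_list_index:
  assumes "c < seq_s N \<alpha> 1"
  shows "\<exists>j i. j \<in> {1..N} \<and> i < length (\<alpha> j) \<and> c = seq_s N \<alpha> (j + 1) + i \<and>
    column_list N \<alpha> ! c = (j, \<alpha> j ! i)"
  using assms
proof (induction N arbitrary: \<alpha> c)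
  case 0
  thus ?case by (simp add: seq_s_def)
next
  case (Suc N)
  show ?case
  proof (cases "c < length (\<alpha> (Suc N))")
    case True
    thus ?thesis
      by (intro exI[of _ "Suc N"] exI[of _ c]) (simp add: seq_s_beyond column_list_Suc nth_append)
  next
    case False
    let ?c = "c - length (\<alpha> (Suc N))"
    have "?c < seq_s N (cut (Suc N) \<alpha>) 1"
      using Suc.prems False by (simp add: seq_s_Suc)
    from Suc.IH[OF this] obtain j i where ji: "j \<in> {1..N}" "i < length ((cut (Suc N) \<alpha>) j)"
      "?c = seq_s N (cut (Suc N) \<alpha>) (j + 1) + i"
      "column_list N (cut (Suc N) \<alpha>) ! ?c = (j, (cut (Suc N) \<alpha>) j ! i)"
      by blast
    have "cut (Suc N) \<alpha> j = \<alpha> j"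
      using ji(1) by (simp add: cut_other)
    hence "j \<in> {1..Suc N} \<and> i < length (\<alpha> j) \<and> c = seq_s (Suc N) \<alpha> (j + 1) + i \<and>
        column_list (Suc N) \<alpha> ! c = (j, \<alpha> j ! i)"
      using ji False by (simp add: seq_s_Suc column_list_Suc nth_append)
    thus ?thesis by blast
  qed
qed

lemma column_list_nth:
  assumes "j \<in> {1..N}" "i < length (\<alpha> j)"
  shows "seq_s N \<alpha> (j + 1) + i < seq_s N \<alpha> 1 \<and> column_list N \<alpha> ! (seq_s N \<alpha> (j + 1) + i) = (j, \<alpha> j ! i)"
  using assms
proof (induction N arbitrary: \<alpha>)
  case 0
  thus ?case by simp
next
  case (Suc N)
  show ?case
  proof (cases "j = Suc N")
    case True
    thus ?thesis
      using Suc.prems seq_s_Suc[of 1 N \<alpha>]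
      by (simp add: seq_s_beyond column_list_Suc nth_append)
  next
    case False
    have "cut (Suc N) \<alpha> j = \<alpha> j" "j \<in> {1..N}"
      using False Suc.prems by (simp_all add: cut_other)
    thus ?thesis
      using Suc.IH[of "cut (Suc N) \<alpha>"] Suc.prems(2) by (simp add: seq_s_Suc column_list_Suc nth_append)
  qed
qed

lemma column_list_sorted:
  assumes "\<alpha> \<in> tuples N s d"
  shows "sorted_wrt (\<lambda>p q. fst q < fst p \<or> fst p = fst q \<and> snd p < snd q) (column_list N \<alpha>)"
  using assms
proof (induction N arbitrary: \<alpha> s)
  case 0
  thus ?case by (simp add: column_list_def)
next
  case (Suc N)
  have "fst q \<le> N" if "q \<in> set (column_list N \<beta>)" for q \<beta>
    using that by (auto simp: column_list_def)
  hence "fst q < Suc N" if "q \<in> set (column_list N \<beta>)" for q \<beta>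
    using that le_imp_less_Suc by blast
  moreover have "sorted_wrt (\<lambda>p q. fst q < fst p \<or> fst p = fst q \<and> snd p < snd q) (column_list N (cut (Suc N) \<alpha>))"
    using Suc.IH Suc.prems by (auto simp: tuples_Suc)
  ultimately show ?case
    using Suc.prems by (auto simp: column_list_Suc sorted_wrt_append sorted_wrt_map tuples_Suc)
qed

text \<open>
  The orders of the jet variables of the columns of block \<open>j\<close> in the diagonal term of the
  determinant.
\<close>

definition orders :: "nat \<Rightarrow> (nat \<Rightarrow> nat list) \<Rightarrow> nat \<Rightarrow> nat list" where
  "orders N \<alpha> j = map (\<lambda>i. \<alpha> j ! i - (seq_s N \<alpha> (j + 1) + i)) [0..<length (\<alpha> j)]"

lemma entry_ge:
  assumes "\<alpha> \<in> tuples N s d" "j \<in> {1..N}" "i < length (\<alpha> j)"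
  shows "s + seq_s N \<alpha> (j + 1) + i \<le> \<alpha> j ! i"
  using assms by (intro sorted_entry_ge) (auto simp: tuples_def subset_iff)

lemma entry_less:
  assumes "\<alpha> \<in> tuples N s d" "j \<in> {1..N}" "i < length (\<alpha> j)"
  shows "\<alpha> j ! i < d"
  using assms nth_mem[of i "\<alpha> j"] by (auto simp: tuples_def subset_iff simp del: nth_mem)

lemma sorted_orders:
  assumes "\<alpha> \<in> tuples N s d" "j \<in> {1..N}"
  shows "sorted (orders N \<alpha> j)"
proof (rule sorted_wrt_iff_nth_Suc_transp[THEN iffD2, rule_format])
  fix i assume i: "Suc i < length (orders N \<alpha> j)"
  hence "\<alpha> j ! i < \<alpha> j ! Suc i"
    using assms by (simp add: tuples_def orders_def sorted_wrt_nth_less)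
  thus "orders N \<alpha> j ! i \<le> orders N \<alpha> j ! Suc i"
    using i by (simp add: orders_def)
qed (auto simp: transp_def)

lemma orders_inj:
  assumes \<alpha>: "\<alpha> \<in> tuples N s d" and \<beta>: "\<beta> \<in> tuples N s d"
    and eq: "\<And>j. j \<in> {1..N} \<Longrightarrow> orders N \<alpha> j = orders N \<beta> j"
  shows "\<alpha> = \<beta>"
proof
  fix j
  have len: "length (\<alpha> j) = length (\<beta> j)" if "j \<in> {1..N}" for j
    using eq[OF that] by (metis length_map length_upt minus_nat.diff_0 orders_def)
  show "\<alpha> j = \<beta> j"
  proof (cases "j \<in> {1..N}")
    case True
    have seq: "seq_s N \<alpha> (j + 1) = seq_s N \<beta> (j + 1)"
      unfolding seq_s_def using len by (intro sum.cong) auto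
    show ?thesis
    proof (rule nth_equalityI[OF len[OF True]])
      fix i assume i: "i < length (\<alpha> j)"
      hence "orders N \<alpha> j ! i = orders N \<beta> j ! i"
        using eq[OF True] by simp
      hence "\<alpha> j ! i - (seq_s N \<alpha> (j + 1) + i) = \<beta> j ! i - (seq_s N \<alpha> (j + 1) + i)"
        using i len[OF True] seq by (simp add: orders_def)
      thus "\<alpha> j ! i = \<beta> j ! i"
        using entry_ge[OF \<alpha> True i] entry_ge[OF \<beta> True, of i] i len[OF True] seq by simp
    qed
  next
    case False
    thus ?thesis using \<alpha> \<beta> by (simp add: tuples_def)
  qed
qed

text \<open>Adding back the offsets makes a sorted list strictly increasing. The position
  \<open>i\<close> is less than \<open>length (L j)\<close>, so the bound on \<open>a\<close> keeps
  the new entries below \<open>d\<close>.\<close>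

lemma orders_surj:
  assumes "\<And>j. j \<in> {1..N} \<Longrightarrow> sorted (L j) \<and> (\<forall>a\<in>set (L j). a + (\<Sum>m=j..N. length (L m)) \<le> d)"
  obtains \<alpha> where "\<alpha> \<in> tuples N 0 d" "\<And>j. j \<in> {1..N} \<Longrightarrow> orders N \<alpha> j = L j"
proof -
  define S where "S = (\<lambda>j. \<Sum>m=j..N. length (L m))"
  define \<alpha> where "\<alpha> = (\<lambda>j. if j \<in> {1..N} then map (\<lambda>i. L j ! i + (S (j + 1) + i)) [0..<length (L j)] else [])"
  have len: "length (\<alpha> j) = length (L j)" if "j \<in> {1..N}" for j
    using that by (simp add: \<alpha>_def)
  have seq: "seq_s N \<alpha> (j + 1) = S (j + 1)" for j
    unfolding seq_s_def S_def by (intro sum.cong refl len) auto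
  have S: "S j = length (L j) + S (j + 1)" if "j \<in> {1..N}" for j
    using that by (simp add: S_def sum.atLeast_Suc_atMost)
  show ?thesis
  proof (rule that[of \<alpha>])
    have "sorted_wrt (<) (\<alpha> j) \<and> set (\<alpha> j) \<subseteq> {0 + seq_s N \<alpha> (j + 1)..<d}" if j: "j \<in> {1..N}" for j
    proof
      have "sorted (L j)" using assms[OF j] by simp
      thus "sorted_wrt (<) (\<alpha> j)"
        using j by (auto simp: \<alpha>_def sorted_wrt_iff_nth_less sorted_iff_nth_mono intro!: add_le_less_mono)
      show "set (\<alpha> j) \<subseteq> {0 + seq_s N \<alpha> (j + 1)..<d}"
      proof
        fix a assume "a \<in> set (\<alpha> j)"
        then obtain i where i: "i < length (L j)" "a = L j ! i + (S (j + 1) + i)"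
          using j by (auto simp: \<alpha>_def)
        moreover have "L j ! i + S j \<le> d"
          using assms[OF j] i(1) by (simp add: S_def)
        ultimately show "a \<in> {0 + seq_s N \<alpha> (j + 1)..<d}"
          using S[OF j] seq[of j] by simp
      qed
    qed
    thus "\<alpha> \<in> tuples N 0 d"
      by (auto simp: tuples_def \<alpha>_def)
    show "orders N \<alpha> j = L j" if "j \<in> {1..N}" for j
    proof (rule nth_equalityI)
      show "length (orders N \<alpha> j) = length (L j)"
        using len[OF that] by (simp add: orders_def)
      fix i assume "i < length (orders N \<alpha> j)"
      hence i: "i < length (L j)" "i < length (\<alpha> j)"
        using len[OF that] by (simp_all add: orders_def)
      hence "\<alpha> j ! i = L j ! i + (S (j + 1) + i)"
        using that by (simp add: \<alpha>_def)
      thus "orders N \<alpha> j ! i = L j ! i"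
        using seq[of j] i(2) by (simp add: orders_def)
    qed
  qed
qed

section \<open>Linear independence of the determinants\<close>

text \<open>A permutation other than the identity has an inversion, and undoing it increases the
  sum.\<close>

lemma permutation_increase:
  fixes b :: "nat \<Rightarrow> int"
  assumes p: "p permutes {0..<n}" "p \<noteq> id"
    and b: "\<And>i j. i < j \<Longrightarrow> j < n \<Longrightarrow> b i < b j"
  obtains q where "q permutes {0..<n}" "(\<Sum>i<n. b (p i) * int i) < (\<Sum>i<n. b (q i) * int i)"
proof -
  \<comment> \<open>Some \<open>j\<close> is moved down; if every \<open>i < j\<close> were sent
    below \<open>p j\<close>, then \<open>j\<close> values would have to fit into fewer than
    \<open>j\<close> places.\<close>
  obtain j where j: "j < n" "p j < j"
    using permutes_natset_ge[OF p(1)] p(2) by (meson atLeastLessThan_iff not_le)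
  have "\<exists>i<j. p j < p i"
  proof (rule ccontr)
    assume no: "\<not> (\<exists>i<j. p j < p i)"
    have "p i < p j" if "i < j" for i
      using no that permutes_inj[OF p(1)] by (metis inj_eq less_irrefl linorder_neqE_nat)
    hence "p ` {..<j} \<subseteq> {..<p j}" by auto
    hence "card (p ` {..<j}) \<le> p j"
      using card_mono[of "{..<p j}"] by simp
    thus False
      using j(2) permutes_inj_on[OF p(1)] by (simp add: card_image)
  qed
  then obtain i where i: "i < j" "p j < p i" by blast
  define q where "q = p \<circ> Transposition.transpose i j"
  have q: "q permutes {0..<n}"
    unfolding q_def using i j by (intro permutes_compose[OF permutes_swap_id p(1)]) auto
  have split: "(\<Sum>l<n. f l) = f i + (f j + (\<Sum>l\<in>{..<n} - {i} - {j}. f l))" for f :: "nat \<Rightarrow> int"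
    using i j by (simp add: sum.remove[of "{..<n}" i] sum.remove[of "{..<n} - {i}" j])
  have rest: "(\<Sum>l\<in>{..<n} - {i} - {j}. b (q l) * int l) = (\<Sum>l\<in>{..<n} - {i} - {j}. b (p l) * int l)"
    by (intro sum.cong) (auto simp: q_def transpose_def)
  have "p i < n"
    using p(1) i j permutes_in_image[OF p(1), of i] by simp
  hence "0 < (b (p i) - b (p j)) * (int j - int i)"
    using b[OF i(2)] i(1) by (intro mult_pos_pos) auto
  hence "b (p i) * int i + b (p j) * int j < b (q i) * int i + b (q j) * int j"
    by (simp add: q_def algebra_simps)
  hence "(\<Sum>l<n. b (p l) * int l) < (\<Sum>l<n. b (q l) * int l)"
    unfolding split[of "\<lambda>l. b (p l) * int l"] split[of "\<lambda>l. b (q l) * int l"] rest by linarith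
  with q show ?thesis using that by blast
qed

text \<open>A maximiser among the finitely many permutations must be the identity, since any other
  can be improved; as \<open>p\<close> can be improved, its value is strictly smaller.\<close>

lemma rearrangement_strict:
  fixes b :: "nat \<Rightarrow> int"
  assumes p: "p permutes {0..<n}" "p \<noteq> id"
    and b: "\<And>i j. i < j \<Longrightarrow> j < n \<Longrightarrow> b i < b j"
  shows "(\<Sum>i<n. b (p i) * int i) < (\<Sum>i<n. b i * int i)"
proof -
  define \<phi> where "\<phi> = (\<lambda>q. \<Sum>i<n. b (q i) * int i)"
  let ?P = "{q. q permutes {0..<n}}"
  have fin: "finite (\<phi> ` ?P)"
    by (simp add: finite_permutations)
  have "id \<in> ?P" by (simp add: permutes_id)
  have "Max (\<phi> ` ?P) \<in> \<phi> ` ?P"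
    using fin \<open>id \<in> ?P\<close> by (intro Max_in) blast+
  then obtain m where m: "m \<in> ?P" "\<phi> m = Max (\<phi> ` ?P)" by auto
  have max: "\<phi> q \<le> \<phi> m" if "q \<in> ?P" for q
    using fin that by (simp add: m(2))
  have "m = id"
  proof (rule ccontr)
    assume "m \<noteq> id"
    then obtain q where "q permutes {0..<n}" "\<phi> m < \<phi> q"
      using permutation_increase[of m n b] b m(1) unfolding \<phi>_def by blast
    thus False using max[of q] by simp
  qed
  obtain q where "q permutes {0..<n}" "\<phi> p < \<phi> q"
    using permutation_increase[of p n b] b p unfolding \<phi>_def by blast
  hence "\<phi> p < \<phi> id"
    using max[of q] \<open>m = id\<close> by simp
  thus ?thesis by (simp add: \<phi>_def)
qed

text \<open>After expanding the squares, only the mixed term depends on the permutation.\<close>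

lemma sum_squares_permuted:
  fixes b :: "nat \<Rightarrow> int"
  assumes p: "p permutes {0..<n}" "p \<noteq> id"
    and b: "\<And>i j. i < j \<Longrightarrow> j < n \<Longrightarrow> b i < b j"
  shows "(\<Sum>i<n. (b i - int i)\<^sup>2) < (\<Sum>i<n. (b (p i) - int i)\<^sup>2)"
proof -
  have "(\<Sum>i<n. (b (p i))\<^sup>2) = (\<Sum>i<n. (b i)\<^sup>2)"
    using sum.permute[OF p(1), of "\<lambda>i. (b i)\<^sup>2"] by (simp add: o_def atLeast0LessThan)
  moreover have "(\<Sum>i<n. (b (r i) - int i)\<^sup>2) = (\<Sum>i<n. (b (r i))\<^sup>2) + (\<Sum>i<n. (int i)\<^sup>2) - 2 * (\<Sum>i<n. b (r i) * int i)" for r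
    by (simp add: power2_diff sum.distrib sum_subtractf sum_distrib_left algebra_simps)
  from this[of p] this[of "\<lambda>i. i"] rearrangement_strict[OF assms]
  show ?thesis using calculation by simp
qed

section \<open>The determinants as sums of monomials over permutations\<close>

lemma prod_mon:
  assumes "finite V" "finite I" "\<And>i. i \<in> I \<Longrightarrow> g i \<in> V"
  shows "(\<Prod>i\<in>I. x (g i)) = mon V (\<lambda>v. card {i \<in> I. g i = v}) x"
proof -
  have "(\<Prod>i\<in>I. x (g i)) = (\<Prod>v\<in>V. \<Prod>i | i \<in> I \<and> g i = v. x (g i))"
    using assms by (intro prod.group[symmetric]) auto
  also have "\<dots> = (\<Prod>v\<in>V. \<Prod>i | i \<in> I \<and> g i = v. x v)"
    by (intro prod.cong) auto
  finally show ?thesis by (simp add: mon_def)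
qed

lemma wt_card:
  assumes "finite V" "finite I" "\<And>i. i \<in> I \<Longrightarrow> g i \<in> V"
  shows "wt V \<omega> (\<lambda>v. card {i \<in> I. g i = v}) = (\<Sum>i\<in>I. \<omega> (g i))"
proof -
  have "(\<Sum>i\<in>I. \<omega> (g i)) = (\<Sum>v\<in>V. \<Sum>i | i \<in> I \<and> g i = v. \<omega> (g i))"
    using assms by (intro sum.group[symmetric]) auto
  also have "\<dots> = (\<Sum>v\<in>V. \<Sum>i | i \<in> I \<and> g i = v. \<omega> v)"
    by (intro sum.cong) auto
  finally show ?thesis by (simp add: wt_def mult.commute)
qed

text \<open>The variable that row \<open>r\<close> contributes to the term of \<open>p\<close>. For
  \<open>r > a\<close> the truncated difference gives a meaningless order, but then the binomial
  coefficient in \<open>tcoef\<close> is 0.\<close>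

definition tvar :: "nat \<Rightarrow> (nat \<Rightarrow> nat list) \<Rightarrow> (nat \<Rightarrow> nat) \<Rightarrow> nat \<Rightarrow> nat \<times> nat" where
  "tvar N \<alpha> p r = (case column_list N \<alpha> ! p r of (j, a) \<Rightarrow> (j, a - r))"

definition tcoef :: "nat \<Rightarrow> (nat \<Rightarrow> nat list) \<Rightarrow> (nat \<Rightarrow> nat) \<Rightarrow> complex" where
  "tcoef N \<alpha> p = signof p * (\<Prod>r\<in>{0..<seq_s N \<alpha> 1}. of_nat (snd (column_list N \<alpha> ! p r) choose r))"

definition texp :: "nat \<Rightarrow> (nat \<Rightarrow> nat list) \<Rightarrow> (nat \<Rightarrow> nat) \<Rightarrow> nat \<times> nat \<Rightarrow> nat" where
  "texp N \<alpha> p v = card {r \<in> {0..<seq_s N \<alpha> 1}. tvar N \<alpha> p r = v}"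

text \<open>
  The weight of a monomial is the sum of the squares of shifted orders; for the term of a
  permutation \<open>p\<close> it is \<open>\<Sum>r. (b (p r) - r)\<^sup>2\<close> with \<open>b\<close> strictly increasing along the columns, so by
  the rearrangement inequality the diagonal term is the unique lightest one.
\<close>

definition sqw :: "nat \<Rightarrow> nat \<Rightarrow> nat \<times> nat \<Rightarrow> nat" where
  "sqw N d v = (snd v + (N - fst v) * d)\<^sup>2"

lemma column_entry_bounds:
  assumes \<alpha>: "\<alpha> \<in> tuples N 0 d" and c: "c < seq_s N \<alpha> 1"
  shows "fst (column_list N \<alpha> ! c) \<in> {1..N}" "snd (column_list N \<alpha> ! c) < d" "c \<le> snd (column_list N \<alpha> ! c)"
proof -
  obtain j i where ji: "j \<in> {1..N}" "i < length (\<alpha> j)" "c = seq_s N \<alpha> (j + 1) + i"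
      "column_list N \<alpha> ! c = (j, \<alpha> j ! i)"
    using column_list_index[OF c] by blast
  show "fst (column_list N \<alpha> ! c) \<in> {1..N}" "snd (column_list N \<alpha> ! c) < d" "c \<le> snd (column_list N \<alpha> ! c)"
    using ji entry_less[OF \<alpha> ji(1,2)] entry_ge[OF \<alpha> ji(1,2)] by simp_all
qed

lemma tvar_mem:
  assumes \<alpha>: "\<alpha> \<in> tuples N 0 d" and p: "p permutes {0..<seq_s N \<alpha> 1}" and r: "r \<in> {0..<seq_s N \<alpha> 1}"
  shows "tvar N \<alpha> p r \<in> jvars {1..N} d"
proof -
  have "p r < seq_s N \<alpha> 1"
    using permutes_in_image[OF p, of r] r by simp
  from column_entry_bounds[OF \<alpha> this] show ?thesis
    by (auto simp: tvar_def jvars_def case_prod_unfold)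
qed

lemma texp_exps:
  assumes "\<alpha> \<in> tuples N 0 d" "p permutes {0..<seq_s N \<alpha> 1}"
  shows "texp N \<alpha> p \<in> exps (jvars {1..N} d)"
  using tvar_mem[OF assms] by (force simp: exps_def texp_def)

lemma det_Delta0_expand:
  assumes \<alpha>: "\<alpha> \<in> tuples N 0 d"
  shows "det_Delta0 N \<alpha> (curry x) = (\<Sum>p | p permutes {0..<seq_s N \<alpha> 1}.
    tcoef N \<alpha> p * mon (jvars {1..N} d) (texp N \<alpha> p) x)"
proof -
  let ?s = "seq_s N \<alpha> 1"
  have "Delta0 N \<alpha> (curry x) \<in> carrier_mat ?s ?s"
    by (simp add: Delta0_def)
  hence "det_Delta0 N \<alpha> (curry x) = (\<Sum>p | p permutes {0..<?s}.
      signof p * (\<Prod>r = 0..<?s. Delta0 N \<alpha> (curry x) $$ (r, p r)))"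
    unfolding det_Delta0_def by (rule det_def')
  also have "\<dots> = (\<Sum>p | p permutes {0..<?s}. tcoef N \<alpha> p * mon (jvars {1..N} d) (texp N \<alpha> p) x)"
  proof (intro sum.cong refl)
    fix p assume "p \<in> {p. p permutes {0..<?s}}"
    hence p: "p permutes {0..<?s}" by simp
    have "(\<Prod>r = 0..<?s. Delta0 N \<alpha> (curry x) $$ (r, p r)) =
        (\<Prod>r = 0..<?s. of_nat (snd (column_list N \<alpha> ! p r) choose r) * x (tvar N \<alpha> p r))"
    proof (intro prod.cong refl)
      fix r assume "r \<in> {0..<?s}"
      moreover hence "p r < ?s"
        using permutes_in_image[OF p, of r] by simp
      ultimately show "Delta0 N \<alpha> (curry x) $$ (r, p r) =
          of_nat (snd (column_list N \<alpha> ! p r) choose r) * x (tvar N \<alpha> p r)"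
        by (simp add: Delta0_def column_entry_def tvar_def case_prod_unfold)
    qed
    also have "\<dots> = (\<Prod>r = 0..<?s. of_nat (snd (column_list N \<alpha> ! p r) choose r)) *
        mon (jvars {1..N} d) (texp N \<alpha> p) x"
      unfolding texp_def prod.distrib using prod_mon[of "jvars {1..N} d" "{0..<?s}" "tvar N \<alpha> p" x]
        tvar_mem[OF \<alpha> p] by simp
    finally show "signof p * (\<Prod>r = 0..<?s. Delta0 N \<alpha> (curry x) $$ (r, p r)) =
        tcoef N \<alpha> p * mon (jvars {1..N} d) (texp N \<alpha> p) x"
      by (simp add: tcoef_def)
  qed
  finally show ?thesis .
qed

lemma
  assumes \<alpha>: "\<alpha> \<in> tuples N 0 d"
  shows polyf_det_Delta0: "polyf (jvars {1..N} d) (\<lambda>x. det_Delta0 N \<alpha> (curry x))"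
    and cf_det_Delta0: "cf (jvars {1..N} d) (\<lambda>x. det_Delta0 N \<alpha> (curry x)) e =
      (\<Sum>p | p \<in> {p. p permutes {0..<seq_s N \<alpha> 1}} \<and> texp N \<alpha> p = e. tcoef N \<alpha> p)"
proof -
  have fin: "finite {p. p permutes {0..<seq_s N \<alpha> 1}}" "finite (jvars {1..N} d)"
    by (simp_all add: finite_permutations)
  have mem: "texp N \<alpha> p \<in> exps (jvars {1..N} d)" if "p \<in> {p. p permutes {0..<seq_s N \<alpha> 1}}" for p
    using texp_exps[OF \<alpha>] that by simp
  show "polyf (jvars {1..N} d) (\<lambda>x. det_Delta0 N \<alpha> (curry x))"
    unfolding det_Delta0_expand[OF \<alpha>] by (rule polyf_family[OF fin(2,1) mem])
  show "cf (jvars {1..N} d) (\<lambda>x. det_Delta0 N \<alpha> (curry x)) e =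
      (\<Sum>p | p \<in> {p. p permutes {0..<seq_s N \<alpha> 1}} \<and> texp N \<alpha> p = e. tcoef N \<alpha> p)"
    unfolding det_Delta0_expand[OF \<alpha>] by (rule cf_family[OF fin(2,1) mem])
qed

lemma weight_texp:
  assumes \<alpha>: "\<alpha> \<in> tuples N 0 d" and p: "p permutes {0..<seq_s N \<alpha> 1}" "tcoef N \<alpha> p \<noteq> 0" "p \<noteq> id"
  shows "wt (jvars {1..N} d) (sqw N d) (texp N \<alpha> id) < wt (jvars {1..N} d) (sqw N d) (texp N \<alpha> p)"
proof -
  let ?s = "seq_s N \<alpha> 1" and ?C = "column_list N \<alpha>"
  \<comment> \<open>As all entries are below \<open>d\<close>, the shift by \<open>d\<close> per
    block makes \<open>b\<close> increase from one block to the next as well.\<close>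
  define b where "b = (\<lambda>c. int (snd (?C ! c)) + int (N - fst (?C ! c)) * int d)"
  have b: "b i < b j" if "i < j" "j < ?s" for i j
  proof -
    have bd: "fst (?C ! i) \<in> {1..N}" "snd (?C ! i) < d"
      using column_entry_bounds[OF \<alpha>, of i] that by simp_all
    have "fst (?C ! j) < fst (?C ! i) \<or> fst (?C ! i) = fst (?C ! j) \<and> snd (?C ! i) < snd (?C ! j)"
      using column_list_sorted[OF \<alpha>] that by (simp add: sorted_wrt_iff_nth_less length_column_list)
    thus ?thesis
    proof
      assume lt: "fst (?C ! j) < fst (?C ! i)"
      hence "N - fst (?C ! i) + 1 \<le> N - fst (?C ! j)"
        using bd(1) by auto
      hence "int (N - fst (?C ! i) + 1) * int d \<le> int (N - fst (?C ! j)) * int d"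
        by (intro mult_right_mono) auto
      thus ?thesis
        using bd(2) by (simp add: b_def algebra_simps)
    qed (simp add: b_def)
  qed
  have weight: "int (wt (jvars {1..N} d) (sqw N d) (texp N \<alpha> q)) = (\<Sum>r<?s. (b (q r) - int r)\<^sup>2)"
    if q: "q permutes {0..<?s}" and ge: "\<And>r. r < ?s \<Longrightarrow> r \<le> snd (?C ! q r)" for q
  proof -
    have "wt (jvars {1..N} d) (sqw N d) (texp N \<alpha> q) = (\<Sum>r\<in>{0..<?s}. sqw N d (tvar N \<alpha> q r))"
      using wt_card[of "jvars {1..N} d" "{0..<?s}" "tvar N \<alpha> q" "sqw N d"] tvar_mem[OF \<alpha> q]
      unfolding texp_def[abs_def] by simp
    also have "int \<dots> = (\<Sum>r<?s. (b (q r) - int r)\<^sup>2)"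
      unfolding of_nat_sum atLeast0LessThan
    proof (intro sum.cong refl)
      fix r assume "r \<in> {..<?s}"
      thus "int (sqw N d (tvar N \<alpha> q r)) = (b (q r) - int r)\<^sup>2"
        using ge[of r] by (simp add: sqw_def tvar_def b_def case_prod_unfold of_nat_diff diff_add_eq)
    qed
    finally show ?thesis .
  qed
  \<comment> \<open>A nonzero coefficient excludes truncated subtraction, so the weight is a sum of
    squares of true differences.\<close>
  have "r \<le> snd (?C ! p r)" if "r < ?s" for r
  proof (rule ccontr)
    assume "\<not> r \<le> snd (?C ! p r)"
    hence "(of_nat (snd (?C ! p r) choose r) :: complex) = 0"
      by simp
    hence "tcoef N \<alpha> p = 0"
      unfolding tcoef_def using that by (auto intro!: prod_zero bexI[of _ r])
    thus False using p(2) by simp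
  qed
  hence "int (wt (jvars {1..N} d) (sqw N d) (texp N \<alpha> p)) = (\<Sum>r<?s. (b (p r) - int r)\<^sup>2)"
    by (rule weight[OF p(1)])
  moreover have "int (wt (jvars {1..N} d) (sqw N d) (texp N \<alpha> id)) = (\<Sum>r<?s. (b r - int r)\<^sup>2)"
    using weight[of id] column_entry_bounds(3)[OF \<alpha>] by (simp add: permutes_id)
  moreover have "(\<Sum>r<?s. (b r - int r)\<^sup>2) < (\<Sum>r<?s. (b (p r) - int r)\<^sup>2)"
    using p(1,3) b by (rule sum_squares_permuted)
  ultimately show ?thesis by linarith
qed

lemma texp_id_orders:
  assumes \<alpha>: "\<alpha> \<in> tuples N 0 d" and j: "j \<in> {1..N}"
  shows "texp N \<alpha> id (j, l) = count (mset (orders N \<alpha> j)) l"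
proof -
  have "{r \<in> {0..<seq_s N \<alpha> 1}. tvar N \<alpha> id r = (j, l)} =
      (\<lambda>i. seq_s N \<alpha> (j + 1) + i) ` {i. i < length (orders N \<alpha> j) \<and> orders N \<alpha> j ! i = l}"
  proof (intro equalityI subsetI)
    fix r assume r: "r \<in> {r \<in> {0..<seq_s N \<alpha> 1}. tvar N \<alpha> id r = (j, l)}"
    then obtain j' i where "j' \<in> {1..N}" "i < length (\<alpha> j')" "r = seq_s N \<alpha> (j' + 1) + i"
        "column_list N \<alpha> ! r = (j', \<alpha> j' ! i)"
      using column_list_index[of r N \<alpha>] by auto
    thus "r \<in> (\<lambda>i. seq_s N \<alpha> (j + 1) + i) ` {i. i < length (orders N \<alpha> j) \<and> orders N \<alpha> j ! i = l}"
      using r by (auto simp: tvar_def orders_def)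
  next
    fix r assume "r \<in> (\<lambda>i. seq_s N \<alpha> (j + 1) + i) ` {i. i < length (orders N \<alpha> j) \<and> orders N \<alpha> j ! i = l}"
    then obtain i where i: "i < length (\<alpha> j)" "orders N \<alpha> j ! i = l" "r = seq_s N \<alpha> (j + 1) + i"
      by (auto simp: orders_def)
    thus "r \<in> {r \<in> {0..<seq_s N \<alpha> 1}. tvar N \<alpha> id r = (j, l)}"
      using column_list_nth[of j N i \<alpha>] j by (auto simp: tvar_def orders_def)
  qed
  hence "texp N \<alpha> id (j, l) = card {i. i < length (orders N \<alpha> j) \<and> orders N \<alpha> j ! i = l}"
    unfolding texp_def by (simp add: card_image inj_on_def)
  thus ?thesis
    by (simp add: count_mset count_list_eq_length_filter length_filter_conv_card eq_commute)
qed

text \<open>The diagonal monomial records the multiset of orders in each block. The lists of orders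
  are sorted, so it determines them and hence the tuple.\<close>

lemma texp_id_inj:
  assumes \<alpha>: "\<alpha> \<in> tuples N 0 d" and \<beta>: "\<beta> \<in> tuples N 0 d" and eq: "texp N \<alpha> id = texp N \<beta> id"
  shows "\<alpha> = \<beta>"
proof (rule orders_inj[OF \<alpha> \<beta>])
  fix j assume j: "j \<in> {1..N}"
  have "count (mset (orders N \<alpha> j)) l = count (mset (orders N \<beta> j)) l" for l
    using texp_id_orders[OF \<alpha> j, of l] texp_id_orders[OF \<beta> j, of l] eq by simp
  hence "mset (orders N \<alpha> j) = mset (orders N \<beta> j)"
    by (intro multiset_eqI)
  thus "orders N \<alpha> j = orders N \<beta> j"
    using sorted_orders[OF \<alpha> j] sorted_orders[OF \<beta> j] by (metis properties_for_sort sorted_sort_id)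
qed

lemma cf_diagonal_nonzero:
  assumes \<alpha>: "\<alpha> \<in> tuples N 0 d"
  shows "cf (jvars {1..N} d) (\<lambda>x. det_Delta0 N \<alpha> (curry x)) (texp N \<alpha> id) \<noteq> 0"
proof -
  let ?P = "{p. p \<in> {p. p permutes {0..<seq_s N \<alpha> 1}} \<and> texp N \<alpha> p = texp N \<alpha> id}"
  have "(\<Sum>p\<in>?P. tcoef N \<alpha> p) = (\<Sum>p\<in>{id}. tcoef N \<alpha> p)"
  proof (intro sum.mono_neutral_right ballI)
    show "finite ?P" by (simp add: finite_permutations)
    show "{id} \<subseteq> ?P" by (simp add: permutes_id)
    fix p assume "p \<in> ?P - {id}"
    thus "tcoef N \<alpha> p = 0"
      using weight_texp[OF \<alpha>, of p] by auto
  qed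
  moreover have "tcoef N \<alpha> id \<noteq> 0"
    using column_entry_bounds(3)[OF \<alpha>] by (auto simp: tcoef_def) (meson leD)
  ultimately show ?thesis
    unfolding cf_det_Delta0[OF \<alpha>] by simp
qed

text \<open>A term of \<beta> with the diagonal monomial of \<alpha> is not the diagonal term of
  \<beta>; with a nonzero coefficient it would be strictly heavier than that term, against
  \<open>le\<close>.\<close>

lemma cf_diagonal_other:
  assumes \<alpha>: "\<alpha> \<in> tuples N 0 d" and \<beta>: "\<beta> \<in> tuples N 0 d" "\<alpha> \<noteq> \<beta>"
    and le: "wt (jvars {1..N} d) (sqw N d) (texp N \<alpha> id) \<le> wt (jvars {1..N} d) (sqw N d) (texp N \<beta> id)"
  shows "cf (jvars {1..N} d) (\<lambda>x. det_Delta0 N \<beta> (curry x)) (texp N \<alpha> id) = 0"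
  unfolding cf_det_Delta0[OF \<beta>(1)]
proof (intro sum.neutral ballI)
  fix p assume p: "p \<in> {p. p \<in> {p. p permutes {0..<seq_s N \<beta> 1}} \<and> texp N \<beta> p = texp N \<alpha> id}"
  hence "p \<noteq> id"
    using texp_id_inj[OF \<alpha> \<beta>(1)] \<beta>(2) by auto
  thus "tcoef N \<beta> p = 0"
    using weight_texp[OF \<beta>(1), of p] p le by auto
qed

text \<open>Among the tuples with nonzero coefficient choose one whose diagonal monomial is
  lightest; this monomial occurs in no other determinant of the relation.\<close>

lemma det_Delta0_independent:
  assumes zero: "\<And>\<xi>. (\<Sum>\<alpha>\<in>tuples N 0 d. c \<alpha> * det_Delta0 N \<alpha> \<xi>) = 0" and "\<alpha> \<in> tuples N 0 d"
  shows "c \<alpha> = 0"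
proof (rule ccontr)
  assume "c \<alpha> \<noteq> 0"
  let ?V = "jvars {1..N} d" and ?T = "tuples N 0 d"
  define Q where "Q = (\<lambda>\<alpha>. wt ?V (sqw N d) (texp N \<alpha> id))"
  obtain \<beta> where \<beta>: "\<beta> \<in> ?T" "c \<beta> \<noteq> 0" "\<And>\<gamma>. \<gamma> \<in> ?T \<Longrightarrow> c \<gamma> \<noteq> 0 \<Longrightarrow> Q \<beta> \<le> Q \<gamma>"
    using ex_has_least_nat[of "\<lambda>\<beta>. \<beta> \<in> ?T \<and> c \<beta> \<noteq> 0" \<alpha> Q] \<open>c \<alpha> \<noteq> 0\<close> assms(2) by auto
  have fin: "finite ?T" using card_tuples by blast
  have "(\<Sum>\<gamma>\<in>?T. c \<gamma> * cf ?V (\<lambda>x. det_Delta0 N \<gamma> (curry x)) (texp N \<beta> id)) =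
      cf ?V (\<lambda>x. \<Sum>\<gamma>\<in>?T. c \<gamma> * det_Delta0 N \<gamma> (curry x)) (texp N \<beta> id)"
    using cf_sum[of ?V ?T "\<lambda>\<gamma> x. det_Delta0 N \<gamma> (curry x)" c "texp N \<beta> id"]
      polyf_det_Delta0 by simp
  also have "\<dots> = 0"
    unfolding zero by (simp add: cf_zero)
  also have "(\<Sum>\<gamma>\<in>?T. c \<gamma> * cf ?V (\<lambda>x. det_Delta0 N \<gamma> (curry x)) (texp N \<beta> id)) =
      (\<Sum>\<gamma>\<in>{\<beta>}. c \<gamma> * cf ?V (\<lambda>x. det_Delta0 N \<gamma> (curry x)) (texp N \<beta> id))"
  proof (intro sum.mono_neutral_right ballI)
    fix \<gamma> assume \<gamma>: "\<gamma> \<in> ?T - {\<beta>}"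
    show "c \<gamma> * cf ?V (\<lambda>x. det_Delta0 N \<gamma> (curry x)) (texp N \<beta> id) = 0"
    proof (cases "c \<gamma> = 0")
      case False
      hence "cf ?V (\<lambda>x. det_Delta0 N \<gamma> (curry x)) (texp N \<beta> id) = 0"
        using \<beta>(3)[of \<gamma>] \<gamma> unfolding Q_def by (intro cf_diagonal_other[OF \<beta>(1)]) auto
      thus ?thesis by simp
    qed simp
  qed (use fin \<beta>(1) in auto)
  finally show False
    using cf_diagonal_nonzero[OF \<beta>(1)] \<beta>(2) by simp
qed

section \<open>The determinants are global sections\<close>

text \<open>
  The exponents of the order-zero variables are stored in the entries \<open>e j 0\<close> of the exponent
  functions, which \<open>jet_monomial\<close> and \<open>jet_weight\<close> ignore; this keeps the indices of the terms
  distinct.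
\<close>

lemma polyf_GG_sum_section:
  assumes "polyf (jvars (chart N i) k) (\<lambda>x. f (curry x))"
  shows "GG_sum_section N k i f"
proof -
  let ?I = "chart N i"
  let ?V = "jvars ?I k"
  let ?f = "\<lambda>x. f (curry x)"
  have V: "finite ?V" by simp
  define E where "E = curry ` supp ?V ?f"
  define c where "c = (\<lambda>e x. cf ?V ?f (case_prod e) * (\<Prod>j\<in>?I. x j ^ e j 0))"
  have E: "finite E"
    unfolding E_def using finite_supp[OF V assms] by simp
  have split: "mon ?V (case_prod e) (case_prod \<xi>) = (\<Prod>j\<in>?I. \<xi> j 0 ^ e j 0) * jet_monomial ?I k e \<xi>" for e \<xi>
  proof -
    have "mon ?V (case_prod e) (case_prod \<xi>) = (\<Prod>j\<in>?I. \<Prod>l=0..k. \<xi> j l ^ e j l)"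
      by (simp add: mon_def jvars_def prod.cartesian_product case_prod_unfold)
    also have "\<dots> = (\<Prod>j\<in>?I. \<xi> j 0 ^ e j 0 * (\<Prod>l=1..k. \<xi> j l ^ e j l))"
      by (simp add: prod.atLeast_Suc_atMost)
    finally show ?thesis
      by (simp add: jet_monomial_def prod.distrib)
  qed
  have f: "f \<xi> = (\<Sum>e\<in>E. c e (\<lambda>j. \<xi> j 0) * jet_monomial ?I k e \<xi>)" for \<xi>
  proof -
    have "f \<xi> = ?f (case_prod \<xi>)" by simp
    also have "\<dots> = (\<Sum>e\<in>supp ?V ?f. cf ?V ?f e * mon ?V e (case_prod \<xi>))"
      by (rule polyf_expand[OF V assms])
    also have "\<dots> = (\<Sum>e\<in>E. cf ?V ?f (case_prod e) * mon ?V (case_prod e) (case_prod \<xi>))"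
      unfolding E_def by (subst sum.reindex) (auto simp: inj_on_def fun_eq_iff)
    finally show ?thesis
      by (simp add: c_def split mult.assoc)
  qed
  have hol: "holomorphic_in ?I (c e)" for e
    unfolding holomorphic_in_def
  proof (intro conjI allI impI ballI)
    show "c e x = c e y" if "\<forall>j\<in>?I. x j = y j" for x y
      using that by (simp add: c_def)
    show "continuous_on UNIV (c e)"
      unfolding c_def
      by (intro continuous_intros continuous_on_product_coordinates)
    fix x j assume "j \<in> ?I"
    show "(\<lambda>z. c e (x(j := z))) holomorphic_on UNIV"
      unfolding c_def
    proof (intro holomorphic_intros)
      show "(\<lambda>z. (x(j := z)) j') holomorphic_on UNIV" for j'
        by (cases "j' = j") auto
    qed
  qed
  define g where "g = (\<lambda>n \<xi>. \<Sum>e | e \<in> E \<and> jet_weight ?I k e = n. c e (\<lambda>j. \<xi> j 0) * jet_monomial ?I k e \<xi>)"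
  have "GG_section N k n i (g n)" for n
    unfolding GG_section_def
    by (intro exI[of _ "{e \<in> E. jet_weight ?I k e = n}"] exI[of _ c]) (use E hol in \<open>auto simp: g_def\<close>)
  moreover obtain m where "\<And>e. e \<in> E \<Longrightarrow> jet_weight ?I k e \<le> m"
    using E by (metis finite_imageI finite_nat_set_iff_bounded_le image_eqI)
  hence "f = (\<lambda>\<xi>. \<Sum>n\<le>m. g n \<xi>)"
    unfolding f g_def using E by (intro ext sum.group[symmetric]) auto
  ultimately show ?thesis
    unfolding GG_sum_section_def by blast
qed

section \<open>The homogenised determinants\<close>

definition full_columns :: "nat \<Rightarrow> nat \<Rightarrow> (nat \<Rightarrow> nat list) \<Rightarrow> (nat \<times> nat) list" where
  "full_columns N d \<alpha> = column_list N \<alpha> @ map (Pair 0) [seq_s N \<alpha> 1..<d]"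

definition fmat :: "nat \<Rightarrow> nat \<Rightarrow> (nat \<Rightarrow> nat list) \<Rightarrow> (nat \<times> nat \<Rightarrow> complex) \<Rightarrow> complex Matrix.mat" where
  "fmat N d \<alpha> x = Matrix.mat d d (\<lambda>(r, c). case full_columns N d \<alpha> ! c of (j, a) \<Rightarrow>
     of_nat (a choose r) * x (j, a - r))"

text \<open>
  The homogenisation of \<open>det_Delta0 N \<alpha>\<close>: as \<open>X\<^sub>0 = 1\<close> has the unit vectors as columns, appending
  columns of \<open>X\<^sub>0\<close> does not change the determinant over \<open>U\<^sub>0\<close>.
\<close>

definition hdet :: "nat \<Rightarrow> nat \<Rightarrow> (nat \<Rightarrow> nat list) \<Rightarrow> (nat \<times> nat \<Rightarrow> complex) \<Rightarrow> complex" where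
  "hdet N d \<alpha> x = Determinant.det (fmat N d \<alpha> x)"

lemma fmat_carrier [simp]: "fmat N d \<alpha> x \<in> carrier_mat d d"
  by (simp add: fmat_def)

lemma full_columns_nth:
  assumes \<alpha>: "\<alpha> \<in> tuples N 0 d" and c: "c < d"
  shows "fst (full_columns N d \<alpha> ! c) \<le> N" "snd (full_columns N d \<alpha> ! c) < d"
proof -
  have "fst (full_columns N d \<alpha> ! c) \<le> N \<and> snd (full_columns N d \<alpha> ! c) < d"
  proof (cases "c < seq_s N \<alpha> 1")
    case True
    thus ?thesis
      using column_entry_bounds[OF \<alpha> True] by (simp add: full_columns_def nth_append length_column_list)
  next
    case False
    thus ?thesis
      using c by (simp add: full_columns_def nth_append length_column_list)
  qed
  thus "fst (full_columns N d \<alpha> ! c) \<le> N" "snd (full_columns N d \<alpha> ! c) < d" by auto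
qed

text \<open>All entries are below \<open>d\<close>, so derivatives of order at most
  \<open>d - 1\<close> suffice; this is the origin of the condition
  \<open>k \<ge> d - 1\<close>.\<close>

lemma polyf_hdet:
  assumes \<alpha>: "\<alpha> \<in> tuples N 0 d" and "finite W"
    and g: "\<And>v. v \<in> jvars {0..N} (d - 1) \<Longrightarrow> polyf W (\<lambda>y. g y v)"
  shows "polyf W (\<lambda>y. hdet N d \<alpha> (g y))"
proof -
  have "polyf W (\<lambda>y. \<Sum>p | p permutes {0..<d}. signof p * (\<Prod>r = 0..<d. fmat N d \<alpha> (g y) $$ (r, p r)))"
  proof (intro polyf_sum polyf_mult polyf_prod polyf_const \<open>finite W\<close>)
    fix p r assume p: "p \<in> {p. p permutes {0..<d}}" and r: "r \<in> {0..<d}"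
    hence pr: "p r < d"
      using permutes_in_image[of p "{0..<d}" r] by simp
    have "polyf W (\<lambda>y. of_nat (snd (full_columns N d \<alpha> ! p r) choose r) *
        g y (fst (full_columns N d \<alpha> ! p r), snd (full_columns N d \<alpha> ! p r) - r))"
      using full_columns_nth[OF \<alpha> pr] by (intro polyf_mult polyf_const g \<open>finite W\<close>) (auto simp: jvars_def)
    thus "polyf W (\<lambda>y. fmat N d \<alpha> (g y) $$ (r, p r))"
      using pr r by (simp add: fmat_def case_prod_unfold)
  qed
  thus ?thesis
    unfolding hdet_def by (simp add: det_def'[OF fmat_carrier])
qed

lemma binomial_fact_fact:
  "r \<le> a \<Longrightarrow> of_nat (a choose r) * fact (a - r) = (fact a / fact r :: complex)"
  by (simp add: binomial_fact)

text \<open>By the Leibniz rule one matrix \<open>U\<close> takes every column to that of the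
  multiplied coordinate: its entry in row \<open>r\<close> and column \<open>t\<close> is
  \<open>t choose r\<close> times the derivative of order \<open>t - r\<close> of
  \<open>lam\<close>. Its diagonal is the constant term of \<open>lam\<close>.\<close>

lemma hdet_mult:
  assumes \<alpha>: "\<alpha> \<in> tuples N 0 d"
  shows "hdet N d \<alpha> (pt (\<lambda>m. lam * A m)) = fps_nth lam 0 ^ d * hdet N d \<alpha> (pt A)"
proof -
  define U where "U = Matrix.mat d d (\<lambda>(r, t). if r \<le> t then fact t / fact r * fps_nth lam (t - r) else 0)"
  have U: "U \<in> carrier_mat d d" by (simp add: U_def)
  have entry: "fmat N d \<alpha> (pt B) $$ (r, c) =
      (if r \<le> snd (full_columns N d \<alpha> ! c) then
        fact (snd (full_columns N d \<alpha> ! c)) / fact r * fps_nth (B (fst (full_columns N d \<alpha> ! c))) (snd (full_columns N d \<alpha> ! c) - r)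
       else 0)" if "r < d" "c < d" for B r c
    using that binomial_fact_fact[of r "snd (full_columns N d \<alpha> ! c)"]
    by (simp add: fmat_def case_prod_unfold mult.assoc[symmetric])
  have "fmat N d \<alpha> (pt (\<lambda>m. lam * A m)) = U * fmat N d \<alpha> (pt A)"
  proof (rule eq_matI)
    fix r c assume "r < dim_row (U * fmat N d \<alpha> (pt A))" "c < dim_col (U * fmat N d \<alpha> (pt A))"
    hence rc: "r < d" "c < d" by (simp_all add: U_def fmat_def)
    define j where "j = fst (full_columns N d \<alpha> ! c)"
    define a where "a = snd (full_columns N d \<alpha> ! c)"
    have a: "a < d" unfolding a_def by (rule full_columns_nth(2)[OF \<alpha> rc(2)])
    note ent = entry[OF _ rc(2), folded j_def a_def]
    have "(U * fmat N d \<alpha> (pt A)) $$ (r, c) = (\<Sum>t = 0..<d. U $$ (r, t) * fmat N d \<alpha> (pt A) $$ (t, c))"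
      using rc carrier_matD[OF U] carrier_matD[OF fmat_carrier[of N d \<alpha> "pt A"]]
      by (simp add: scalar_prod_def)
    also have "\<dots> = (\<Sum>t = 0..<d. if r \<le> t \<and> t \<le> a then
        fact a / fact r * (fps_nth lam (t - r) * fps_nth (A j) (a - t)) else 0)"
      by (intro sum.cong refl) (auto simp: ent U_def rc)
    \<comment> \<open>Since \<open>a < d\<close>, no term of the Cauchy product is cut off by the
      size of the matrix.\<close>
    also have "\<dots> = (\<Sum>t\<in>{r..a}. fact a / fact r * (fps_nth lam (t - r) * fps_nth (A j) (a - t)))"
      using a by (intro sum.mono_neutral_cong_right) auto
    also have "\<dots> = (if r \<le> a then fact a / fact r * fps_nth (lam * A j) (a - r) else 0)"
    proof (cases "r \<le> a")
      case True
      have "(\<Sum>t\<in>{r..a}. fps_nth lam (t - r) * fps_nth (A j) (a - t)) =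
          (\<Sum>t\<in>{0..a - r}. fps_nth lam t * fps_nth (A j) (a - r - t))"
        using True by (intro sum.reindex_bij_witness[of _ "\<lambda>t. t + r" "\<lambda>t. t - r"]) auto
      thus ?thesis
        using True by (simp only: fps_mult_nth sum_distrib_left[symmetric] if_True)
    qed simp
    also have "\<dots> = fmat N d \<alpha> (pt (\<lambda>m. lam * A m)) $$ (r, c)"
      by (simp add: ent rc)
    finally show "fmat N d \<alpha> (pt (\<lambda>m. lam * A m)) $$ (r, c) = (U * fmat N d \<alpha> (pt A)) $$ (r, c)"
      by simp
  qed (simp_all add: U_def fmat_def)
  moreover have "Determinant.det U = fps_nth lam 0 ^ d"
  proof -
    have "upper_triangular U"
      by (simp add: upper_triangular_def U_def)
    from det_upper_triangular[OF this U] show ?thesis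
      unfolding prod_list_diag_prod by (simp add: U_def)
  qed
  ultimately show ?thesis
    unfolding hdet_def by (simp add: det_mult[OF U fmat_carrier])
qed

lemma hdet_cong:
  assumes \<alpha>: "\<alpha> \<in> tuples N 0 d" and "\<And>m l. m \<le> N \<Longrightarrow> x (m, l) = y (m, l)"
  shows "hdet N d \<alpha> x = hdet N d \<alpha> y"
proof -
  have "fmat N d \<alpha> x = fmat N d \<alpha> y"
    unfolding fmat_def using full_columns_nth(1)[OF \<alpha>] assms(2)
    by (intro cong_mat) (auto simp: case_prod_unfold)
  thus ?thesis by (simp add: hdet_def)
qed

lemma hdet_hom_coord_0:
  assumes \<alpha>: "\<alpha> \<in> tuples N 0 d"
  shows "hdet N d \<alpha> (pt (hom_coord 0 \<xi>)) = det_Delta0 N \<alpha> \<xi>"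
proof -
  let ?s = "seq_s N \<alpha> 1"
  let ?M = "fmat N d \<alpha> (pt (hom_coord 0 \<xi>))"
  have s: "?s \<le> d" using seq_s_le[OF \<alpha>] by simp
  define C where "C = Matrix.mat (d - ?s) ?s (\<lambda>(r, c). ?M $$ (r + ?s, c))"
  \<comment> \<open>In chart 0 the padding columns are unit vectors, which makes the matrix block
    lower triangular with an identity block at the end.\<close>
  have "?M = four_block_mat (Delta0 N \<alpha> \<xi>) (0\<^sub>m ?s (d - ?s)) C (1\<^sub>m (d - ?s))" (is "_ = ?F")
  proof (rule eq_matI)
    fix r c assume "r < dim_row ?F" "c < dim_col ?F"
    hence rc: "r < d" "c < d"
      using s by (simp_all add: Delta0_def)
    show "?M $$ (r, c) = ?F $$ (r, c)"
    proof (cases "c < ?s")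
      case True
      have "fst (column_list N \<alpha> ! c) \<noteq> 0"
        using column_entry_bounds(1)[OF \<alpha> True] by auto
      hence "?M $$ (r, c) = column_entry (snd (column_list N \<alpha> ! c)) (fst (column_list N \<alpha> ! c)) r \<xi>"
        using rc True by (simp add: fmat_def full_columns_def nth_append length_column_list
            case_prod_unfold column_entry_def hom_coord_def)
      thus ?thesis
        using True rc s by (auto simp: Delta0_def C_def case_prod_unfold)
    next
      case False
      have "?M $$ (r, c) = of_nat (c choose r) * (fact (c - r) * fps_nth 1 (c - r))"
        using rc False by (simp add: fmat_def full_columns_def nth_append length_column_list hom_coord_def)
      also have "\<dots> = (if r = c then 1 else 0)"
        by (cases "r < c") (auto simp: binomial_eq_0)
      finally show ?thesis
        using False rc s by (auto simp: Delta0_def)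
    qed
  qed (use s in \<open>simp_all add: fmat_def Delta0_def\<close>)
  moreover have "Determinant.det ?F = Determinant.det (Delta0 N \<alpha> \<xi>) * Determinant.det (1\<^sub>m (d - ?s) :: complex Matrix.mat)"
  proof (rule det_four_block_mat_upper_right_zero[OF _ refl])
    show "Delta0 N \<alpha> \<xi> \<in> carrier_mat ?s ?s"
      by (simp add: Delta0_def)
    show "C \<in> carrier_mat (d - ?s) ?s"
      unfolding C_def by (rule mat_carrier)
    show "1\<^sub>m (d - ?s) \<in> carrier_mat (d - ?s) (d - ?s)"
      by (rule one_carrier_mat)
  qed
  ultimately show ?thesis
    by (simp add: hdet_def det_Delta0_def)
qed

text \<open>Passing from chart \<open>i\<close> to chart \<open>j\<close> divides all coordinates by
  the series \<open>B\<close> of \<open>X\<^sub>j\<close>, and \<open>hdet_mult\<close> extracts its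
  constant term to the power \<open>d\<close>.\<close>

lemma hdet_global_section:
  assumes \<alpha>: "\<alpha> \<in> tuples N 0 d" and "k \<ge> d - 1"
  shows "global_section N k d (\<lambda>i \<xi>. hdet N d \<alpha> (pt (hom_coord i \<xi>)))"
  unfolding global_section_def
proof (intro conjI allI impI)
  fix i assume "i \<le> N"
  have "polyf (jvars (chart N i) k) (\<lambda>x. hdet N d \<alpha> (pt (hom_coord i (curry x))))"
  proof (rule polyf_hdet[OF \<alpha>])
    fix v assume v: "v \<in> jvars {0..N} (d - 1)"
    obtain m l where ml: "v = (m, l)" by (cases v)
    show "polyf (jvars (chart N i) k) (\<lambda>x. pt (hom_coord i (curry x)) v)"
    proof (cases "m = i")
      case True
      thus ?thesis by (simp add: ml hom_coord_def polyf_const)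
    next
      case False
      hence "polyf (jvars (chart N i) k) (\<lambda>x. x (m, l))"
        using v assms(2) by (intro polyf_var) (auto simp: ml jvars_def chart_def)
      thus ?thesis
        using False by (simp add: ml hom_coord_def)
    qed
  qed simp
  thus "GG_sum_section N k i (\<lambda>\<xi>. hdet N d \<alpha> (pt (hom_coord i \<xi>)))"
    by (rule polyf_GG_sum_section)
next
  fix i j and \<xi> :: jet
  assume ij: "i \<le> N" "j \<le> N" "i \<noteq> j" and nz: "\<xi> j 0 \<noteq> 0"
  define B where "B = hom_coord i \<xi> j"
  have B0: "fps_nth B 0 = \<xi> j 0"
    using ij by (simp add: B_def hom_coord_def)
  have "hom_coord i \<xi> m = B * (hom_coord i \<xi> m * inverse B)" for m
    using inverse_mult_eq_1[of B] nz B0 by (simp add: mult_ac)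
  hence "hdet N d \<alpha> (pt (hom_coord i \<xi>)) = hdet N d \<alpha> (pt (\<lambda>m. B * (hom_coord i \<xi> m * inverse B)))"
    by presburger
  also have "\<dots> = \<xi> j 0 ^ d * hdet N d \<alpha> (pt (\<lambda>m. hom_coord i \<xi> m * inverse B))"
    by (simp add: hdet_mult[OF \<alpha>] B0)
  also have "hdet N d \<alpha> (pt (\<lambda>m. hom_coord i \<xi> m * inverse B)) = hdet N d \<alpha> (pt (hom_coord j (jet_change N i j \<xi>)))"
  proof (rule hdet_cong[OF \<alpha>])
    fix m l assume "m \<le> N"
    show "pt (\<lambda>m. hom_coord i \<xi> m * inverse B) (m, l) = pt (hom_coord j (jet_change N i j \<xi>)) (m, l)"
    proof (cases "m = j")
      case True
      thus ?thesis
        using inverse_mult_eq_1'[of B] nz B0 by (simp add: hom_coord_def B_def)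
    next
      case False
      thus ?thesis
        using jet_change_eq[OF ij(2,3) \<open>m \<le> N\<close> False, of \<xi> l] nz by (simp add: hom_coord_def[of j] B_def)
    qed
  qed
  finally show "hdet N d \<alpha> (pt (hom_coord i \<xi>)) = \<xi> j 0 ^ d * hdet N d \<alpha> (pt (hom_coord j (jet_change N i j \<xi>)))" .
qed

section \<open>The sections form a subspace containing the determinants\<close>

lemma GG_H0I: "global_section N k d s \<Longrightarrow> f = s 0 \<Longrightarrow> f \<in> GG_H0 N k d"
  by (auto simp: GG_H0_def)

lemma det_Delta0_in_GG_H0:
  assumes "\<alpha> \<in> tuples N 0 d" "k \<ge> d - 1"
  shows "det_Delta0 N \<alpha> \<in> GG_H0 N k d"
  using hdet_hom_coord_0[OF assms(1)] by (intro GG_H0I[OF hdet_global_section[OF assms]] ext) simp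

lemma global_section_linear:
  assumes s: "global_section N k d s" and t: "global_section N k d t"
  shows "global_section N k d (\<lambda>i \<xi>. a * s i \<xi> + b * t i \<xi>)"
  unfolding global_section_def
proof (intro conjI allI impI)
  fix i assume "i \<le> N"
  thus "GG_sum_section N k i (\<lambda>\<xi>. a * s i \<xi> + b * t i \<xi>)"
    using global_section_polyf[OF s] global_section_polyf[OF t]
    by (intro polyf_GG_sum_section polyf_linear) auto
next
  fix i j and \<xi> :: jet assume "i \<le> N" "j \<le> N" "i \<noteq> j" "\<xi> j 0 \<noteq> 0"
  hence "s i \<xi> = \<xi> j 0 ^ d * s j (jet_change N i j \<xi>)" "t i \<xi> = \<xi> j 0 ^ d * t j (jet_change N i j \<xi>)"
    using s t unfolding global_section_def by blast+
  thus "a * s i \<xi> + b * t i \<xi> = \<xi> j 0 ^ d * (a * s j (jet_change N i j \<xi>) + b * t j (jet_change N i j \<xi>))"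
    by (simp add: algebra_simps)
qed

lemma subspace_GG_H0: "jetfun.subspace (GG_H0 N k d)"
proof (rule jetfun.subspaceI)
  have "GG_sum_section N k i (\<lambda>_. 0)" for i
    by (rule polyf_GG_sum_section) (simp add: polyf_const)
  hence "global_section N k d (\<lambda>_ _. 0)"
    by (simp add: global_section_def)
  thus "0 \<in> GG_H0 N k d"
    by (rule GG_H0I) (simp add: zero_fun_def)
next
  fix f g assume "f \<in> GG_H0 N k d" "g \<in> GG_H0 N k d"
  then obtain s t where st: "global_section N k d s" "global_section N k d t" "f = s 0" "g = t 0"
    unfolding GG_H0_def by blast
  show "f + g \<in> GG_H0 N k d"
    by (rule GG_H0I[OF global_section_linear[OF st(1,2), of 1 1]]) (simp add: st(3,4) fun_eq_iff)
next
  fix a f assume "f \<in> GG_H0 N k d"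
  then obtain s where s: "global_section N k d s" "f = s 0"
    unfolding GG_H0_def by blast
  show "jscale a f \<in> GG_H0 N k d"
    by (rule GG_H0I[OF global_section_linear[OF s(1,1), of a 0]]) (simp add: s(2) fun_eq_iff jscale_def)
qed

section \<open>Spanning\<close>

definition homog :: "nat \<Rightarrow> nat \<Rightarrow> nat \<Rightarrow> ((nat \<times> nat \<Rightarrow> complex) \<Rightarrow> complex) \<Rightarrow> bool" where
  "homog N k d F \<longleftrightarrow> polyf (jvars {0..N} k) F \<and> invariant N F \<and>
     (\<forall>c x. F (\<lambda>v. c * x v) = c ^ d * F x)"

text \<open>The degrees of the homogenised determinant of \<alpha> in the coordinates, with
  \<open>X\<^sub>0\<close> taking what is left up to \<open>d\<close>.\<close>

definition ctype :: "nat \<Rightarrow> nat \<Rightarrow> (nat \<Rightarrow> nat list) \<Rightarrow> nat \<Rightarrow> nat" where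
  "ctype N d \<alpha> j = (if j = 0 then d - seq_s N \<alpha> 1 else length (\<alpha> j))"

definition cexp :: "nat \<Rightarrow> nat \<Rightarrow> (nat \<Rightarrow> nat list) \<Rightarrow> nat \<times> nat \<Rightarrow> nat" where
  "cexp N d \<alpha> v = (if v \<in> rvars N (ctype N d \<alpha>) then orders N \<alpha> (fst v) ! snd v else 0)"

definition tpart :: "nat \<Rightarrow> nat \<Rightarrow> (nat \<Rightarrow> nat) \<Rightarrow> ((nat \<times> nat \<Rightarrow> complex) \<Rightarrow> complex) \<Rightarrow> (nat \<times> nat \<Rightarrow> complex) \<Rightarrow> complex" where
  "tpart N k n = part (jvars {0..N} k) (\<lambda>e. \<forall>j<Suc N. wt (jvars {0..N} k) (bw j) e = n j)"

text \<open>One coefficient for each index tuple, which fixes a multidegree through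
  \<open>ctype\<close> and a monomial in the \<open>w\<close> through \<open>orders\<close>. So
  there are as many functionals as determinants.\<close>

definition functional :: "nat \<Rightarrow> nat \<Rightarrow> nat \<Rightarrow> (nat \<Rightarrow> nat list) \<Rightarrow> ((nat \<times> nat \<Rightarrow> complex) \<Rightarrow> complex) \<Rightarrow> complex" where
  "functional N k d \<alpha> F =
     cf (rvars N (ctype N d \<alpha>)) (rec_eval (ctype N d \<alpha>) (tpart N k (ctype N d \<alpha>) F)) (cexp N d \<alpha>)"

lemma part_linear:
  assumes "finite V" "polyf V F" "polyf V G"
  shows "part V P (\<lambda>x. r * F x + s * G x) = (\<lambda>x. r * part V P F x + s * part V P G x)"
  by (rule polyf_ext_cf[OF assms(1)])
    (use assms in \<open>auto intro!: polyf_part polyf_linear simp: cf_part polyf_linear cf_linear polyf_part\<close>)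

lemma functional_linear:
  assumes "polyf (jvars {0..N} k) F" "polyf (jvars {0..N} k) G"
  shows "functional N k d \<alpha> (\<lambda>x. r * F x + s * G x) = r * functional N k d \<alpha> F + s * functional N k d \<alpha> G"
proof -
  have "tpart N k n (\<lambda>x. r * F x + s * G x) = (\<lambda>x. r * tpart N k n F x + s * tpart N k n G x)" for n
    unfolding tpart_def by (rule part_linear) (use assms in auto)
  moreover have "polyf (jvars {0..N} k) (tpart N k n F)" "polyf (jvars {0..N} k) (tpart N k n G)" for n
    unfolding tpart_def using assms by (auto intro!: polyf_part)
  moreover have "rec_eval n (\<lambda>x. r * F x + s * G x) = (\<lambda>w. r * rec_eval n F w + s * rec_eval n G w)" for n F G
    by (simp add: rec_eval_def fun_eq_iff)
  ultimately show ?thesis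
    unfolding functional_def by (simp add: cf_linear polyf_rec_eval[where k = k])
qed

lemma homog_linear:
  assumes "homog N k d F" "homog N k d G"
  shows "homog N k d (\<lambda>x. r * F x + s * G x)"
  using assms unfolding homog_def invariant_def
  by (auto intro!: polyf_linear simp: algebra_simps)

lemma homog_sum:
  assumes "finite I" "\<And>i. i \<in> I \<Longrightarrow> homog N k d (F i)"
  shows "homog N k d (\<lambda>x. \<Sum>i\<in>I. c i * F i x) \<and>
    functional N k d \<alpha> (\<lambda>x. \<Sum>i\<in>I. c i * F i x) = (\<Sum>i\<in>I. c i * functional N k d \<alpha> (F i))"
  using assms
proof (induction I rule: finite_induct)
  case empty
  have z: "polyf (jvars {0..N} k) (\<lambda>x. 0)" by (simp add: polyf_const)
  have "functional N k d \<alpha> (\<lambda>x. 0 * 0 + 0 * 0) = 0"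
    unfolding functional_linear[OF z z] by simp
  thus ?case
    using z by (simp add: homog_def invariant_def)
next
  case (insert i I)
  let ?G = "\<lambda>x. \<Sum>i\<in>I. c i * F i x"
  have F: "homog N k d (F i)" and G: "homog N k d ?G"
    using insert by auto
  have "homog N k d (\<lambda>x. c i * F i x + 1 * ?G x)"
    by (rule homog_linear[OF F G])
  moreover have "functional N k d \<alpha> (\<lambda>x. c i * F i x + 1 * ?G x) =
      c i * functional N k d \<alpha> (F i) + 1 * functional N k d \<alpha> ?G"
    using F G unfolding homog_def by (intro functional_linear) auto
  ultimately show ?case
    using insert by simp
qed

lemma invariant_tpart:
  assumes F: "polyf (jvars {0..N} k) F" "invariant J F"
  shows "invariant J (tpart N k n F)"
proof -
  let ?V = "jvars {0..N} k"
  have V: "finite ?V" by simp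
  have "invariant J (part ?V (\<lambda>e. \<forall>j<m. wt ?V (bw j) e = n j) F)" for m
  proof (induction m)
    case 0
    have "part ?V (\<lambda>e. \<forall>j<0. wt ?V (bw j) e = n j) F = F"
      by (rule polyf_ext_cf[OF V]) (use F in \<open>simp_all add: polyf_part cf_part\<close>)
    thus ?case using F(2) by simp
  next
    case (Suc m)
    let ?P = "\<lambda>m e. \<forall>j<m. wt ?V (bw j) e = n j"
    have "part ?V (?P (Suc m)) F = part ?V (\<lambda>e. wt ?V (bw m) e = n m) (part ?V (?P m) F)"
      by (rule polyf_ext_cf[OF V]) (use F in \<open>auto simp: polyf_part cf_part less_Suc_eq\<close>)
    thus ?case
      using invariant_part_block[OF V polyf_part[OF V F(1)] Suc.IH] by simp
  qed
  thus ?thesis by (simp add: tpart_def)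
qed

lemma total_degree_blocks:
  "(\<Sum>j\<le>N. wt (jvars {0..N} k) (bw j) e) = (\<Sum>v\<in>jvars {0..N} k. e v)"
proof -
  have "(\<Sum>j\<le>N. wt (jvars {0..N} k) (bw j) e) = (\<Sum>v\<in>jvars {0..N} k. (\<Sum>j\<le>N. bw j v) * e v)"
    unfolding wt_def by (subst sum.swap) (simp add: sum_distrib_right)
  also have "\<dots> = (\<Sum>v\<in>jvars {0..N} k. e v)"
    by (intro sum.cong refl) (auto simp: jvars_def bw_def)
  finally show ?thesis .
qed

lemma rec_eval_permute:
  assumes "\<And>j. j \<in> {1..N} \<Longrightarrow> p j permutes {..<n j}" "\<And>j. N < j \<Longrightarrow> n j = 0"
  shows "rec_eval n F (w \<circ> (\<lambda>v. if v \<in> rvars N n then (fst v, p (fst v) (snd v)) else v)) = rec_eval n F w"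
proof -
  have "hser n j (w \<circ> (\<lambda>v. if v \<in> rvars N n then (fst v, p (fst v) (snd v)) else v)) = hser n j w"
    if "j \<noteq> 0" for j
  proof (cases "j \<le> N")
    case True
    hence j: "j \<in> {1..N}" using that by simp
    have "(\<Prod>i<n j. geo (w (j, i))) = (\<Prod>i<n j. geo (w (j, p j i)))"
      using prod.permute[OF assms(1)[OF j], of "\<lambda>i. geo (w (j, i))"] by (simp add: o_def)
    thus ?thesis
      using j by (simp add: hser_def rvars_def)
  qed (simp add: hser_def assms(2))
  thus ?thesis
    unfolding rec_eval_def by (auto intro!: arg_cong[of _ _ F] arg_cong[of _ _ pt])
qed

text \<open>If \<open>F\<close> were nonzero, some part of fixed multidegree would have a nonzero
  coefficient within the bounds of \<open>invariant_good_coefficient\<close>. By symmetry its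
  exponents may be sorted within each block, and the sorted lists are the orders of an index
  tuple.\<close>

lemma functionals_separate:
  assumes F: "homog N k d F" and zero: "\<And>\<alpha>. \<alpha> \<in> tuples N 0 d \<Longrightarrow> functional N k d \<alpha> F = 0"
  shows "F x = 0"
proof -
  let ?V = "jvars {0..N} k"
  have V: "finite ?V" by simp
  have pF: "polyf ?V F" and iF: "invariant N F" and hF: "\<And>c x. F (\<lambda>v. c * x v) = c ^ d * F x"
    using F by (auto simp: homog_def)
  have "supp ?V F = {}"
  proof (rule ccontr)
    assume "supp ?V F \<noteq> {}"
    then obtain e where e: "e \<in> supp ?V F" by blast
    \<comment> \<open>The value 0 beyond \<open>N\<close> makes \<open>n\<close> coincide with
      \<open>ctype\<close> as a function.\<close>
    define n where "n = (\<lambda>j. if j \<le> N then wt ?V (bw j) e else 0)"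
    have sum_n: "(\<Sum>j\<le>N. n j) = d"
      using homogeneous_total_degree[OF V pF hF e] total_degree_blocks[of N k e] by (simp add: n_def)
    define G where "G = tpart N k n F"
    have G: "polyf ?V G"
      unfolding G_def tpart_def by (rule polyf_part[OF V pF])
    have suppG: "supp ?V G = {e \<in> supp ?V F. \<forall>j<Suc N. wt ?V (bw j) e = n j}"
      unfolding G_def tpart_def by (rule supp_part[OF V pF])
    have "e \<in> supp ?V G"
      using e by (simp add: suppG n_def)
    hence ne: "supp ?V G \<noteq> {}" by blast
    have degG: "wt ?V (bw j) e' = n j" if "e' \<in> supp ?V G" "j \<le> N" for e' j
      using that by (simp add: suppG)
    obtain \<epsilon> where \<epsilon>: "\<epsilon> \<in> supp (rvars N n) (rec_eval n G)"
      "\<And>j i. 1 \<le> j \<Longrightarrow> j \<le> N \<Longrightarrow> i < n j \<Longrightarrow> \<epsilon> (j, i) \<le> (\<Sum>l<j. n l)"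
      using invariant_good_coefficient[OF G _ order_refl degG ne] invariant_tpart[OF pF iF] unfolding G_def by blast
    define l where "l = (\<lambda>j. map (\<lambda>i. \<epsilon> (j, i)) [0..<n j])"
    have "sorted (sort (l j)) \<and> (\<forall>a\<in>set (sort (l j)). a + (\<Sum>m=j..N. length (sort (l m))) \<le> d)"
      if j: "j \<in> {1..N}" for j
    proof (intro conjI ballI)
      fix a assume "a \<in> set (sort (l j))"
      hence "a \<le> (\<Sum>m<j. n m)"
        using \<epsilon>(2)[of j] j by (auto simp: l_def)
      \<comment> \<open>Since the degrees add up to \<open>d\<close>, the bound on \<open>a\<close>
        is \<open>d\<close> minus the lengths of the blocks \<open>j, ..., N\<close>.\<close>
      moreover have "{..N} = {..<j} \<union> {j..N}" using j by auto
      hence "(\<Sum>m\<le>N. n m) = (\<Sum>m<j. n m) + (\<Sum>m=j..N. n m)"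
        by (simp add: sum.union_disjoint[symmetric] ivl_disj_int)
      ultimately show "a + (\<Sum>m=j..N. length (sort (l m))) \<le> d"
        using sum_n by (simp add: l_def)
    qed simp
    then obtain \<alpha> where \<alpha>: "\<alpha> \<in> tuples N 0 d" "\<And>j. j \<in> {1..N} \<Longrightarrow> orders N \<alpha> j = sort (l j)"
      using orders_surj[of N "\<lambda>j. sort (l j)" d] by blast
    have len: "length (\<alpha> j) = n j" if "j \<in> {1..N}" for j
      using arg_cong[OF \<alpha>(2)[OF that], of length] by (simp add: orders_def l_def)
    have "ctype N d \<alpha> j = n j" for j
    proof -
      have "seq_s N \<alpha> 1 = (\<Sum>m=1..N. n m)"
        unfolding seq_s_def using len by (intro sum.cong) auto
      moreover have "{..N} = insert 0 {1..N}" by auto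
      ultimately have "d = n 0 + seq_s N \<alpha> 1"
        using sum_n by simp
      moreover have "\<alpha> j = [] \<and> n j = 0" if "N < j"
        using that \<alpha>(1) by (simp add: tuples_def n_def)
      ultimately show ?thesis
        using len[of j] by (cases "j \<le> N") (auto simp: ctype_def)
    qed
    hence ctype: "ctype N d \<alpha> = n" by blast
    have "\<exists>p. p permutes {..<n j} \<and> permute_list p (l j) = sort (l j)" for j
    proof -
      have "length (l j) = n j" by (simp add: l_def)
      moreover obtain p where "p permutes {..<length (l j)}" "permute_list p (l j) = sort (l j)"
        using mset_eq_permutation[of "sort (l j)" "l j"] by auto
      ultimately show ?thesis by auto
    qed
    then obtain p where p: "\<And>j. p j permutes {..<n j}" "\<And>j. permute_list (p j) (l j) = sort (l j)"
      by metis
    define \<pi> where "\<pi> = (\<lambda>v. if v \<in> rvars N n then (fst v, p (fst v) (snd v)) else v)"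
    have mem: "\<pi> v \<in> rvars N n" if "v \<in> rvars N n" for v
      using that permutes_in_image[OF p(1)] by (auto simp: \<pi>_def rvars_def)
    have "cexp N d \<alpha> = \<epsilon> \<circ> \<pi>"
    proof
      fix v :: "nat \<times> nat"
      obtain j i where v: "v = (j, i)" by (cases v)
      show "cexp N d \<alpha> v = (\<epsilon> \<circ> \<pi>) v"
      proof (cases "v \<in> rvars N n")
        case True
        hence ji: "j \<in> {1..N}" "i < n j" by (auto simp: v rvars_def)
        have "p j i < n j"
          using permutes_in_image[OF p(1), of j i] ji by simp
        hence "permute_list (p j) (l j) ! i = \<epsilon> (j, p j i)"
          using p(1)[of j] ji by (subst permute_list_nth) (simp_all add: l_def)
        thus ?thesis
          using True ji by (simp add: cexp_def ctype v \<alpha>(2) p(2) \<pi>_def)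
      next
        case False
        have "\<epsilon> \<in> exps (rvars N n)"
          using \<epsilon>(1) supp_exps[OF finite_rvars polyf_rec_eval[OF G, of n]] by blast
        thus ?thesis
          using False by (simp add: cexp_def ctype \<pi>_def exps_def v)
      qed
    qed
    moreover have "cf (rvars N n) (rec_eval n G) (\<epsilon> \<circ> \<pi>) = cf (rvars N n) (rec_eval n G) \<epsilon>"
    proof (rule cf_permute[OF finite_rvars polyf_rec_eval[OF G]])
      have "inj_on \<pi> (rvars N n)"
        using permutes_inj[OF p(1)] by (auto simp: inj_on_def \<pi>_def inj_def)
      moreover have "\<pi> ` rvars N n \<subseteq> rvars N n"
        using mem by blast
      ultimately show "bij_betw \<pi> (rvars N n) (rvars N n)"
        by (simp add: bij_betw_def endo_inj_surj)
      show "rec_eval n G (w \<circ> \<pi>) = rec_eval n G w" for w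
      proof -
        have "n j = 0" if "N < j" for j
          using that by (simp add: n_def)
        thus ?thesis
          unfolding \<pi>_def using p(1) by (intro rec_eval_permute)
      qed
    qed (simp add: \<pi>_def)
    ultimately have "functional N k d \<alpha> F = cf (rvars N n) (rec_eval n G) \<epsilon>"
      by (simp add: functional_def ctype G_def)
    thus False
      using zero[OF \<alpha>(1)] \<epsilon>(1) by (simp add: supp_def)
  qed
  thus ?thesis
    using polyf_expand[OF V pF, of x] by simp
qed

text \<open>An injective square system is solvable; the enumeration \<open>h\<close> of
  \<open>A\<close> transports this statement from matrices.\<close>

lemma square_system_solvable:
  fixes M :: "'a \<Rightarrow> 'a \<Rightarrow> complex"
  assumes "finite A" and ker: "\<And>c. (\<And>b. b \<in> A \<Longrightarrow> (\<Sum>a\<in>A. c a * M a b) = 0) \<Longrightarrow> (\<And>a. a \<in> A \<Longrightarrow> c a = 0)"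
  shows "\<exists>c. \<forall>b\<in>A. (\<Sum>a\<in>A. c a * M a b) = u b"
proof -
  define n where "n = card A"
  obtain h where h: "bij_betw h {0..<n} A"
    using ex_bij_betw_nat_finite[OF assms(1)] unfolding n_def by blast
  define g where "g = inv_into {0..<n} h"
  have gh: "g (h i) = i" if "i < n" for i
    using h that by (simp add: g_def bij_betw_inv_into_left)
  define B where "B = Matrix.mat n n (\<lambda>(i, j). M (h j) (h i))"
  have B: "B \<in> carrier_mat n n" by (simp add: B_def)
  have mult: "vec_index (B *\<^sub>v v) i = (\<Sum>a\<in>A. vec_index v (g a) * M a (h i))" if "i < n" "v \<in> carrier_vec n" for i v
  proof -
    have "vec_index (B *\<^sub>v v) i = (\<Sum>j\<in>{0..<n}. M (h j) (h i) * vec_index v j)"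
      using that by (simp add: B_def scalar_prod_def)
    also have "\<dots> = (\<Sum>j\<in>{0..<n}. vec_index v (g (h j)) * M (h j) (h i))"
      by (intro sum.cong) (auto simp: gh)
    also have "\<dots> = (\<Sum>a\<in>A. vec_index v (g a) * M a (h i))"
      by (rule sum.reindex_bij_betw[OF h])
    finally show ?thesis .
  qed
  have hA: "\<exists>i<n. b = h i" if "b \<in> A" for b
    using h that by (auto simp: bij_betw_def)
  have "Determinant.det B \<noteq> 0"
  proof
    assume "Determinant.det B = 0"
    then obtain v where v: "v \<in> carrier_vec n" "v \<noteq> 0\<^sub>v n" "B *\<^sub>v v = 0\<^sub>v n"
      using det_0_iff_vec_prod_zero_field[OF B] by blast
    have "(\<Sum>a\<in>A. vec_index v (g a) * M a b) = 0" if b: "b \<in> A" for b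
    proof -
      obtain i where "i < n" "b = h i" using hA[OF b] by blast
      thus ?thesis using mult[of i v] v by simp
    qed
    hence zero: "vec_index v (g a) = 0" if "a \<in> A" for a
      using ker[of "\<lambda>a. vec_index v (g a)"] that by blast
    have "v = 0\<^sub>v n"
    proof (rule eq_vecI)
      fix i assume "i < dim_vec (0\<^sub>v n :: complex Matrix.vec)"
      hence "i < n" by simp
      thus "vec_index v i = vec_index (0\<^sub>v n) i"
        using zero[of "h i"] gh[of i] h by (auto simp: bij_betw_def)
    qed (use v in simp)
    thus False using v by simp
  qed
  hence "B \<in> Units (ring_mat TYPE(complex) n ())"
    by (rule det_non_zero_imp_unit[OF B])
  then obtain C where C: "C \<in> carrier_mat n n" "B * C = 1\<^sub>m n"
    unfolding Units_def by (auto simp: ring_mat_simps)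
  define U where "U = Matrix.vec n (\<lambda>i. u (h i))"
  have U: "U \<in> carrier_vec n" by (simp add: U_def)
  have CU: "C *\<^sub>v U \<in> carrier_vec n"
    using C(1) U by simp
  have "B *\<^sub>v (C *\<^sub>v U) = U"
    using assoc_mult_mat_vec[OF B C(1) U] C(2) U by simp
  hence "(\<Sum>a\<in>A. vec_index (C *\<^sub>v U) (g a) * M a b) = u b" if b: "b \<in> A" for b
  proof -
    obtain i where "i < n" "b = h i" using hA[OF b] by blast
    thus ?thesis
      using mult[OF _ CU, of i] \<open>B *\<^sub>v (C *\<^sub>v U) = U\<close> by (simp add: U_def)
  qed
  thus ?thesis
    by (intro exI[of _ "\<lambda>a. vec_index (C *\<^sub>v U) (g a)"]) blast
qed

lemma invariantI:
  assumes "polyf (jvars {0..N} k) F"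
    and "\<And>lam A. fps_nth lam 0 = 1 \<Longrightarrow> F (pt (\<lambda>j. lam * A j)) = F (pt A)"
  shows "invariant N F"
  unfolding invariant_def
proof (intro allI impI)
  fix lam :: "complex fps" and A assume "fps_nth lam 0 = 1"
  moreover have "F (pt (\<lambda>j. if j \<le> N then lam * A j else A j)) = F (pt (\<lambda>j. lam * A j))"
    by (rule polyf_cong_vars[OF _ assms(1)]) (auto simp: jvars_def)
  ultimately show "F (pt (\<lambda>j. if j \<le> N then lam * A j else A j)) = F (pt A)"
    using assms(2) by simp
qed

lemma homog_hdet:
  assumes \<alpha>: "\<alpha> \<in> tuples N 0 d" and "k \<ge> d - 1"
  shows "homog N k d (hdet N d \<alpha>)"
  unfolding homog_def
proof (intro conjI allI)
  show pf: "polyf (jvars {0..N} k) (hdet N d \<alpha>)"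
    using assms(2) by (intro polyf_hdet[OF \<alpha>, of _ "\<lambda>x. x"] polyf_var) (auto simp: jvars_def)
  show "invariant N (hdet N d \<alpha>)"
    by (rule invariantI[OF pf]) (simp add: hdet_mult[OF \<alpha>])
  fix c x
  have "pt (\<lambda>j. fps_const c * jf (\<lambda>l. x (j, l))) = (\<lambda>v. c * x v)"
    by (auto simp: fun_eq_iff)
  thus "hdet N d \<alpha> (\<lambda>v. c * x v) = c ^ d * hdet N d \<alpha> x"
    using hdet_mult[OF \<alpha>, of "fps_const c" "\<lambda>j. jf (\<lambda>l. x (j, l))"] by (simp add: pt_jf)
qed

text \<open>Where the constant term of \<open>A 0\<close> is nonzero, the formula for
  \<open>F\<close> shows how it reacts to every series \<open>lam\<close> with nonzero constant
  term. The exceptional points are reached by continuity along lines.\<close>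

lemma homog_homogenisation:
  assumes F: "polyf (jvars {0..N} k) F"
    "\<And>A. fps_nth (A 0) 0 \<noteq> 0 \<Longrightarrow> F (pt A) = fps_nth (A 0) 0 ^ d * f (pt (\<lambda>m. A m * inverse (A 0)))"
  shows "homog N k d F"
  unfolding homog_def
proof (intro conjI allI)
  have V: "finite (jvars {0..N} k)" by simp
  have mult: "F (pt (\<lambda>j. lam * A j)) = fps_nth lam 0 ^ d * F (pt A)"
    if "fps_nth (A 0) 0 \<noteq> 0" "fps_nth lam 0 \<noteq> 0" for lam A
  proof -
    have "lam * A m * inverse (lam * A 0) = A m * inverse (A 0)" for m
    proof -
      have "lam * A m * inverse (lam * A 0) = (lam * inverse lam) * (A m * inverse (A 0))"
        by (simp add: fps_inverse_mult mult_ac)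
      thus ?thesis using that(2) by (simp add: inverse_mult_eq_1')
    qed
    hence "(\<lambda>m. lam * A m * inverse (lam * A 0)) = (\<lambda>m. A m * inverse (A 0))"
      by blast
    moreover have "F (pt (\<lambda>j. lam * A j)) = fps_nth (lam * A 0) 0 ^ d * f (pt (\<lambda>m. lam * A m * inverse (lam * A 0)))"
      using F(2)[of "\<lambda>j. lam * A j"] that by simp
    ultimately show ?thesis
      using F(2)[of A] that by (simp add: power_mult_distrib)
  qed
  show "polyf (jvars {0..N} k) F" by (rule F(1))
  show "invariant N F"
  proof (rule invariantI[OF F(1)])
    fix lam :: "complex fps" and A :: "nat \<Rightarrow> complex fps" assume lam: "fps_nth lam 0 = 1"
    \<comment> \<open>Only the constant term of \<open>A 0\<close> is moved, and a single value of
      \<open>z\<close> makes it vanish.\<close>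
    define B where "B = (\<lambda>z. A(0 := A 0 + fps_const z))"
    define h where "h = (\<lambda>z. F (pt (\<lambda>j. lam * B z j)) - F (pt (B z)))"
    have B: "continuous_on UNIV (\<lambda>z. fps_nth (B z j) n)" for j n
      by (cases "j = 0"; cases "n = 0") (auto simp: B_def intro!: continuous_intros)
    have "continuous_on UNIV (\<lambda>z. pt (\<lambda>j. lam * B z j) v)" "continuous_on UNIV (\<lambda>z. pt (B z) v)" for v
      unfolding pt_def case_prod_unfold
      by (intro continuous_intros continuous_on_fps_mult_nth B)+
    hence "continuous_on UNIV h"
      unfolding h_def
      by (intro continuous_on_diff polyf_continuous[OF V F(1), where g = "\<lambda>z. pt (\<lambda>j. lam * B z j)"]
          polyf_continuous[OF V F(1), where g = "\<lambda>z. pt (B z)"])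
    moreover have "h z = 0" if "z \<notin> {- fps_nth (A 0) 0}" for z
      using mult[of "B z" lam] lam that by (simp add: h_def B_def eq_neg_iff_add_eq_0 add.commute)
    ultimately have "h 0 = 0"
      using continuous_zero_off_finite[of h "{- fps_nth (A 0) 0}"] by blast
    moreover have "B 0 = A"
      by (auto simp: B_def)
    ultimately show "F (pt (\<lambda>j. lam * A j)) = F (pt A)"
      by (simp add: h_def)
  qed
  fix c x
  have 1: "F (\<lambda>v. c * x v) = c ^ d * F x" if "x (0, 0) \<noteq> 0" "c \<noteq> 0" for c x
  proof -
    have "pt (\<lambda>j. fps_const c * jf (\<lambda>l. x (j, l))) = (\<lambda>v. c * x v)"
      by (auto simp: fun_eq_iff)
    thus ?thesis
      using mult[of "\<lambda>j. jf (\<lambda>l. x (j, l))" "fps_const c"] that by (simp add: pt_jf)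
  qed
  have 2: "F (\<lambda>v. c * x v) = c ^ d * F x" if "c \<noteq> 0" for c x
  proof -
    define h where "h = (\<lambda>z. F (\<lambda>v. c * (x((0, 0) := z)) v) - c ^ d * F (x((0, 0) := z)))"
    have "continuous_on UNIV h"
      unfolding h_def
      by (intro continuous_intros continuous_on_upd
          polyf_continuous[OF V F(1), where g = "\<lambda>z v. c * (x((0, 0) := z)) v"]
          polyf_continuous[OF V F(1), where g = "\<lambda>z. x((0, 0) := z)"])
    moreover have "h z = 0" if "z \<notin> {0}" for z
      using 1[of "x((0, 0) := z)" c] that \<open>c \<noteq> 0\<close> by (simp only: h_def) simp
    ultimately have "h (x (0, 0)) = 0"
      using continuous_zero_off_finite[of h "{0}"] by blast
    thus ?thesis
      unfolding h_def fun_upd_triv by simp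
  qed
  \<comment> \<open>Scaling by 0 leaves the locus treated so far and is reached by continuity in
    \<open>c\<close>.\<close>
  define h where "h = (\<lambda>c. F (\<lambda>v. c * x v) - c ^ d * F x)"
  have "continuous_on UNIV h"
    unfolding h_def
    by (intro continuous_intros polyf_continuous[OF V F(1), where g = "\<lambda>c v. c * x v"])
  moreover have "h c = 0" if "c \<notin> {0}" for c
    using 2[of c x] that by (simp add: h_def)
  ultimately have "h c = 0"
    using continuous_zero_off_finite[of h "{0}"] by blast
  thus "F (\<lambda>v. c * x v) = c ^ d * F x"
    by (simp add: h_def)
qed

text \<open>Homogenise \<open>f\<close>, solve the square system for a combination of determinants
  with the same functionals, and apply \<open>functionals_separate\<close> to the
  difference.\<close>

lemma GG_H0_combination:
  assumes "N \<ge> 1" "k \<ge> d - 1" "f \<in> GG_H0 N k d"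
  shows "\<exists>c. f = (\<lambda>\<xi>. \<Sum>\<alpha>\<in>tuples N 0 d. c \<alpha> * det_Delta0 N \<alpha> \<xi>)"
proof -
  let ?T = "tuples N 0 d"
  have T: "finite ?T" using card_tuples by blast
  obtain s where s: "global_section N k d s" "f = s 0"
    using assms(3) by (auto simp: GG_H0_def)
  obtain F where F: "polyf (jvars {0..N} k) F" "\<And>A. fps_nth (A 0) 0 \<noteq> 0 \<Longrightarrow>
      F (pt A) = fps_nth (A 0) 0 ^ d * f (curry (pt (\<lambda>m. A m * inverse (A 0))))"
    using global_section_homogenise[OF s(1) assms(1)] unfolding s(2) by blast
  have hF: "homog N k d F"
    using F(2) by (rule homog_homogenisation[OF F(1), where f = "\<lambda>x. f (curry x)"])
  have Ff: "F (pt (hom_coord 0 \<xi>)) = f \<xi>" for \<xi>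
  proof -
    have GG: "GG_sum_section N k 0 f"
      using s unfolding global_section_def by blast
    have "F (pt (hom_coord 0 \<xi>)) = f (curry (pt (\<lambda>m. hom_coord 0 \<xi> m * inverse (hom_coord 0 \<xi> 0))))"
      using F(2)[of "hom_coord 0 \<xi>"] by (simp add: hom_coord_def)
    also have "\<dots> = f (curry (case_prod \<xi>))"
      by (rule GG_sum_section_depends[OF GG]) (auto simp: jvars_def chart_def hom_coord_def split: if_splits)
    finally show ?thesis by simp
  qed
  have comb: "homog N k d (\<lambda>x. \<Sum>\<alpha>\<in>?T. c \<alpha> * hdet N d \<alpha> x) \<and>
      functional N k d \<beta> (\<lambda>x. \<Sum>\<alpha>\<in>?T. c \<alpha> * hdet N d \<alpha> x) =
        (\<Sum>\<alpha>\<in>?T. c \<alpha> * functional N k d \<beta> (hdet N d \<alpha>))" for c \<beta>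
    by (rule homog_sum[OF T homog_hdet[OF _ assms(2)]])
  have "\<exists>c. \<forall>\<beta>\<in>?T. (\<Sum>\<alpha>\<in>?T. c \<alpha> * functional N k d \<beta> (hdet N d \<alpha>)) = functional N k d \<beta> F"
  proof (rule square_system_solvable[OF T])
    fix c \<alpha>
    assume zero: "\<And>\<beta>. \<beta> \<in> ?T \<Longrightarrow> (\<Sum>\<alpha>\<in>?T. c \<alpha> * functional N k d \<beta> (hdet N d \<alpha>)) = 0" and \<alpha>: "\<alpha> \<in> ?T"
    define G where "G = (\<lambda>x. \<Sum>\<alpha>\<in>?T. c \<alpha> * hdet N d \<alpha> x)"
    have "homog N k d G" "functional N k d \<beta> G = (\<Sum>\<alpha>\<in>?T. c \<alpha> * functional N k d \<beta> (hdet N d \<alpha>))" for \<beta>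
      unfolding G_def using comb by blast+
    hence "G x = 0" for x
      using functionals_separate[of N k d G] zero by simp
    hence "(\<Sum>\<alpha>\<in>?T. c \<alpha> * det_Delta0 N \<alpha> \<xi>) = 0" for \<xi>
      using hdet_hom_coord_0[of _ N d \<xi>] unfolding G_def by (metis (mono_tags, lifting) sum.cong)
    thus "c \<alpha> = 0"
      using \<alpha> by (rule det_Delta0_independent)
  qed
  then obtain c where c: "\<And>\<beta>. \<beta> \<in> ?T \<Longrightarrow>
      (\<Sum>\<alpha>\<in>?T. c \<alpha> * functional N k d \<beta> (hdet N d \<alpha>)) = functional N k d \<beta> F"
    by blast
  define G where "G = (\<lambda>x. \<Sum>\<alpha>\<in>?T. c \<alpha> * hdet N d \<alpha> x)"
  have G: "homog N k d G" "functional N k d \<beta> G = (\<Sum>\<alpha>\<in>?T. c \<alpha> * functional N k d \<beta> (hdet N d \<alpha>))" for \<beta>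
    unfolding G_def using comb by blast+
  have "1 * F x + (- 1) * G x = 0" for x
  proof (rule functionals_separate[of N k d "\<lambda>x. 1 * F x + (- 1) * G x"])
    show "homog N k d (\<lambda>x. 1 * F x + (- 1) * G x)"
      by (rule homog_linear[OF hF G(1)])
    show "functional N k d \<beta> (\<lambda>x. 1 * F x + (- 1) * G x) = 0" if "\<beta> \<in> ?T" for \<beta>
      using functional_linear[of N k F G d \<beta> 1 "- 1"] F(1) G c[OF that] by (simp add: homog_def)
  qed
  hence "F x = G x" for x by simp
  hence "f \<xi> = (\<Sum>\<alpha>\<in>?T. c \<alpha> * det_Delta0 N \<alpha> \<xi>)" for \<xi>
    using Ff[of \<xi>] by (simp add: G_def hdet_hom_coord_0)
  thus ?thesis by blast
qed

lemma sum_fun_apply: "(\<Sum>i\<in>I. f i) x = (\<Sum>i\<in>I. f i x)"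
  by (induction I rule: infinite_finite_induct) simp_all

theorem theorem1p6:
  fixes N d k :: nat
  assumes "N \<ge> 1" and "d \<ge> 1" and "k \<ge> d - 1"
  defines "A \<equiv> {\<alpha> \<in> BNplus N. max_entry N \<alpha> \<le> int d - 1}"
  shows "card A = (N + 1) ^ d \<and>
    inj_on (det_Delta0 N) A \<and>
    jetfun.independent (det_Delta0 N ` A) \<and>
    jetfun.span (det_Delta0 N ` A) = GG_H0 N k d"
proof -
  have A: "A = tuples N 0 d"
    unfolding A_def by (rule tuples_eq)
  have fin: "finite A" and card: "card A = (N + 1) ^ d"
    using card_tuples[of N 0 d] by (simp_all add: A)
  have indep: "c \<alpha> = 0" if "\<And>\<xi>. (\<Sum>\<alpha>\<in>A. c \<alpha> * det_Delta0 N \<alpha> \<xi>) = 0" "\<alpha> \<in> A" for c \<alpha>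
    using that unfolding A by (rule det_Delta0_independent)
  have inj: "inj_on (det_Delta0 N) A"
  proof (rule inj_onI, rule ccontr)
    fix \<alpha> \<beta> assume ab: "\<alpha> \<in> A" "\<beta> \<in> A" "det_Delta0 N \<alpha> = det_Delta0 N \<beta>" "\<alpha> \<noteq> \<beta>"
    \<comment> \<open>Equal determinants for two tuples would be a nontrivial relation, so
      independence of the indexed family also yields injectivity.\<close>
    define c :: "(nat \<Rightarrow> nat list) \<Rightarrow> complex" where "c = (\<lambda>\<gamma>. (if \<gamma> = \<alpha> then 1 else 0) - (if \<gamma> = \<beta> then 1 else 0))"
    have "(\<Sum>\<gamma>\<in>A. c \<gamma> * det_Delta0 N \<gamma> \<xi>) = 0" for \<xi>
    proof -
      have "(\<Sum>\<gamma>\<in>A. (if \<gamma> = \<delta> then 1 else 0) * det_Delta0 N \<gamma> \<xi>) = det_Delta0 N \<delta> \<xi>" if "\<delta> \<in> A" for \<delta>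
        using fin that by (simp add: if_distrib[of "\<lambda>x. x * _"] cong: if_cong)
      thus ?thesis
        using ab(1-3) by (simp add: c_def left_diff_distrib sum_subtractf)
    qed
    hence "c \<alpha> = 0" using indep ab(1) by blast
    thus False using ab(4) by (simp add: c_def)
  qed
  have scalars: "u x = 0"
    if zero: "(\<Sum>x\<in>det_Delta0 N ` A. jscale (u x) x) = 0" and x: "x \<in> det_Delta0 N ` A" for u x
  proof -
    obtain \<alpha> where \<alpha>: "\<alpha> \<in> A" "x = det_Delta0 N \<alpha>" using x by blast
    have "(\<Sum>\<alpha>\<in>A. jscale (u (det_Delta0 N \<alpha>)) (det_Delta0 N \<alpha>)) = 0"
      using zero by (simp add: sum.reindex[OF inj])
    hence "(\<Sum>\<alpha>\<in>A. u (det_Delta0 N \<alpha>) * det_Delta0 N \<alpha> \<xi>) = 0" for \<xi>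
      by (simp add: fun_eq_iff sum_fun_apply jscale_def)
    thus "u x = 0"
      using indep[of "\<lambda>\<alpha>. u (det_Delta0 N \<alpha>)" \<alpha>] \<alpha> by simp
  qed
  have independent: "jetfun.independent (det_Delta0 N ` A)"
  proof
    assume "jetfun.dependent (det_Delta0 N ` A)"
    then obtain u v where uv: "v \<in> det_Delta0 N ` A" "u v \<noteq> 0"
        "(\<Sum>v\<in>det_Delta0 N ` A. jscale (u v) v) = 0"
      unfolding jetfun.dependent_finite[OF finite_imageI[OF fin]] by blast
    show False
      using scalars[OF uv(3,1)] uv(2) by contradiction
  qed
  have "jetfun.span (det_Delta0 N ` A) = GG_H0 N k d"
  proof
    have "det_Delta0 N ` A \<subseteq> GG_H0 N k d"
      unfolding A using det_Delta0_in_GG_H0[OF _ assms(3)] by blast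
    thus "jetfun.span (det_Delta0 N ` A) \<subseteq> GG_H0 N k d"
      by (rule jetfun.span_minimal[OF _ subspace_GG_H0])
    show "GG_H0 N k d \<subseteq> jetfun.span (det_Delta0 N ` A)"
    proof
      fix f assume "f \<in> GG_H0 N k d"
      then obtain c where c: "f = (\<lambda>\<xi>. \<Sum>\<alpha>\<in>A. c \<alpha> * det_Delta0 N \<alpha> \<xi>)"
        using GG_H0_combination[OF assms(1,3)] unfolding A by blast
      have "f = (\<Sum>\<alpha>\<in>A. jscale (c \<alpha>) (det_Delta0 N \<alpha>))"
        unfolding c by (simp add: fun_eq_iff sum_fun_apply jscale_def)
      also have "\<dots> \<in> jetfun.span (det_Delta0 N ` A)"
        by (intro jetfun.span_sum jetfun.span_scale jetfun.span_base) auto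
      finally show "f \<in> jetfun.span (det_Delta0 N ` A)" .
    qed
  qed
  thus ?thesis
    using card inj independent by blast
qed

end
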